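(* For each $n\ge 1$, let $K_n$ be the transition matrix of an irreducible birth and death chain on $\mathcal{X}_n=\{0,1,\dots,n\}$ with stationary distribution $\pi_n$, and let $\lambda_n$ be the smallest non-zero eigenvalue of $I-K_n$. Let $\tau^{(n)}_i$ and $\widetilde{\tau}^{(n)}_i$ be the first hitting times of state $i$ by the discrete time chain with transition matrix $K_n$ and by the associated continuous time chain. For each $n\ge 1$ let $M_n\in\{0,1,\dots,n\}$ and set \[ s_n=\mathbb{E}_0\widetilde{\tau}^{(n)}_{M_n}+\mathbb{E}_n\widetilde{\tau}^{(n)}_{M_n}=\mathbb{E}_0\tau^{(n)}_{M_n}+\mathbb{E}_n\tau^{(n)}_{M_n}, \] \[ b_n^2=\mathrm{Var}_0\widetilde{\tau}^{(n)}_{M_n}+\mathrm{Var}_n\widetilde{\tau}^{(n)}_{M_n},\qquad c_n^2=\mathrm{Var}_0\tau^{(n)}_{M_n}+\mathrm{Var}_n\tau^{(n)}_{M_n}. \] Suppose that $\inf_{n\ge 1}\pi_n([0,M_n])>0$ and $\inf_{n\ge 1}\pi_n([M_n,n])>0$. Let $\mathcal{F}^L$ be the family of the discrete time chains $(\mathcal{X}_n,K_n,\pi_n)_{n=1}^\infty$ all started at the left boundary state $0$, and let $\mathcal{F}_c^L$ be the family of the associated continuous time chains started at $0$. Then: (1) $\mathcal{F}_c^L$ has a separation cutoff if and only if $s_n\lambda_n\to\infty$, if and only if $s_n/b_n\to\infty$. Furthermore, if $s_n/b_n\to\infty$, then $\mathcal{F}_c^L$ has a $(s_n,b_n)$ separation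 cutoff. (2) Assume that $K_n(i,i+1)+K_n(i+1,i)\le 1$ for all $n\ge1$ and $0\le i<n$. Then $\mathcal{F}^L$ has a separation cutoff if and only if $s_n\lambda_n\to\infty$, if and only if $s_n/c_n\to\infty$. Furthermore, if $s_n/c_n\to\infty$, then $\mathcal{F}^L$ has a $(s_n,\max\{c_n,1/\lambda_n\})$ separation cutoff.
   Context: A birth and death chain on $\{0,1,\dots,n\}$ is a Markov chain with transition matrix $K$ such that $K(i,i+1)=p_i$, $K(i,i-1)=q_i$, $K(i,i)=r_i$, $p_i+q_i+r_i=1$, $p_n=q_0=0$ (all other entries zero); it is irreducible iff $p_iq_{i+1}>0$ for $0\le i<n$. The associated continuous time chain has semigroup $H_t=e^{-t(I-K)}$; it is realized as $X_{N_t}$, where $(X_m)$ is the discrete time chain and $N_t$ is an independent Poisson process with parameter $1$. For the $n$th chain, $\tau^{(n)}_i=\inf\{m\ge 0: X^{(n)}_m=i\}$ and $\widetilde{\tau}^{(n)}_i=\inf\{t\ge 0: X^{(n)}_{N_t}=i\}$. $\mathbb{E}_j,\mathrm{Var}_j$ are expectation and variance given $X_0^{(n)}=j$. $[a,b]$ denotes the integers from $a$ to $b$. Separation of a probability $\mu$ with respect to $\nu$ is $\mathrm{sep}(\mu,\nu)=\max_{x}\{1-\mu(x)/\nu(x)\}$. Separation from initial state $x$ is $d_n(x,m)=\mathrm{sep}(K_n^m(x,\cdot),\pi_n)$ in discrete time and $\mathrm{sep}(H_{n,t}(x,\cdot),\pi_n)$ in continuous time. For a given distance function $d_n$ (here,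 separation from state $0$), the mixing time is $T_n(\epsilon)=\min\{m\ge0: d_n(m)\le\epsilon\}$ over integers $m$ in discrete time, and $T_n(\epsilon)=\inf\{t\ge0: d_n(t)\le\epsilon\}$ in continuous time. The family has a cutoff if there is a sequence $t_n>0$ with $\lim_{n}T_n(\epsilon)/t_n=1$ for all $\epsilon\in(0,1)$. It has a $(t_n,b_n)$ cutoff if it has a cutoff, $t_n>0$, $b_n>0$, $b_n/t_n\to0$ and $\limsup_n|T_n(\epsilon)-t_n|/b_n<\infty$ for all $\epsilon\in(0,1)$. *)

theory Defs
  imports "HOL-Probability.Probability" "Jordan_Normal_Form.Char_Poly"
begin

definition birth_death :: "nat \<Rightarrow> real mat \<Rightarrow> bool" where
  "birth_death n K \<longleftrightarrow>
     (\<exists>p q r :: nat \<Rightarrow> real.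
        (\<forall>i\<le>n. p i \<ge> 0 \<and> q i \<ge> 0 \<and> r i \<ge> 0 \<and> p i + q i + r i = 1) \<and>
        p n = 0 \<and> q 0 = 0 \<and>
        K = mat (Suc n) (Suc n) (\<lambda>(i, j).
              if j = Suc i then p i else if i = Suc j then q i else if j = i then r i else 0))"

definition irreducible_matrix :: "real mat \<Rightarrow> bool" where
  "irreducible_matrix K \<longleftrightarrow>
     (\<forall>i<dim_row K. \<forall>j<dim_row K. \<exists>m. (K ^\<^sub>m m) $$ (i, j) > 0)"

definition stationary :: "nat \<Rightarrow> real mat \<Rightarrow> (nat \<Rightarrow> real) \<Rightarrow> bool" where
  "stationary n K \<pi> \<longleftrightarrow>
     (\<forall>x\<le>n. \<pi> x \<ge> 0) \<and> (\<Sum>x\<le>n. \<pi> x) = 1 \<and>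
     (\<forall>y\<le>n. (\<Sum>x\<le>n. \<pi> x * K $$ (x, y)) = \<pi> y)"

text \<open>The eigenvalues of \<open>I - K\<close> are real for a birth and death chain (\<open>K\<close> is reversible), so
  ranging over real eigenvalues loses nothing.\<close>

definition spectral_gap :: "nat \<Rightarrow> real mat \<Rightarrow> real" where
  "spectral_gap n K = Min {l. eigenvalue (1\<^sub>m (Suc n) - K) l \<and> l \<noteq> 0}"

text \<open>Matrices with variable dimension carry no topology in the library; the exponential series
  is summed entrywise.\<close>

definition mat_exp :: "real mat \<Rightarrow> real mat" where
  "mat_exp A = mat (dim_row A) (dim_row A) (\<lambda>(i, j). \<Sum>k. (A ^\<^sub>m k) $$ (i, j) / fact k)"

definition heat_semigroup :: "nat \<Rightarrow> real mat \<Rightarrow> real \<Rightarrow> real mat" where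
  "heat_semigroup n K t = mat_exp ((- t) \<cdot>\<^sub>m (1\<^sub>m (Suc n) - K))"

definition sep :: "nat \<Rightarrow> (nat \<Rightarrow> real) \<Rightarrow> (nat \<Rightarrow> real) \<Rightarrow> real" where
  "sep n \<mu> \<nu> = Max ((\<lambda>x. 1 - \<mu> x / \<nu> x) ` {0..n})"

definition sep_discrete :: "nat \<Rightarrow> real mat \<Rightarrow> (nat \<Rightarrow> real) \<Rightarrow> nat \<Rightarrow> nat \<Rightarrow> real" where
  "sep_discrete n K \<pi> x m = sep n (\<lambda>y. (K ^\<^sub>m m) $$ (x, y)) \<pi>"

definition sep_continuous :: "nat \<Rightarrow> real mat \<Rightarrow> (nat \<Rightarrow> real) \<Rightarrow> nat \<Rightarrow> real \<Rightarrow> real" where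
  "sep_continuous n K \<pi> x t = sep n (\<lambda>y. heat_semigroup n K t $$ (x, y)) \<pi>"

text \<open>The minimum and infimum below are meant for distances that eventually drop below every
  positive \<open>\<epsilon>\<close>. This holds for irreducible chains in continuous time, and in discrete
  time whenever \<open>K(i,i+1) + K(i+1,i) \<le> 1\<close>, which forces \<open>K(0,0) > 0\<close>.\<close>

definition mixing_time_discrete :: "(nat \<Rightarrow> real) \<Rightarrow> real \<Rightarrow> real" where
  "mixing_time_discrete d \<epsilon> = real (LEAST m. d m \<le> \<epsilon>)"

definition mixing_time_continuous :: "(real \<Rightarrow> real) \<Rightarrow> real \<Rightarrow> real" where
  "mixing_time_continuous d \<epsilon> = Inf {t. 0 \<le> t \<and> d t \<le> \<epsilon>}"

text \<open>Families are indexed by \<open>n \<ge> 1\<close>; \<open>T n \<epsilon>\<close> is the \<open>\<epsilon>\<close>-mixing time of the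
  \<open>n\<close>th chain.\<close>

definition has_cutoff :: "(nat \<Rightarrow> real \<Rightarrow> real) \<Rightarrow> bool" where
  "has_cutoff T \<longleftrightarrow>
     (\<exists>t. (\<forall>n\<ge>1. t n > 0) \<and>
          (\<forall>\<epsilon>. 0 < \<epsilon> \<and> \<epsilon> < 1 \<longrightarrow> (\<lambda>n. T n \<epsilon> / t n) \<longlonglongrightarrow> 1))"

definition has_window_cutoff ::
    "(nat \<Rightarrow> real \<Rightarrow> real) \<Rightarrow> (nat \<Rightarrow> real) \<Rightarrow> (nat \<Rightarrow> real) \<Rightarrow> bool" where
  "has_window_cutoff T t b \<longleftrightarrow>
     has_cutoff T \<and> (\<forall>n\<ge>1. t n > 0 \<and> b n > 0) \<and> (\<lambda>n. b n / t n) \<longlonglongrightarrow> 0 \<and>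
     (\<forall>\<epsilon>. 0 < \<epsilon> \<and> \<epsilon> < 1 \<longrightarrow> limsup (\<lambda>n. ereal (\<bar>T n \<epsilon> - t n\<bar> / b n)) < \<infinity>)"

definition markov_chain ::
    "'a measure \<Rightarrow> nat \<Rightarrow> real mat \<Rightarrow> nat \<Rightarrow> (nat \<Rightarrow> 'a \<Rightarrow> nat) \<Rightarrow> bool" where
  "markov_chain P n K j X \<longleftrightarrow>
     prob_space P \<and>
     (\<forall>m. X m \<in> measurable P (count_space {0..n})) \<and>
     (AE \<omega> in P. X 0 \<omega> = j) \<and>
     (\<forall>m x. \<forall>y\<le>n.
        \<P>(\<omega> in P. \<forall>k\<le>m. X k \<omega> = x k) > 0 \<longrightarrow>
        \<P>(\<omega> in P. X (Suc m) \<omega> = y \<bar> \<forall>k\<le>m. X k \<omega> = x k) = K $$ (x m, y))"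

text \<open>Poisson process with parameter 1 and regular paths; the topology on \<open>nat\<close> is discrete, so
  right-continuity makes the paths piecewise constant. Only times \<open>t \<ge> 0\<close> matter. The
  subtractions of naturals do not truncate, since paths are nondecreasing.\<close>

definition poisson_process :: "'a measure \<Rightarrow> (real \<Rightarrow> 'a \<Rightarrow> nat) \<Rightarrow> bool" where
  "poisson_process P N \<longleftrightarrow>
     prob_space P \<and>
     (\<forall>t\<ge>0. N t \<in> measurable P (count_space UNIV)) \<and>
     (\<forall>\<omega>\<in>space P. N 0 \<omega> = 0 \<and> mono_on {0..} (\<lambda>t. N t \<omega>) \<and>
        (\<forall>t\<ge>0. continuous (at_right t) (\<lambda>s. N s \<omega>))) \<and>
     (\<forall>s t. 0 \<le> s \<and> s < t \<longrightarrow>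
        distr P (count_space UNIV) (\<lambda>\<omega>. N t \<omega> - N s \<omega>) = measure_pmf (poisson_pmf (t - s))) \<and>
     (\<forall>(t :: nat \<Rightarrow> real) m. 0 \<le> t 0 \<and> mono t \<longrightarrow>
        prob_space.indep_vars P (\<lambda>_. count_space UNIV)
          (\<lambda>k \<omega>. N (t (Suc k)) \<omega> - N (t k) \<omega>) {..<m})"

text \<open>Under \<open>P\<close> the chain \<open>X\<close> starts at \<open>j\<close> and is independent of the Poisson clock \<open>N\<close>
  (independence of the two generated sigma-algebras); the continuous time chain is
  \<open>\<lambda>t \<omega>. X (N t \<omega>) \<omega>\<close>.\<close>

definition realizes_chain ::
    "'a measure \<Rightarrow> nat \<Rightarrow> real mat \<Rightarrow> nat \<Rightarrow> (nat \<Rightarrow> 'a \<Rightarrow> nat) \<Rightarrow> (real \<Rightarrow> 'a \<Rightarrow> nat) \<Rightarrow> bool" where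
  "realizes_chain P n K j X N \<longleftrightarrow>
     markov_chain P n K j X \<and> poisson_process P N \<and>
     prob_space.indep_set P
       (sigma_sets (space P) {X m -` A \<inter> space P | m A. True})
       (sigma_sets (space P) {N t -` A \<inter> space P | t A. 0 \<le> t})"

text \<open>Hitting times are real valued: for an irreducible chain on a finite set the event of never
  hitting \<open>i\<close> is null, so the value of the infimum of the empty set is immaterial.\<close>

definition hitting_time :: "(nat \<Rightarrow> 'a \<Rightarrow> nat) \<Rightarrow> nat \<Rightarrow> 'a \<Rightarrow> real" where
  "hitting_time X i \<omega> = real (Inf {m. X m \<omega> = i})"

definition hitting_time_continuous ::
    "(nat \<Rightarrow> 'a \<Rightarrow> nat) \<Rightarrow> (real \<Rightarrow> 'a \<Rightarrow> nat) \<Rightarrow> nat \<Rightarrow> 'a \<Rightarrow> real" where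
  "hitting_time_continuous X N i \<omega> = Inf {t. 0 \<le> t \<and> X (N t \<omega>) \<omega> = i}"

end

theory Submission
  imports Defs "Jordan_Normal_Form.Spectral_Radius"
begin

text \<open>
Separation from the boundary state \<open>0\<close> behaves like the tail of a random time. When the chain is
monotone (\<open>p i + q (Suc i) \<le> 1\<close>), \<open>K^m(0,x)/\<pi> x\<close> is smallest at \<open>x = n\<close>, so that separation
equals \<open>1 - K^m(0,n)/\<pi> n\<close>, which decreases from at most \<open>1\<close> to \<open>0\<close>. Chebyshev's inequality
therefore reduces cutoff to the mean \<open>t\<close> and the variance of this tail, and these come from two
successive Poisson equations, solved explicitly because a birth and death chain carries a single
flux across each edge (\<open>sep_tail_sums\<close>, \<open>sep_var_eq\<close>). The same scheme applied to the chain killed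
at \<open>M\<close> gives the moments of the hitting times (\<open>avoid_sums\<close>).

Continuous time is discrete time read by a Poisson clock. The semigroup generated by \<open>K\<close> runs
twice as fast as the one generated by the lazy chain \<open>(I + K)/2\<close>, which is always monotone, so
continuous separation is a Poisson mixture of the monotone tails above (\<open>sep_continuous_eq\<close>). The
continuous hitting time has as tail the Poisson mixture of the discrete one (\<open>T_tail\<close>).

Both pairs of moments are explicit sums over edges. With \<open>F z\<close> the stationary mass of \<open>[0,z]\<close> and
\<open>c z\<close> the conductance of the edge from \<open>z\<close> to \<open>z+1\<close>, the mean separation time is the sum of
\<open>F(1-F)/c\<close>, whereas \<open>s\<close> is the sum of \<open>F/c\<close> left of \<open>M\<close> and of \<open>(1-F)/c\<close> right of \<open>M\<close>. Hence
\<open>s - t\<close> is a sum of terms \<open>F^2/c\<close> and \<open>(1-F)^2/c\<close>. Testing the Poincare inequality, whose constant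
is \<open>1/\<lambda>\<close>, against \<open>d z = F z/c z\<close> on an initial segment bounds these sums by a multiple of
\<open>1/\<lambda>\<close>, because both sides of \<open>M\<close> have stationary mass bounded below (\<open>hardy_left\<close>,
\<open>hardy_right\<close>). The same bound yields that \<open>b^2\<close> is at most a multiple of \<open>s/\<lambda>\<close>, and a comparison of
kernels bounds the variance of the separation time by \<open>b^2\<close> up to a multiple of \<open>1/\<lambda>^2\<close>
(\<open>sep_var_le\<close>). So if \<open>s\<lambda>\<close> diverges then \<open>s/b\<close> diverges, and then Chebyshev gives the cutoff and
its window.

Conversely, the eigenfunction \<open>\<psi>\<close> of the spectral gap can be chosen decreasing, hence maximal at the
starting state; writing \<open>K^m(0,\<cdot>)\<close> as a convex combination of \<open>\<pi>\<close> and another probability gives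
\<open>(1-\<lambda>)^m \<le> sep(m)\<close> at once. If \<open>s\<lambda>\<close> stayed bounded along a subsequence, the mixing times at
different levels, being at least \<open>log(1/\<epsilon>)/\<lambda>\<close> up to a constant and at most a multiple of \<open>s\<close> at level \<open>1/2\<close>, could
not be asymptotically equal. In discrete time \<open>c^2 = b^2 - s\<close>, and since \<open>s \<ge> n\<close> the ratios \<open>s/c\<close> and
\<open>s/b\<close> diverge together.
\<close>

section \<open>Birth and death chains on an interval\<close>

lemma double_sum_sym:
  fixes f :: "nat \<Rightarrow> nat \<Rightarrow> real"
  shows "2 * (\<Sum>z\<in>S. \<Sum>w\<in>S. f z w) = (\<Sum>z\<in>S. \<Sum>w\<in>S. f z w + f w z)"
proof -
  have "(\<Sum>z\<in>S. \<Sum>w\<in>S. f w z) = (\<Sum>z\<in>S. \<Sum>w\<in>S. f z w)" by (rule sum.swap)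
  then show ?thesis by (simp add: sum.distrib)
qed

text \<open>The chain is given by its rates and its reversible probability rather than by its matrix, so that
the lazy chain, with rates \<open>p/2\<close> and \<open>q/2\<close>, is another instance over the same \<open>\<pi>\<close>.\<close>

locale bd_chain =
  fixes n :: nat and p q \<pi> :: "nat \<Rightarrow> real"
  assumes n_pos: "n \<ge> 1"
    and p_pos: "i < n \<Longrightarrow> p i > 0"
    and q_pos: "i < n \<Longrightarrow> q (Suc i) > 0"
    and p_n: "p n = 0"
    and q_0: "q 0 = 0"
    and pq_le: "i \<le> n \<Longrightarrow> p i + q i \<le> 1"
    and pi_pos: "i \<le> n \<Longrightarrow> \<pi> i > 0"
    and pi_sum: "(\<Sum>i\<le>n. \<pi> i) = 1"
    and detailed_balance: "i < n \<Longrightarrow> \<pi> i * p i = \<pi> (Suc i) * q (Suc i)"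
begin

text \<open>The action of the transition matrix on functions. The values \<open>f (Suc n)\<close> and, at \<open>x = 0\<close>, the
truncated \<open>f (0 - 1)\<close> enter with the coefficients \<open>p n = 0\<close> and \<open>q 0 = 0\<close>.\<close>

definition step :: "(nat \<Rightarrow> real) \<Rightarrow> nat \<Rightarrow> real" where
  "step f x = p x * f (Suc x) + q x * f (x - 1) + (1 - p x - q x) * f x"

text \<open>The conductance of the edge between \<open>z\<close> and \<open>Suc z\<close>; an edge is named by its left end point.\<close>

definition cond :: "nat \<Rightarrow> real" where
  "cond z = \<pi> z * p z"

definition below :: "nat \<Rightarrow> real" where
  "below z = (\<Sum>y\<le>z. \<pi> y)"

definition above :: "nat \<Rightarrow> real" where
  "above z = (\<Sum>y\<in>{z<..n}. \<pi> y)"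

text \<open>The variance in terms of increments: if \<open>d z = f z - f (Suc z)\<close>, then the variance of \<open>f\<close>
under \<open>\<pi>\<close> is \<open>\<Sum>z<n. \<Sum>w<n. green z w * d z * d w\<close>.\<close>

definition green :: "nat \<Rightarrow> nat \<Rightarrow> real" where
  "green z w = below (min z w) * above (max z w)"

lemma p_nonneg: "i \<le> n \<Longrightarrow> p i \<ge> 0"
  using p_pos[of i] p_n by (cases "i = n") auto

lemma q_nonneg: "i \<le> n \<Longrightarrow> q i \<ge> 0"
  using q_pos[of "i - 1"] q_0 by (cases i) (auto intro: less_imp_le)

lemma pi_nonneg: "i \<le> n \<Longrightarrow> \<pi> i \<ge> 0"
  using pi_pos[of i] by simp

lemma cond_pos: "z < n \<Longrightarrow> cond z > 0"
  using pi_pos[of z] p_pos[of z] by (simp add: cond_def)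

lemma below_above: "z \<le> n \<Longrightarrow> below z + above z = 1"
proof -
  assume "z \<le> n"
  then have "{..n} = {..z} \<union> {z<..n}" "{..z} \<inter> {z<..n} = {}" by auto
  then show ?thesis using pi_sum by (simp add: below_def above_def sum.union_disjoint)
qed

lemma below_mono: "z \<le> w \<Longrightarrow> w \<le> n \<Longrightarrow> below z \<le> below w"
  unfolding below_def by (rule sum_mono2) (auto simp: pi_nonneg)

lemma above_antimono: "z \<le> w \<Longrightarrow> above w \<le> above z"
  unfolding above_def by (rule sum_mono2) (auto simp: pi_nonneg)

lemma below_pos: "z \<le> n \<Longrightarrow> below z > 0"
  unfolding below_def by (rule sum_pos) (auto intro: pi_pos)

lemma above_nonneg: "above z \<ge> 0"
  unfolding above_def by (rule sum_nonneg) (auto intro: less_imp_le pi_pos)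

lemma above_pos: "z < n \<Longrightarrow> above z > 0"
  unfolding above_def by (rule sum_pos) (auto intro: pi_pos)

lemma below_le_1: "z \<le> n \<Longrightarrow> below z \<le> 1"
  using below_above[of z] above_nonneg[of z] by simp

lemma above_le_1: "z \<le> n \<Longrightarrow> above z \<le> 1"
  using below_above[of z] below_pos[of z] by simp

lemma above_n: "above n = 0"
  by (simp add: above_def)

lemma above_Suc: "z < n \<Longrightarrow> above z = \<pi> (Suc z) + above (Suc z)"
proof -
  assume "z < n"
  then have "{z<..n} = insert (Suc z) {Suc z<..n}" by auto
  then show ?thesis by (simp add: above_def)
qed

lemma cond_le_below: "z < n \<Longrightarrow> cond z \<le> below z"
proof -
  assume z: "z < n"
  have "p z \<le> 1" using pq_le[of z] q_nonneg[of z] z by simp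
  then have "cond z \<le> \<pi> z" using pi_pos[of z] z by (simp add: cond_def mult_left_le)
  also have "\<dots> \<le> below z" unfolding below_def
    by (rule member_le_sum) (use z in \<open>auto simp: pi_nonneg\<close>)
  finally show ?thesis .
qed

lemma cond_le_above: "z < n \<Longrightarrow> cond z \<le> above z"
proof -
  assume z: "z < n"
  have "q (Suc z) \<le> 1" using pq_le[of "Suc z"] p_nonneg[of "Suc z"] z by simp
  then have "cond z \<le> \<pi> (Suc z)"
    using pi_pos[of "Suc z"] z detailed_balance[of z] by (simp add: cond_def mult_left_le)
  also have "\<dots> \<le> above z" using above_Suc[OF z] above_nonneg[of "Suc z"] by simp
  finally show ?thesis .
qed

lemma green_sym: "green z w = green w z"
  by (simp add: green_def min.commute max.commute)

lemma green_alt: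
  assumes "z \<le> n" "w \<le> n"
  shows "green z w = below (min z w) - below z * below w"
proof (cases "z \<le> w")
  case True
  have "above w = 1 - below w" using below_above[OF assms(2)] by simp
  with True show ?thesis by (simp add: green_def right_diff_distrib)
next
  case False
  have "above z = 1 - below z" using below_above[OF assms(1)] by simp
  with False show ?thesis by (simp add: green_def right_diff_distrib)
qed

lemma green_nonneg: "z \<le> n \<Longrightarrow> w \<le> n \<Longrightarrow> green z w \<ge> 0"
  unfolding green_def
  by (intro mult_nonneg_nonneg above_nonneg less_imp_le[OF below_pos]) auto

section \<open>Fluxes and the Poisson equation\<close>

text \<open>By detailed balance the net flow of \<open>f\<close> out of \<open>x\<close> is a difference of the fluxes
\<open>cond z * (f z - f (Suc z))\<close> across the two edges at \<open>x\<close>. This turns every second order equation for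
\<open>step\<close> into a first order one.\<close>

lemma flux_difference:
  assumes "x \<le> n"
  shows "\<pi> x * (f x - step f x) =
    cond x * (f x - f (Suc x)) - (if x = 0 then 0 else cond (x - 1) * (f (x - 1) - f x))"
proof (cases x)
  case 0
  then show ?thesis using q_0 by (simp add: step_def cond_def algebra_simps)
next
  case (Suc y)
  then have "cond y = \<pi> x * q x" using detailed_balance[of y] assms by (simp add: cond_def)
  then show ?thesis using Suc by (simp add: step_def cond_def algebra_simps)
qed

lemma flux_sum:
  assumes "z \<le> n"
  shows "(\<Sum>y\<le>z. \<pi> y * (f y - step f y)) = cond z * (f z - f (Suc z))"
  using assms
proof (induction z)
  case 0
  then show ?case using flux_difference[of 0 f] by simp
next
  case (Suc z)
  then show ?case using flux_difference[of "Suc z" f] by simp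
qed

lemma cond_n: "cond n = 0"
  using p_n by (simp add: cond_def)

lemma pi_step: "(\<Sum>y\<le>n. \<pi> y * step f y) = (\<Sum>y\<le>n. \<pi> y * f y)"
  using flux_sum[of n f] cond_n by (simp add: right_diff_distrib sum_subtractf)

text \<open>The function of mean zero whose increments are \<open>d\<close>.\<close>

definition potential :: "(nat \<Rightarrow> real) \<Rightarrow> nat \<Rightarrow> real" where
  "potential d x = (\<Sum>w<n. d w * (of_bool (x \<le> w) - below w))"

lemma potential_diff: "z < n \<Longrightarrow> potential d z - potential d (Suc z) = d z"
proof -
  assume z: "z < n"
  have "potential d z - potential d (Suc z) = (\<Sum>w<n. d w * (of_bool (z \<le> w) - of_bool (Suc z \<le> w)))"
    unfolding potential_def sum_subtractf[symmetric]
    by (intro sum.cong refl) (simp add: right_diff_distrib)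
  also have "\<dots> = (\<Sum>w<n. if w = z then d w else 0)"
    by (intro sum.cong) auto
  also have "\<dots> = d z" using z by simp
  finally show ?thesis .
qed

lemma pi_of_bool_le: "(\<Sum>y\<le>z. \<pi> y * of_bool (y \<le> w)) = below (min z w)"
proof -
  have "(\<Sum>y\<le>z. \<pi> y * of_bool (y \<le> w)) = (\<Sum>y\<in>{..z}. if y \<le> w then \<pi> y else 0)"
    by (intro sum.cong) auto
  also have "\<dots> = (\<Sum>y\<in>{..z} \<inter> {y. y \<le> w}. \<pi> y)" by (simp add: sum.inter_restrict)
  also have "{..z} \<inter> {y. y \<le> w} = {..min z w}" by auto
  finally show ?thesis by (simp add: below_def)
qed

lemma potential_mass:
  assumes "z \<le> n"
  shows "(\<Sum>y\<le>z. \<pi> y * potential d y) = (\<Sum>w<n. d w * green z w)"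
proof -
  have "(\<Sum>y\<le>z. \<pi> y * potential d y) =
      (\<Sum>w<n. \<Sum>y\<le>z. \<pi> y * (d w * (of_bool (y \<le> w) - below w)))"
    unfolding potential_def sum_distrib_left by (rule sum.swap)
  also have "\<dots> = (\<Sum>w<n. d w * (below (min z w) - below z * below w))"
  proof (rule sum.cong[OF refl])
    fix w
    have "(\<Sum>y\<le>z. \<pi> y * (d w * (of_bool (y \<le> w) - below w))) =
       (\<Sum>y\<le>z. d w * (\<pi> y * of_bool (y \<le> w)) - d w * below w * \<pi> y)"
      by (intro sum.cong refl) (simp add: right_diff_distrib)
    also have "\<dots> = d w * (\<Sum>y\<le>z. \<pi> y * of_bool (y \<le> w)) - d w * below w * (\<Sum>y\<le>z. \<pi> y)"
      by (simp only: sum_subtractf sum_distrib_left)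
    finally have "(\<Sum>y\<le>z. \<pi> y * (d w * (of_bool (y \<le> w) - below w))) = \<dots>" .
    then show "(\<Sum>y\<le>z. \<pi> y * (d w * (of_bool (y \<le> w) - below w))) =
        d w * (below (min z w) - below z * below w)"
      by (simp add: pi_of_bool_le right_diff_distrib below_def[of z])
  qed
  also have "\<dots> = (\<Sum>w<n. d w * green z w)"
    using assms by (intro sum.cong) (auto simp: green_alt)
  finally show ?thesis .
qed

lemma potential_mean: "(\<Sum>y\<le>n. \<pi> y * potential d y) = 0"
  by (subst potential_mass) (auto simp: green_def above_n max_absorb1 less_imp_le)

text \<open>Summing the equation over \<open>[0,z]\<close> leaves only the flux across the edge \<open>z\<close>; the increments of the
solution are therefore the cumulative mass \<open>g z\<close> of the right hand side divided by the conductance.\<close>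

lemma poisson_solution:
  assumes "x \<le> n" and g: "\<And>z. z < n \<Longrightarrow> g z = (\<Sum>y\<le>z. \<pi> y * r y)"
    and "(\<Sum>y\<le>n. \<pi> y * r y) = 0"
  shows "step (potential (\<lambda>z. g z / cond z)) x = potential (\<lambda>z. g z / cond z) x - r x"
proof -
  let ?f = "potential (\<lambda>z. g z / cond z)"
  have J: "cond z * (?f z - ?f (Suc z)) = (\<Sum>y\<le>z. \<pi> y * r y)" if "z \<le> n" for z
  proof (cases "z = n")
    case True then show ?thesis using assms(3) cond_n by simp
  next
    case False
    then show ?thesis using that g[of z] cond_pos[of z] by (simp add: potential_diff)
  qed
  have "\<pi> x * (?f x - step ?f x) = \<pi> x * r x"
  proof (cases x)
    case 0 then show ?thesis using flux_difference[OF assms(1), of ?f] J[of 0] by simp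
  next
    case (Suc y)
    then show ?thesis using flux_difference[OF assms(1), of ?f] J[of y] J[of x] assms(1) by simp
  qed
  then show ?thesis using pi_pos[OF assms(1)] by simp
qed

section \<open>Moments of the separation time\<close>

text \<open>Formally \<open>sep_phi x\<close> is the sum over \<open>m\<close> of \<open>1 - K^m(x,n)/\<pi> n\<close>, and \<open>sep_chi x\<close> is the sum over \<open>m\<close>
of \<open>K^m sep_phi x\<close>; both are defined as the solutions of the corresponding Poisson equations.\<close>

definition sep_phi :: "nat \<Rightarrow> real" where
  "sep_phi = potential (\<lambda>z. below z / cond z)"

definition sep_chi :: "nat \<Rightarrow> real" where
  "sep_chi = potential (\<lambda>z. (\<Sum>y\<le>z. \<pi> y * sep_phi y) / cond z)"

text \<open>In spectral terms \<open>sep_mean\<close> and \<open>sep_var\<close> are the sums of \<open>1/\<lambda>\<close> and \<open>1/\<lambda>^2\<close> over the non-zero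
eigenvalues of \<open>I - K\<close>: they are the traces of the operator with kernel \<open>green\<close>, normalized by the
conductances, and of its square.\<close>

definition sep_mean :: real where
  "sep_mean = (\<Sum>z<n. below z * above z / cond z)"

definition sep_var :: real where
  "sep_var = (\<Sum>z<n. \<Sum>w<n. (green z w)^2 / (cond z * cond w))"

lemma sep_phi_poisson:
  assumes "x \<le> n"
  shows "step sep_phi x = sep_phi x - (1 - of_bool (x = n) / \<pi> n)"
  unfolding sep_phi_def
proof (rule poisson_solution[OF assms])
  show "below z = (\<Sum>y\<le>z. \<pi> y * (1 - of_bool (y = n) / \<pi> n))" if "z < n" for z
    unfolding below_def using that by (intro sum.cong) auto
  have "(\<Sum>y\<le>n. \<pi> y * (1 - of_bool (y = n) / \<pi> n)) = (\<Sum>y\<le>n. \<pi> y) - (\<Sum>y\<le>n. if y = n then \<pi> y / \<pi> n else 0)"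
    unfolding sum_subtractf[symmetric] by (intro sum.cong) (auto simp: algebra_simps)
  then show "(\<Sum>y\<le>n. \<pi> y * (1 - of_bool (y = n) / \<pi> n)) = 0"
    using pi_pos[of n] pi_sum by simp
qed

lemma sep_chi_poisson: "x \<le> n \<Longrightarrow> step sep_chi x = sep_chi x - sep_phi x"
  unfolding sep_chi_def
  by (rule poisson_solution) (auto simp: sep_phi_def potential_mean)

lemma sep_phi_mean: "(\<Sum>y\<le>n. \<pi> y * sep_phi y) = 0"
  and sep_chi_mean: "(\<Sum>y\<le>n. \<pi> y * sep_chi y) = 0"
  by (simp_all add: sep_phi_def sep_chi_def potential_mean)

lemma potential_0: "potential d 0 = (\<Sum>w<n. d w * above w)"
  unfolding potential_def
proof (intro sum.cong refl)
  fix w assume "w \<in> {..<n}"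
  then show "d w * (of_bool (0 \<le> w) - below w) = d w * above w"
    using below_above[of w] by auto
qed

lemma sep_phi_0: "sep_phi 0 = sep_mean"
  unfolding sep_phi_def sep_mean_def potential_0 by (simp add: field_simps)

text \<open>After symmetrization in the two edges \<open>z \<le> w\<close>, both sides agree term by term:
\<open>(F w (1 - F z) + F z (1 - F w)) * F z (1 - F w) = (F z (1 - F w))^2 + F z (1 - F z) F w (1 - F w)\<close>.\<close>

lemma sep_var_eq: "2 * sep_chi 0 - sep_mean^2 = sep_var"
proof -
  have "sep_chi 0 = (\<Sum>z<n. \<Sum>w<n. below w / cond w * green z w / cond z * above z)"
    unfolding sep_chi_def potential_0 sep_phi_def
    by (intro sum.cong refl, subst potential_mass)
       (auto simp: sum_distrib_left sum_distrib_right sum_divide_distrib)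
  then have "2 * sep_chi 0 = (\<Sum>z<n. \<Sum>w<n. below w / cond w * green z w / cond z * above z
     + below z / cond z * green w z / cond w * above w)"
    by (simp add: double_sum_sym)
  also have "\<dots> = (\<Sum>z<n. \<Sum>w<n. (green z w)^2 / (cond z * cond w) +
      (below z * above z / cond z) * (below w * above w / cond w))"
  proof (intro sum.cong refl)
    fix z w assume zw: "z \<in> {..<n}" "w \<in> {..<n}"
    then have c: "cond z > 0" "cond w > 0" by (auto intro: cond_pos)
    have "(below w * above z + below z * above w) * green z w =
        (green z w)^2 + below z * above z * (below w * above w)"
      by (cases "z \<le> w") (auto simp: green_def power2_eq_square algebra_simps min_def max_def)
    then have "(below w * above z + below z * above w) * green z w / (cond z * cond w) =
        ((green z w)^2 + below z * above z * (below w * above w)) / (cond z * cond w)" by simp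
    then show "below w / cond w * green z w / cond z * above z
     + below z / cond z * green w z / cond w * above w =
      (green z w)^2 / (cond z * cond w) +
      (below z * above z / cond z) * (below w * above w / cond w)"
      using c by (simp add: green_sym[of w z] add_divide_distrib algebra_simps)
  qed
  also have "\<dots> = sep_var + sep_mean^2"
    by (simp add: sum.distrib sep_var_def sep_mean_def power2_eq_square sum_product)
  finally show ?thesis by simp
qed

end

section \<open>Moments of hitting times\<close>

text \<open>The hitting time analogue of \<open>sep_var_eq\<close>, used with \<open>m = min\<close> on the left and \<open>m = max\<close> on the right
of the target; it rests on \<open>a m (a z + a w) = (a m)^2 + a z a w\<close> when \<open>m\<close> is one of \<open>z\<close> and \<open>w\<close>.\<close>

lemma second_moment_identity:
  fixes a c :: "nat \<Rightarrow> real" and m :: "nat \<Rightarrow> nat \<Rightarrow> nat"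
  assumes m: "\<And>z w. m z w = m w z" "\<And>z w. m z w = z \<or> m z w = w"
  shows "2 * (\<Sum>z\<in>S. (\<Sum>w\<in>S. a (m z w) * (a w / c w)) / c z) - (\<Sum>z\<in>S. a z / c z)^2 =
    (\<Sum>z\<in>S. \<Sum>w\<in>S. (a (m z w))^2 / (c z * c w))"
proof -
  have pt: "(a (m z w) * (a w / c w)) / c z + (a (m w z) * (a z / c z)) / c w =
      (a (m z w))^2 / (c z * c w) + (a z / c z) * (a w / c w)" for z w
  proof -
    have "a (m z w) * a w + a (m z w) * a z = (a (m z w))^2 + a z * a w"
      using m(2)[of z w] by (auto simp: power2_eq_square)
    then have "(a (m z w) * a w + a (m z w) * a z) / (c z * c w) =
       ((a (m z w))^2 + a z * a w) / (c z * c w)" by simp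
    then show ?thesis by (simp add: m(1)[of w z] add_divide_distrib mult.commute)
  qed
  have "2 * (\<Sum>z\<in>S. (\<Sum>w\<in>S. a (m z w) * (a w / c w)) / c z) =
      (\<Sum>z\<in>S. \<Sum>w\<in>S. (a (m z w) * (a w / c w)) / c z + (a (m w z) * (a z / c z)) / c w)"
    unfolding sum_divide_distrib by (rule double_sum_sym)
  also have "\<dots> = (\<Sum>z\<in>S. \<Sum>w\<in>S. (a (m z w))^2 / (c z * c w)) + (\<Sum>z\<in>S. a z / c z)^2"
    by (simp only: pt sum.distrib power2_eq_square sum_product)
  finally show ?thesis by simp
qed

text \<open>Each pair is charged to whichever of its two members \<open>m\<close> selects.\<close>

lemma sum_sq_le_twice_ordered:
  fixes a c :: "nat \<Rightarrow> real" and m :: "nat \<Rightarrow> nat \<Rightarrow> nat"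
  assumes m: "\<And>z w. m z w = m w z" "\<And>z w. m z w = z \<or> m z w = w"
    and "finite S" and c: "\<And>z. z \<in> S \<Longrightarrow> c z > 0"
  shows "(\<Sum>z\<in>S. \<Sum>w\<in>S. (a (m z w))^2 / (c z * c w)) \<le>
    2 * (\<Sum>w\<in>S. (\<Sum>z\<in>{z\<in>S. m z w = z}. (a z)^2 / c z) / c w)"
proof -
  have *: "(\<Sum>z\<in>{z\<in>S. m z w = z}. (a z)^2 / c z) = (\<Sum>z\<in>S. of_bool (m w z = z) * ((a z)^2 / c z))" for w
    using assms(3) unfolding sum.inter_filter[OF assms(3)] by (intro sum.cong) (auto simp: m(1)[of w])
  have "(\<Sum>z\<in>S. \<Sum>w\<in>S. (a (m z w))^2 / (c z * c w)) \<le>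
     (\<Sum>z\<in>S. \<Sum>w\<in>S. of_bool (m z w = w) * ((a w)^2 / c w) / c z + of_bool (m w z = z) * ((a z)^2 / c z) / c w)"
  proof (intro sum_mono)
    fix z w assume zw: "z \<in> S" "w \<in> S"
    then have "c z > 0" "c w > 0" using c by auto
    then have nn: "(a w)^2 / (c w * c z) \<ge> 0" "(a z)^2 / (c z * c w) \<ge> 0" by auto
    show "(a (m z w))^2 / (c z * c w) \<le>
       of_bool (m z w = w) * ((a w)^2 / c w) / c z + of_bool (m w z = z) * ((a z)^2 / c z) / c w"
      using m(2)[of z w] m(1)[of z w] nn by (auto simp: mult.commute)
  qed
  also have "\<dots> = 2 * (\<Sum>z\<in>S. \<Sum>w\<in>S. of_bool (m z w = w) * ((a w)^2 / c w) / c z)"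
    by (rule double_sum_sym[symmetric])
  finally show ?thesis by (simp add: * sum_divide_distrib)
qed

lemma scaled_bound:
  fixes A b k v :: real
  assumes "k > 0" "b > 0" "k / b * A \<le> v"
  shows "A \<le> v / k * b"
proof -
  have "A = (k / b * A) * (b / k)" using assms by simp
  also have "\<dots> \<le> v * (b / k)" using assms by (intro mult_right_mono) auto
  finally show ?thesis by simp
qed

context bd_chain
begin

text \<open>The function vanishing at \<open>M\<close> whose flux is \<open>l\<close> across the edges left of \<open>M\<close> and \<open>-r\<close> across the edges
right of \<open>M\<close>.\<close>

definition anchored :: "nat \<Rightarrow> (nat \<Rightarrow> real) \<Rightarrow> (nat \<Rightarrow> real) \<Rightarrow> nat \<Rightarrow> real" where
  "anchored M l r x = (\<Sum>z\<in>{x..<M}. l z / cond z) + (\<Sum>z\<in>{M..<x}. r z / cond z)"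

lemma anchored_self: "anchored M l r M = 0"
  by (simp add: anchored_def)

lemma anchored_diff_left: "z < M \<Longrightarrow> anchored M l r z - anchored M l r (Suc z) = l z / cond z"
proof -
  assume "z < M"
  then have "{z..<M} = insert z {Suc z..<M}" "{M..<z} = {}" "{M..<Suc z} = {}" by auto
  then show ?thesis by (simp add: anchored_def)
qed

lemma anchored_diff_right: "M \<le> z \<Longrightarrow> anchored M l r z - anchored M l r (Suc z) = - r z / cond z"
  by (simp add: anchored_def)

lemma anchored_nonneg:
  assumes "x \<le> n" "M \<le> n" "\<And>z. z < n \<Longrightarrow> l z \<ge> 0" "\<And>z. z < n \<Longrightarrow> r z \<ge> 0"
  shows "anchored M l r x \<ge> 0"
  unfolding anchored_def
  by (intro add_nonneg_nonneg sum_nonneg divide_nonneg_pos) (use assms cond_pos in auto)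

lemma anchored_poisson:
  assumes x: "x \<le> n" "x \<noteq> M" and M: "M \<le> n"
    and l: "\<And>z. z < M \<Longrightarrow> l z = (\<Sum>y\<le>z. \<pi> y * g y)"
    and r: "\<And>z. M \<le> z \<Longrightarrow> z < n \<Longrightarrow> r z = (\<Sum>y\<in>{z<..n}. \<pi> y * g y)"
  shows "step (anchored M l r) x = anchored M l r x - g x"
proof -
  let ?f = "anchored M l r"
  have L: "cond z * (?f z - ?f (Suc z)) = (\<Sum>y\<le>z. \<pi> y * g y)" if "z < M" for z
    using that M l[of z] cond_pos[of z] by (simp add: anchored_diff_left)
  have R: "cond z * (?f z - ?f (Suc z)) = - (\<Sum>y\<in>{z<..n}. \<pi> y * g y)" if "M \<le> z" "z \<le> n" for z
  proof (cases "z = n")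
    case True then show ?thesis by (simp add: cond_n)
  next
    case False
    then show ?thesis using that r[of z] cond_pos[of z] by (simp add: anchored_diff_right)
  qed
  have "\<pi> x * (?f x - step ?f x) = \<pi> x * g x"
  proof (cases "x < M")
    case True
    show ?thesis
    proof (cases x)
      case 0 then show ?thesis using flux_difference[OF x(1), of ?f] L[of 0] True by simp
    next
      case (Suc y)
      then show ?thesis using flux_difference[OF x(1), of ?f] L[of y] L[of x] True by simp
    qed
  next
    case False
    then obtain y where y: "x = Suc y" "M \<le> y" using x(2) by (cases x) auto
    have "{y<..n} = insert x {x<..n}" using y x by auto
    then have "(\<Sum>y\<in>{y<..n}. \<pi> y * g y) = \<pi> x * g x + (\<Sum>y\<in>{x<..n}. \<pi> y * g y)" by simp
    then show ?thesis using flux_difference[OF x(1), of ?f] R[of y] R[of x] y x(1) by simp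
  qed
  then show ?thesis using pi_pos[OF x(1)] by simp
qed

text \<open>The right hand side \<open>1\<close> of the equation for the mean accumulates, across each edge, the stationary mass
on the side away from \<open>M\<close>; \<open>hit_second\<close> repeats this with the right hand side \<open>hit_mean\<close>.\<close>

definition hit_mean :: "nat \<Rightarrow> nat \<Rightarrow> real" where
  "hit_mean M = anchored M below above"

definition hit_second :: "nat \<Rightarrow> nat \<Rightarrow> real" where
  "hit_second M = anchored M (\<lambda>z. \<Sum>y\<le>z. \<pi> y * hit_mean M y) (\<lambda>z. \<Sum>y\<in>{z<..n}. \<pi> y * hit_mean M y)"

text \<open>The three sums below are traces: \<open>hit_total\<close> is the sum of \<open>1/\<theta>\<close>, and \<open>hit_var_left + hit_var_right\<close> the sum
of \<open>1/\<theta>^2\<close>, over the eigenvalues \<open>\<theta>\<close> of \<open>I - K\<close> restricted to the states other than \<open>M\<close>.\<close>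

definition hit_total :: "nat \<Rightarrow> real" where
  "hit_total M = (\<Sum>z<M. below z / cond z) + (\<Sum>z\<in>{M..<n}. above z / cond z)"

definition hit_var_left :: "nat \<Rightarrow> real" where
  "hit_var_left M = (\<Sum>z<M. \<Sum>w<M. (below (min z w))^2 / (cond z * cond w))"

definition hit_var_right :: "nat \<Rightarrow> real" where
  "hit_var_right M = (\<Sum>z\<in>{M..<n}. \<Sum>w\<in>{M..<n}. (above (max z w))^2 / (cond z * cond w))"

lemma hit_potentials_at_target: "hit_mean M M = 0" "hit_second M M = 0"
  by (simp_all add: hit_mean_def hit_second_def anchored_self)

lemma hit_mean_nonneg: "x \<le> n \<Longrightarrow> M \<le> n \<Longrightarrow> hit_mean M x \<ge> 0"
  unfolding hit_mean_def by (intro anchored_nonneg above_nonneg less_imp_le[OF below_pos]) auto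

lemma hit_mean_poisson:
  "x \<le> n \<Longrightarrow> x \<noteq> M \<Longrightarrow> M \<le> n \<Longrightarrow> step (hit_mean M) x = hit_mean M x - 1"
  unfolding hit_mean_def by (rule anchored_poisson) (auto simp: below_def above_def)

lemma hit_second_poisson:
  "x \<le> n \<Longrightarrow> x \<noteq> M \<Longrightarrow> M \<le> n \<Longrightarrow> step (hit_second M) x = hit_second M x - hit_mean M x"
  unfolding hit_second_def by (rule anchored_poisson) auto

lemma hit_total_eq: "hit_mean M 0 + hit_mean M n = hit_total M" if "M \<le> n"
  using that by (simp add: hit_mean_def anchored_def hit_total_def atLeast0LessThan)

lemma pi_of_bool_gt: "(\<Sum>y\<in>{z<..n}. \<pi> y * of_bool (w < y)) = above (max z w)"
proof -
  have "(\<Sum>y\<in>{z<..n}. \<pi> y * of_bool (w < y)) = (\<Sum>y\<in>{z<..n}. if w < y then \<pi> y else 0)"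
    by (intro sum.cong) auto
  also have "\<dots> = (\<Sum>y\<in>{z<..n} \<inter> {y. w < y}. \<pi> y)" by (simp add: sum.inter_restrict)
  also have "{z<..n} \<inter> {y. w < y} = {max z w<..n}" by auto
  finally show ?thesis by (simp add: above_def)
qed

lemma hit_mean_mass_left:
  assumes "z < M"
  shows "(\<Sum>y\<le>z. \<pi> y * hit_mean M y) = (\<Sum>w<M. below (min z w) * (below w / cond w))"
proof -
  have "hit_mean M y = (\<Sum>w<M. of_bool (y \<le> w) * (below w / cond w))" if "y \<le> z" for y
  proof -
    have "(\<Sum>w<M. of_bool (y \<le> w) * (below w / cond w)) = (\<Sum>w\<in>{..<M}. if y \<le> w then below w / cond w else 0)"
      by (intro sum.cong) auto
    also have "\<dots> = (\<Sum>w\<in>{..<M} \<inter> {w. y \<le> w}. below w / cond w)" by (simp add: sum.inter_restrict)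
    also have "{..<M} \<inter> {w. y \<le> w} = {y..<M}" by auto
    finally show ?thesis using that assms by (simp add: hit_mean_def anchored_def)
  qed
  then have "(\<Sum>y\<le>z. \<pi> y * hit_mean M y) = (\<Sum>y\<le>z. \<Sum>w<M. \<pi> y * (of_bool (y \<le> w) * (below w / cond w)))"
    by (simp add: sum_distrib_left)
  also have "\<dots> = (\<Sum>w<M. \<Sum>y\<le>z. (\<pi> y * of_bool (y \<le> w)) * (below w / cond w))"
    by (subst sum.swap) (simp add: mult.assoc)
  finally show ?thesis by (simp only: sum_distrib_right[symmetric] pi_of_bool_le)
qed

lemma hit_mean_mass_right:
  assumes "M \<le> z"
  shows "(\<Sum>y\<in>{z<..n}. \<pi> y * hit_mean M y) = (\<Sum>w\<in>{M..<n}. above (max z w) * (above w / cond w))"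
proof -
  have "hit_mean M y = (\<Sum>w\<in>{M..<n}. of_bool (w < y) * (above w / cond w))" if "y \<in> {z<..n}" for y
  proof -
    have "(\<Sum>w\<in>{M..<n}. of_bool (w < y) * (above w / cond w)) = (\<Sum>w\<in>{M..<n}. if w < y then above w / cond w else 0)"
      by (intro sum.cong) auto
    also have "\<dots> = (\<Sum>w\<in>{M..<n} \<inter> {w. w < y}. above w / cond w)" by (simp add: sum.inter_restrict)
    also have "{M..<n} \<inter> {w. w < y} = {M..<y}" using that by auto
    finally show ?thesis using that assms by (simp add: hit_mean_def anchored_def)
  qed
  then have "(\<Sum>y\<in>{z<..n}. \<pi> y * hit_mean M y) = (\<Sum>y\<in>{z<..n}. \<Sum>w\<in>{M..<n}. \<pi> y * (of_bool (w < y) * (above w / cond w)))"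
    by (simp add: sum_distrib_left)
  also have "\<dots> = (\<Sum>w\<in>{M..<n}. \<Sum>y\<in>{z<..n}. (\<pi> y * of_bool (w < y)) * (above w / cond w))"
    by (subst sum.swap) (simp add: mult.assoc)
  finally show ?thesis by (simp only: sum_distrib_right[symmetric] pi_of_bool_gt)
qed

lemma hit_var_left_eq:
  assumes "M \<le> n"
  shows "2 * hit_second M 0 - (hit_mean M 0)^2 = hit_var_left M"
proof -
  have "hit_second M 0 = (\<Sum>z<M. (\<Sum>w<M. below (min z w) * (below w / cond w)) / cond z)"
    by (simp add: hit_second_def anchored_def atLeast0LessThan hit_mean_mass_left)
  moreover have "hit_mean M 0 = (\<Sum>z<M. below z / cond z)"
    by (simp add: hit_mean_def anchored_def atLeast0LessThan)
  ultimately show ?thesis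
    using second_moment_identity[of min below cond "{..<M}"]
    by (simp add: hit_var_left_def min.commute min_def_raw)
qed

lemma hit_var_right_eq:
  assumes "M \<le> n"
  shows "2 * hit_second M n - (hit_mean M n)^2 = hit_var_right M"
proof -
  have "hit_second M n = (\<Sum>z\<in>{M..<n}. (\<Sum>w\<in>{M..<n}. above (max z w) * (above w / cond w)) / cond z)"
    using assms by (simp add: hit_second_def anchored_def hit_mean_mass_right)
  moreover have "hit_mean M n = (\<Sum>z\<in>{M..<n}. above z / cond z)"
    using assms by (simp add: hit_mean_def anchored_def)
  ultimately show ?thesis
    using second_moment_identity[of max above cond "{M..<n}"]
    by (simp add: hit_var_right_def max.commute max_def_raw)
qed

section \<open>Comparison of the moments of separation and hitting times\<close>

definition excess_left :: "nat \<Rightarrow> real" where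
  "excess_left M = (\<Sum>z<M. (below z)^2 / cond z)"

definition excess_right :: "nat \<Rightarrow> real" where
  "excess_right M = (\<Sum>z\<in>{M..<n}. (above z)^2 / cond z)"

lemma excess_nonneg: "M \<le> n \<Longrightarrow> excess_left M \<ge> 0" "M \<le> n \<Longrightarrow> excess_right M \<ge> 0"
  unfolding excess_left_def excess_right_def
  by (intro sum_nonneg divide_nonneg_pos; use cond_pos in auto)+

lemma edges_split: "M \<le> n \<Longrightarrow> sum f {..<n} = sum f {..<M} + sum f {M..<n}"
  for f :: "nat \<Rightarrow> real"
  by (metis atLeast0LessThan sum.atLeastLessThan_concat le0)

lemma hit_total_minus_sep_mean:
  assumes "M \<le> n"
  shows "hit_total M - sep_mean = excess_left M + excess_right M"
proof -
  have "(\<Sum>z<M. below z / cond z) - (\<Sum>z<M. below z * above z / cond z) = excess_left M"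
    unfolding excess_left_def sum_subtractf[symmetric]
  proof (intro sum.cong refl)
    fix z assume "z \<in> {..<M}"
    then have "below z - below z * above z = (below z)^2"
      using below_above[of z] assms by (simp add: power2_eq_square algebra_simps)
        (metis distrib_left mult.right_neutral)
    then show "below z / cond z - below z * above z / cond z = (below z)^2 / cond z"
      by (metis diff_divide_distrib)
  qed
  moreover have "(\<Sum>z\<in>{M..<n}. above z / cond z) - (\<Sum>z\<in>{M..<n}. below z * above z / cond z) = excess_right M"
    unfolding excess_right_def sum_subtractf[symmetric]
  proof (intro sum.cong refl)
    fix z assume "z \<in> {M..<n}"
    then have "above z - below z * above z = (above z)^2"
      using below_above[of z] assms by (simp add: power2_eq_square algebra_simps)
        (metis distrib_right mult.left_neutral)
    then show "above z / cond z - below z * above z / cond z = (above z)^2 / cond z"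
      by (metis diff_divide_distrib)
  qed
  ultimately show ?thesis
    unfolding hit_total_def sep_mean_def edges_split[OF assms] by simp
qed

text \<open>For two edges on the same side of \<open>M\<close> the kernel \<open>green\<close> is dominated by the hitting time kernel; for
edges on opposite sides it factorizes, and these terms give the product of the excesses.\<close>

lemma sep_var_le:
  assumes M: "M \<le> n"
  shows "sep_var \<le> hit_var_left M + hit_var_right M + 2 * excess_left M * excess_right M"
proof -
  let ?t = "\<lambda>z w. (green z w)^2 / (cond z * cond w)"
  have le: "?t z w \<le> x^2 / (cond z * cond w)" if "green z w \<le> x" "z < n" "w < n" for z w x
    using that cond_pos[of z] cond_pos[of w] green_nonneg[of z w]
    by (intro divide_right_mono power_mono) auto
  have gb: "green z w \<le> below (min z w)" if "z < n" "w < n" for z w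
    unfolding green_def using above_le_1[of "max z w"] below_pos[of "min z w"] that
    by (intro mult_left_le) (auto intro: less_imp_le)
  have ga: "green z w \<le> above (max z w)" if "z < n" "w < n" for z w
    unfolding green_def using below_le_1[of "min z w"] above_nonneg[of "max z w"] that
    by (intro mult_left_le_one_le less_imp_le[OF below_pos]) auto
  have "sep_var = (\<Sum>z<M. \<Sum>w<M. ?t z w) + (\<Sum>z<M. \<Sum>w\<in>{M..<n}. ?t z w)
      + ((\<Sum>z\<in>{M..<n}. \<Sum>w<M. ?t z w) + (\<Sum>z\<in>{M..<n}. \<Sum>w\<in>{M..<n}. ?t z w))"
    unfolding sep_var_def by (simp only: edges_split[OF M] sum.distrib)
  moreover have "(\<Sum>z<M. \<Sum>w<M. ?t z w) \<le> hit_var_left M"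
    unfolding hit_var_left_def by (intro sum_mono le gb) (use M in auto)
  moreover have "(\<Sum>z\<in>{M..<n}. \<Sum>w\<in>{M..<n}. ?t z w) \<le> hit_var_right M"
    unfolding hit_var_right_def by (intro sum_mono le ga) (use M in auto)
  moreover have cross: "(\<Sum>z<M. \<Sum>w\<in>{M..<n}. ?t z w) = excess_left M * excess_right M"
    unfolding excess_left_def excess_right_def sum_product
    by (intro sum.cong refl) (auto simp: green_def min_absorb1 max_absorb2 power_mult_distrib)
  moreover have "(\<Sum>z\<in>{M..<n}. \<Sum>w<M. ?t z w) = excess_left M * excess_right M"
    unfolding cross[symmetric] by (subst sum.swap) (simp add: green_sym mult.commute)
  ultimately show ?thesis by simp
qed

lemma excess_left_sq: "M \<le> n \<Longrightarrow> (excess_left M)^2 \<le> hit_var_left M"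
  unfolding excess_left_def hit_var_left_def power2_eq_square[of "sum _ _"] sum_product
proof (intro sum_mono)
  fix z w assume M: "M \<le> n" and "z \<in> {..<M}" "w \<in> {..<M}"
  then have zw: "z < n" "w < n" by auto
  have b: "0 < below z" "below z \<le> 1" "0 < below w" "below w \<le> 1"
    using zw by (auto intro: below_pos below_le_1)
  have "(below z * below w)^2 \<le> (below (min z w))^2"
    using b by (intro power_mono) (auto simp: min_def mult_left_le mult_left_le_one_le)
  then have "(below z * below w)^2 / (cond z * cond w) \<le> (below (min z w))^2 / (cond z * cond w)"
    using cond_pos[of z] cond_pos[of w] zw by (intro divide_right_mono) auto
  then show "(below z)^2 / cond z * ((below w)^2 / cond w) \<le> (below (min z w))^2 / (cond z * cond w)"
    by (simp add: power_mult_distrib)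
qed

lemma excess_right_sq: "M \<le> n \<Longrightarrow> (excess_right M)^2 \<le> hit_var_right M"
  unfolding excess_right_def hit_var_right_def power2_eq_square[of "sum _ _"] sum_product
proof (intro sum_mono)
  fix z w assume M: "M \<le> n" and "z \<in> {M..<n}" "w \<in> {M..<n}"
  then have zw: "z < n" "w < n" by auto
  have b: "0 < above z" "above z \<le> 1" "0 < above w" "above w \<le> 1"
    using zw by (auto intro: above_pos above_le_1)
  have "(above z * above w)^2 \<le> (above (max z w))^2"
    using b by (intro power_mono) (auto simp: max_def mult_left_le mult_left_le_one_le)
  then have "(above z * above w)^2 / (cond z * cond w) \<le> (above (max z w))^2 / (cond z * cond w)"
    using cond_pos[of z] cond_pos[of w] zw by (intro divide_right_mono) auto
  then show "(above z)^2 / cond z * ((above w)^2 / cond w) \<le> (above (max z w))^2 / (cond z * cond w)"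
    by (simp add: power_mult_distrib)
qed

lemma ratio_ge_1: "z < n \<Longrightarrow> below z / cond z \<ge> 1" "z < n \<Longrightarrow> above z / cond z \<ge> 1"
  using cond_pos[of z] cond_le_below[of z] cond_le_above[of z] by simp_all

lemma hit_total_ge: "M \<le> n \<Longrightarrow> hit_total M \<ge> n"
proof -
  assume M: "M \<le> n"
  have "(\<Sum>z<M. 1) \<le> (\<Sum>z<M. below z / cond z)" "(\<Sum>z\<in>{M..<n}. 1) \<le> (\<Sum>z\<in>{M..<n}. above z / cond z)"
    by (intro sum_mono ratio_ge_1; use M in auto)+
  then show ?thesis using M by (simp add: hit_total_def)
qed

lemma diag_le_double_sum:
  fixes f :: "nat \<Rightarrow> nat \<Rightarrow> real"
  assumes "finite S" "\<And>z w. z \<in> S \<Longrightarrow> w \<in> S \<Longrightarrow> f z w \<ge> 0"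
  shows "(\<Sum>z\<in>S. f z z) \<le> (\<Sum>z\<in>S. \<Sum>w\<in>S. f z w)"
  by (intro sum_mono member_le_sum[of _ S "f _"]) (use assms in auto)

lemma hit_var_diag:
  assumes M: "M \<le> n"
  shows "(\<Sum>z<M. (below z / cond z)^2) + (\<Sum>z\<in>{M..<n}. (above z / cond z)^2) \<le> hit_var_left M + hit_var_right M"
proof -
  have "(\<Sum>z<M. (below (min z z))^2 / (cond z * cond z)) \<le> hit_var_left M"
    unfolding hit_var_left_def using M cond_pos
    by (intro diag_le_double_sum) (auto intro!: divide_nonneg_pos mult_pos_pos)
  moreover have "(\<Sum>z\<in>{M..<n}. (above (max z z))^2 / (cond z * cond z)) \<le> hit_var_right M"
    unfolding hit_var_right_def using M cond_pos
    by (intro diag_le_double_sum) (auto intro!: divide_nonneg_pos mult_pos_pos)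
  ultimately show ?thesis by (simp add: power_divide power2_eq_square)
qed

lemma hit_total_le_var:
  assumes M: "M \<le> n"
  shows "hit_total M \<le> hit_var_left M + hit_var_right M"
proof -
  have sq: "a \<le> a^2" if "a \<ge> 1" for a :: real
    using that by (simp add: power2_eq_square)
  have "hit_total M \<le> (\<Sum>z<M. (below z / cond z)^2) + (\<Sum>z\<in>{M..<n}. (above z / cond z)^2)"
    unfolding hit_total_def by (intro add_mono sum_mono sq ratio_ge_1) (use M in auto)
  then show ?thesis using hit_var_diag[OF M] by simp
qed

text \<open>The monotonicity condition forces \<open>p i < 1\<close> and \<open>q (Suc i) < 1\<close>, so that every conductance is
strictly smaller than the mass on either side. This excludes deterministic hitting times, for which
the variance in discrete time would vanish.\<close>

lemma hit_total_less_var: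
  assumes M: "M \<le> n" and mon: "\<And>i. i < n \<Longrightarrow> p i + q (Suc i) \<le> 1"
  shows "hit_total M < hit_var_left M + hit_var_right M"
proof -
  have sq: "a < a^2" if "a > 1" for a :: real
    using that by (simp add: power2_eq_square)
  have b: "below z / cond z > 1" if "z < n" for z
  proof -
    have "\<pi> z * p z < \<pi> z * 1"
      using mon[OF that] q_pos[OF that] pi_pos[of z] that by (intro mult_strict_left_mono) auto
    then have "cond z < \<pi> z" by (simp add: cond_def)
    also have "\<pi> z \<le> below z" unfolding below_def
      by (rule member_le_sum) (use that in \<open>auto simp: pi_nonneg\<close>)
    finally show ?thesis using cond_pos[OF that] by simp
  qed
  have a: "above z / cond z > 1" if "z < n" for z
  proof -
    have "\<pi> (Suc z) * q (Suc z) < \<pi> (Suc z) * 1"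
      using mon[OF that] p_pos[OF that] pi_pos[of "Suc z"] that by (intro mult_strict_left_mono) auto
    then have "cond z < \<pi> (Suc z)" using detailed_balance[OF that] by (simp add: cond_def)
    also have "\<dots> \<le> above z" using above_Suc[OF that] above_nonneg[of "Suc z"] by simp
    finally show ?thesis using cond_pos[OF that] by simp
  qed
  have "(\<Sum>z<M. below z / cond z) \<le> (\<Sum>z<M. (below z / cond z)^2)"
     "(\<Sum>z\<in>{M..<n}. above z / cond z) \<le> (\<Sum>z\<in>{M..<n}. (above z / cond z)^2)"
    by (intro sum_mono less_imp_le sq a b; use M in auto)+
  moreover have "(\<Sum>z<M. below z / cond z) < (\<Sum>z<M. (below z / cond z)^2)" if "M > 0"
    by (intro sum_strict_mono sq a b) (use M that in auto)
  moreover have "(\<Sum>z\<in>{M..<n}. above z / cond z) < (\<Sum>z\<in>{M..<n}. (above z / cond z)^2)" if "M = 0"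
    by (intro sum_strict_mono sq a b) (use M that n_pos in auto)
  ultimately have "hit_total M < (\<Sum>z<M. (below z / cond z)^2) + (\<Sum>z\<in>{M..<n}. (above z / cond z)^2)"
    unfolding hit_total_def by (cases "M = 0") auto
  then show ?thesis using hit_var_diag[OF M] by simp
qed

section \<open>Hardy type consequences of a Poincare inequality\<close>

text \<open>The Poincare inequality with constant \<open>\<nu>\<close>, written for increments: the variance is at most \<open>\<nu>\<close> times the
Dirichlet form.\<close>

definition poincare :: "real \<Rightarrow> bool" where
  "poincare \<nu> \<longleftrightarrow> (\<forall>d. (\<Sum>z<n. \<Sum>w<n. green z w * d z * d w) \<le> \<nu> * (\<Sum>z<n. cond z * (d z)^2))"

text \<open>The test function with increments \<open>a z / cond z\<close> on \<open>S\<close> has Dirichlet form \<open>\<Sum>z\<in>S. (a z)^2 / cond z\<close>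
and variance at least \<open>\<theta>\<close> times the square of this sum.\<close>

lemma hardy:
  assumes P: "poincare \<nu>" and S: "S \<subseteq> {..<n}" "S \<noteq> {}" and a: "\<And>z. z \<in> S \<Longrightarrow> a z > 0"
    and g: "\<And>z w. z \<in> S \<Longrightarrow> w \<in> S \<Longrightarrow> \<theta> * a z * a w \<le> green z w"
  shows "\<theta> * (\<Sum>z\<in>S. (a z)^2 / cond z) \<le> \<nu>"
proof -
  let ?A = "\<Sum>z\<in>S. (a z)^2 / cond z"
  have fin: "finite S" using S finite_subset by blast
  have A: "?A > 0" using S a cond_pos fin
    by (intro sum_pos divide_pos_pos zero_less_power) auto
  define d where "d z = (if z \<in> S then a z / cond z else 0)" for z
  have restr: "(\<Sum>z<n. f z) = (\<Sum>z\<in>S. f z)" if "\<And>z. z \<notin> S \<Longrightarrow> f z = 0" for f :: "nat \<Rightarrow> real"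
    using S that by (intro sum.mono_neutral_right) auto
  have C: "(\<Sum>z<n. cond z * (d z)^2) = ?A"
  proof (subst restr)
    show "(\<Sum>z\<in>S. cond z * (d z)^2) = ?A"
    proof (intro sum.cong refl)
      fix z assume z: "z \<in> S"
      then have "cond z > 0" using S cond_pos by auto
      then show "cond z * (d z)^2 = (a z)^2 / cond z" using z by (simp add: d_def power2_eq_square)
    qed
  qed (simp add: d_def)
  have "(\<Sum>z<n. \<Sum>w<n. green z w * d z * d w) = (\<Sum>z\<in>S. \<Sum>w\<in>S. green z w * d z * d w)"
    by (subst restr, simp add: d_def, rule sum.cong[OF refl], subst restr) (simp_all add: d_def)
  moreover have "(\<Sum>z\<in>S. \<Sum>w\<in>S. green z w * d z * d w) \<ge> \<theta> * ?A^2"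
  proof -
    have "\<theta> * ?A^2 = (\<Sum>z\<in>S. \<Sum>w\<in>S. (\<theta> * a z * a w) * d z * d w)"
      unfolding power2_eq_square[of ?A] sum_product
      unfolding sum_distrib_left
    proof (intro sum.cong refl)
      fix z w assume "z \<in> S" "w \<in> S"
      then show "\<theta> * ((a z)^2 / cond z * ((a w)^2 / cond w)) = (\<theta> * a z * a w) * d z * d w"
        by (simp add: d_def power2_eq_square)
    qed
    also have "\<dots> \<le> (\<Sum>z\<in>S. \<Sum>w\<in>S. green z w * d z * d w)"
    proof (intro sum_mono mult_right_mono g)
      fix z assume "z \<in> S" then show "0 \<le> d z"
        using a[of z] cond_pos[of z] S by (auto simp: d_def subset_iff intro!: divide_nonneg_pos less_imp_le)
    next
      fix z assume "z \<in> S" then show "0 \<le> d z"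
        using a[of z] cond_pos[of z] S by (auto simp: d_def subset_iff intro!: divide_nonneg_pos less_imp_le)
    qed auto
    finally show ?thesis .
  qed
  moreover have "(\<Sum>z<n. \<Sum>w<n. green z w * d z * d w) \<le> \<nu> * (\<Sum>z<n. cond z * (d z)^2)"
    using P by (simp add: poincare_def)
  ultimately have "\<theta> * ?A^2 \<le> \<nu> * (\<Sum>z<n. cond z * (d z)^2)" by linarith
  then have "\<theta> * ?A^2 \<le> \<nu> * ?A" unfolding C .
  then have "(\<theta> * ?A) * ?A \<le> \<nu> * ?A" by (simp add: power2_eq_square)
  then show ?thesis using A by (simp only: mult_le_cancel_right_pos)
qed

lemma hardy_left:
  assumes P: "poincare \<nu>" and M: "M \<le> n" "w < M" and k: "\<kappa> > 0" "\<And>z. z < M \<Longrightarrow> \<kappa> \<le> above z"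
  shows "(\<Sum>z\<le>w. (below z)^2 / cond z) \<le> \<nu> / \<kappa> * below w"
proof -
  have b: "below w > 0" using M by (intro below_pos) auto
  have "\<kappa> / below w * (\<Sum>z\<in>{..w}. (below z)^2 / cond z) \<le> \<nu>"
  proof (rule hardy[OF P])
    fix z v assume zv: "z \<in> {..w}" "v \<in> {..w}"
    have pos: "0 < below z" "0 < below v" using zv M by (auto intro!: below_pos)
    have *: "below z * below v \<le> below (min z v) * below w"
    proof (cases "z \<le> v")
      case True
      then show ?thesis using below_mono[of v w] zv M pos
        by (auto simp: min_absorb1 intro!: mult_left_mono)
    next
      case False
      then have "below v * below z \<le> below v * below w" using below_mono[of z w] zv M pos
        by (intro mult_left_mono) auto
      then show ?thesis using False by (simp add: min_absorb2 mult.commute)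
    qed
    have "\<kappa> * (below z * below v) \<le> above (max z v) * (below (min z v) * below w)"
      by (intro mult_mono * k above_nonneg) (use zv M pos in auto)
    then have "\<kappa> * (below z * below v) / below w \<le> above (max z v) * (below (min z v) * below w) / below w"
      using b by (intro divide_right_mono) auto
    also have "\<dots> = green z v" using b by (simp add: green_def)
    finally show "\<kappa> / below w * below z * below v \<le> green z v" by simp
  qed (use M in \<open>auto intro: below_pos\<close>)
  from scaled_bound[OF k(1) b this] show ?thesis .
qed

lemma hardy_right:
  assumes P: "poincare \<nu>" and M: "M \<le> w" "w < n" and k: "\<kappa> > 0" "\<And>z. M \<le> z \<Longrightarrow> z < n \<Longrightarrow> \<kappa> \<le> below z"
  shows "(\<Sum>z\<in>{w..<n}. (above z)^2 / cond z) \<le> \<nu> / \<kappa> * above w"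
proof -
  have b: "above w > 0" using M by (intro above_pos) auto
  have "\<kappa> / above w * (\<Sum>z\<in>{w..<n}. (above z)^2 / cond z) \<le> \<nu>"
  proof (rule hardy[OF P])
    fix z v assume zv: "z \<in> {w..<n}" "v \<in> {w..<n}"
    have pos: "0 < above z" "0 < above v" using zv M by (auto intro!: above_pos)
    have *: "above z * above v \<le> above (max z v) * above w"
    proof (cases "v \<le> z")
      case True
      then show ?thesis using above_antimono[of w v] zv M pos
        by (auto simp: max_absorb1 intro!: mult_left_mono)
    next
      case False
      then have "above v * above z \<le> above v * above w" using above_antimono[of w z] zv M pos
        by (intro mult_left_mono) auto
      then show ?thesis using False by (simp add: max_absorb2 mult.commute)
    qed
    have "\<kappa> * (above z * above v) \<le> below (min z v) * (above (max z v) * above w)"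
      by (intro mult_mono * k less_imp_le[OF below_pos]) (use zv M pos in auto)
    then have "\<kappa> * (above z * above v) / above w \<le> below (min z v) * (above (max z v) * above w) / above w"
      using b by (intro divide_right_mono) auto
    also have "\<dots> = green z v" using b by (simp add: green_def)
    finally show "\<kappa> / above w * above z * above v \<le> green z v" by simp
  qed (use M in \<open>auto intro: above_pos\<close>)
  from scaled_bound[OF k(1) b this] show ?thesis .
qed

lemma poincare_nonneg:
  assumes P: "poincare \<nu>"
  shows "\<nu> \<ge> 0"
  using hardy[OF P, of "{0}" "\<lambda>_. 1" 0] n_pos green_nonneg[of 0 0] by simp

lemma excess_left_le:
  assumes P: "poincare \<nu>" and M: "M \<le> n" and k: "\<kappa> > 0" "\<And>z. z < M \<Longrightarrow> \<kappa> \<le> above z"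
  shows "excess_left M \<le> \<nu> / \<kappa>"
proof (cases M)
  case 0
  then show ?thesis using poincare_nonneg[OF P] k by (simp add: excess_left_def)
next
  case (Suc w)
  have "excess_left M \<le> \<nu> / \<kappa> * below w"
    using hardy_left[OF P M, of w \<kappa>] k Suc by (simp add: excess_left_def lessThan_Suc_atMost)
  also have "\<dots> \<le> \<nu> / \<kappa>"
    using poincare_nonneg[OF P] k below_le_1[of w] M Suc by (intro mult_left_le) auto
  finally show ?thesis .
qed

lemma excess_right_le:
  assumes P: "poincare \<nu>" and M: "M \<le> n" and k: "\<kappa> > 0" "\<And>z. M \<le> z \<Longrightarrow> z < n \<Longrightarrow> \<kappa> \<le> below z"
  shows "excess_right M \<le> \<nu> / \<kappa>"
proof (cases "M = n")
  case True
  then show ?thesis using poincare_nonneg[OF P] k by (simp add: excess_right_def)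
next
  case False
  have "excess_right M \<le> \<nu> / \<kappa> * above M"
    using hardy_right[OF P, of M M \<kappa>] k False M by (simp add: excess_right_def)
  also have "\<dots> \<le> \<nu> / \<kappa>"
    using poincare_nonneg[OF P] k above_le_1[of M] M by (intro mult_left_le) auto
  finally show ?thesis .
qed

text \<open>Ordering the pairs of edges and summing the Hardy bound over the inner edge leaves the sum defining
\<open>hit_total\<close>.\<close>

lemma hit_var_le:
  assumes P: "poincare \<nu>" and M: "M \<le> n" and k: "\<kappa> > 0" "\<And>z. z < M \<Longrightarrow> \<kappa> \<le> above z"
    "\<And>z. M \<le> z \<Longrightarrow> z < n \<Longrightarrow> \<kappa> \<le> below z"
  shows "hit_var_left M + hit_var_right M \<le> 2 * \<nu> / \<kappa> * hit_total M"
proof -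
  have "hit_var_left M \<le> 2 * (\<Sum>w\<in>{..<M}. (\<Sum>z\<in>{z\<in>{..<M}. min z w = z}. (below z)^2 / cond z) / cond w)"
    unfolding hit_var_left_def
    by (rule sum_sq_le_twice_ordered) (use M cond_pos in \<open>auto simp: min_def\<close>)
  also have "\<dots> \<le> 2 * (\<Sum>w\<in>{..<M}. (\<nu> / \<kappa> * below w) / cond w)"
  proof (intro mult_left_mono sum_mono divide_right_mono)
    fix w assume w: "w \<in> {..<M}"
    then have "{z \<in> {..<M}. min z w = z} = {..w}" by (auto simp: min_def split: if_splits)
    then show "(\<Sum>z\<in>{z\<in>{..<M}. min z w = z}. (below z)^2 / cond z) \<le> \<nu> / \<kappa> * below w"
      using hardy_left[OF P M, of w \<kappa>] k w by simp
    show "0 \<le> cond w" using cond_pos[of w] w M by simp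
  qed auto
  finally have 1: "hit_var_left M \<le> 2 * \<nu> / \<kappa> * (\<Sum>w<M. below w / cond w)"
    by (simp add: sum_distrib_left mult.assoc)
  have "hit_var_right M \<le> 2 * (\<Sum>w\<in>{M..<n}. (\<Sum>z\<in>{z\<in>{M..<n}. max z w = z}. (above z)^2 / cond z) / cond w)"
    unfolding hit_var_right_def
    by (rule sum_sq_le_twice_ordered) (use M cond_pos in \<open>auto simp: max_def\<close>)
  also have "\<dots> \<le> 2 * (\<Sum>w\<in>{M..<n}. (\<nu> / \<kappa> * above w) / cond w)"
  proof (intro mult_left_mono sum_mono divide_right_mono)
    fix w assume w: "w \<in> {M..<n}"
    then have "{z \<in> {M..<n}. max z w = z} = {w..<n}" by (auto simp: max_def split: if_splits)
    then show "(\<Sum>z\<in>{z\<in>{M..<n}. max z w = z}. (above z)^2 / cond z) \<le> \<nu> / \<kappa> * above w"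
      using hardy_right[OF P, of M w \<kappa>] k w by simp
    show "0 \<le> cond w" using cond_pos[of w] w M by simp
  qed auto
  finally have 2: "hit_var_right M \<le> 2 * \<nu> / \<kappa> * (\<Sum>w\<in>{M..<n}. above w / cond w)"
    by (simp add: sum_distrib_left mult.assoc)
  show ?thesis using 1 2 unfolding hit_total_def distrib_left by linarith
qed

end

section \<open>The spectral gap and its monotone eigenfunction\<close>

lemma linear_coeff_zero:
  fixes b c :: real
  assumes "\<And>t. b * t + c * t^2 \<ge> 0"
  shows "b = 0"
proof (rule ccontr)
  assume b: "b \<noteq> 0"
  define k where "k = \<bar>c\<bar> + 1"
  have k: "k > 0" "c < k" by (auto simp: k_def)
  have "0 \<le> (b * (- b / k) + c * (- b / k)^2) * k^2"
    using assms[of "- b / k"] by (intro mult_nonneg_nonneg) auto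
  also have "\<dots> = b^2 * (c - k)"
    using k by (simp add: field_simps power2_eq_square)
  also have "\<dots> < 0" using b k by (simp add: mult_less_0_iff)
  finally show False by simp
qed

text \<open>Perron--Frobenius for a symmetric matrix with positive entries, by maximizing the quadratic form on
the unit sphere: replacing a maximizer by its absolute value does not decrease the form.\<close>

lemma symmetric_form_maximum:
  fixes a :: "nat \<Rightarrow> nat \<Rightarrow> real"
  assumes n: "n \<ge> 1" and sym: "\<And>z w. a z w = a w z"
    and pos: "\<And>z w. z < n \<Longrightarrow> w < n \<Longrightarrow> a z w > 0"
  obtains \<nu> e where "\<nu> > 0" "\<And>z. e z \<ge> 0" "\<exists>z<n. e z > 0"
    "\<And>z. z < n \<Longrightarrow> (\<Sum>w<n. a z w * e w) = \<nu> * e z"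
    "\<And>d. (\<Sum>z<n. \<Sum>w<n. a z w * d z * d w) \<le> \<nu> * (\<Sum>z<n. (d z)^2)"
proof -
  define Q where "Q d = (\<Sum>z<n. \<Sum>w<n. a z w * d z * d w)" for d
  define N where "N d = (\<Sum>z<n. (d z)^2)" for d :: "nat \<Rightarrow> real"
  define S where "S i = (if i < n then {-1..1} else {0::real})" for i
  define K where "K = {e. (\<forall>i. e i \<in> S i)} \<inter> {e. N e = 1}"
  \<comment> \<open>Coordinates from \<open>n\<close> on are set to zero, which embeds the sphere into a compact product.\<close>
  have "compact {e. (\<forall>i. e i \<in> S i)}"
  proof -
    have "compactin (product_topology (\<lambda>_. euclidean) UNIV) (PiE UNIV S)"
      unfolding compactin_PiE by (auto simp: S_def)
    then show ?thesis by (simp add: euclidean_product_topology PiE_UNIV_domain Pi_def)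
  qed
  moreover have "closed {e. N e = 1}"
    unfolding N_def by (intro closed_Collect_eq continuous_intros continuous_on_product_coordinates)
  ultimately have "compact K" unfolding K_def by (rule compact_Int_closed)
  moreover have "(\<lambda>i. of_bool (i = 0)) \<in> K"
  proof -
    have "N (\<lambda>i. of_bool (i = 0)) = (\<Sum>z<n. if z = 0 then 1 else 0)"
      unfolding N_def by (intro sum.cong) auto
    then show ?thesis using n by (auto simp: K_def S_def)
  qed
  moreover have "continuous_on K Q"
    unfolding Q_def by (intro continuous_intros continuous_on_subset[OF continuous_on_product_coordinates]) auto
  ultimately obtain e0 where e0: "e0 \<in> K" "\<And>d. d \<in> K \<Longrightarrow> Q d \<le> Q e0"
    using continuous_attains_sup[of K Q] by blast
  define \<nu> where "\<nu> = Q e0"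
  define e where "e i = \<bar>e0 i\<bar>" for i
  have Ne: "N e = 1" using e0(1) by (simp add: K_def N_def e_def)
  have bound: "Q d \<le> \<nu> * N d" for d
  proof (cases "N d = 0")
    case True
    then have "\<And>z. z < n \<Longrightarrow> d z = 0" unfolding N_def by (subst (asm) sum_nonneg_eq_0_iff) auto
    then show ?thesis using True by (simp add: Q_def)
  next
    case False
    have "N d \<ge> 0" by (simp add: N_def sum_nonneg)
    with False have Np: "N d > 0" by simp
    define r where "r = sqrt (N d)"
    have r: "r > 0" "r^2 = N d" using Np by (auto simp: r_def)
    define d' where "d' i = (if i < n then d i / r else 0)" for i
    have N': "N d' = 1"
    proof -
      have "N d' = (\<Sum>z<n. (d z)^2) / r^2"
        unfolding N_def sum_divide_distrib by (intro sum.cong) (auto simp: d'_def power_divide)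
      then show ?thesis using Np by (simp add: r N_def)
    qed
    have "d' \<in> K"
    proof -
      have "\<bar>d' i\<bar> \<le> 1" if "i < n" for i
      proof -
        have "(d' i)^2 \<le> N d'" unfolding N_def by (rule member_le_sum) (use that in auto)
        then show ?thesis using N' by (simp add: abs_square_le_1)
      qed
      then show ?thesis using N' by (auto simp: K_def S_def abs_le_iff) (auto simp: d'_def)
    qed
    then have "Q d' \<le> \<nu>" using e0(2) by (simp add: \<nu>_def)
    moreover have "Q d' = Q d / r^2"
      unfolding Q_def sum_divide_distrib
      by (intro sum.cong refl) (auto simp: d'_def power2_eq_square)
    ultimately show ?thesis using r Np by (simp add: pos_divide_le_eq mult.commute)
  qed
  have Qe: "Q e = \<nu>"
  proof (rule antisym)
    show "Q e \<le> \<nu>" using bound[of e] Ne by simp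
    show "\<nu> \<le> Q e" unfolding \<nu>_def Q_def
    proof (intro sum_mono)
      fix z w assume "z \<in> {..<n}" "w \<in> {..<n}"
      then have "a z w > 0" using pos by simp
      moreover have "e0 z * e0 w \<le> e z * e w" by (metis abs_ge_self abs_mult e_def)
      ultimately show "a z w * e0 z * e0 w \<le> a z w * e z * e w"
        by (simp add: mult.assoc)
    qed
  qed
  have ex: "\<exists>z<n. e z > 0"
  proof (rule ccontr)
    assume "\<not> ?thesis"
    then have "\<And>z. z < n \<Longrightarrow> e z = 0" by (force simp: e_def)
    then show False using Ne by (simp add: N_def)
  qed
  \<comment> \<open>The form \<open>\<nu> N - Q\<close> is nonnegative and vanishes at \<open>e\<close>, so its derivative in each coordinate is zero.\<close>
  have eig: "(\<Sum>w<n. a z w * e w) = \<nu> * e z" if z: "z < n" for z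
  proof -
    define D where "D t = (\<lambda>i. e i + t * of_bool (i = z))" for t :: real
    have s1: "(\<Sum>w<n. f w * of_bool (w = z)) = f z" for f :: "nat \<Rightarrow> real"
    proof -
      have "(\<Sum>w<n. f w * of_bool (w = z)) = (\<Sum>w<n. if w = z then f w else 0)"
        by (intro sum.cong) auto
      then show ?thesis using z by simp
    qed
    have ND: "N (D t) = 1 + 2 * t * e z + t^2" for t
    proof -
      have "N (D t) = (\<Sum>w<n. (e w)^2 + ((2 * t * e w + t^2) * of_bool (w = z)))"
        unfolding N_def D_def by (intro sum.cong) (auto simp: power2_eq_square algebra_simps)
      then show ?thesis using Ne by (simp only: sum.distrib s1) (simp add: N_def)
    qed
    have QD: "Q (D t) = \<nu> + 2 * t * (\<Sum>w<n. a z w * e w) + t^2 * a z z" for t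
    proof -
      have "Q (D t) = (\<Sum>v<n. \<Sum>w<n. a v w * e v * e w + (t * a v w * e v) * of_bool (w = z)
          + (t * a v w * e w + t^2 * a v w * of_bool (w = z)) * of_bool (v = z))"
        unfolding Q_def D_def by (intro sum.cong refl) (auto simp: power2_eq_square algebra_simps)
      also have "\<dots> = Q e + (\<Sum>v<n. t * a v z * e v) + (\<Sum>w<n. (t * a z w * e w + t^2 * a z w * of_bool (w = z)))"
        by (simp only: sum.distrib s1 sum_distrib_right[symmetric] Q_def)
      also have "(\<Sum>v<n. t * a v z * e v) = t * (\<Sum>w<n. a z w * e w)"
        unfolding sum_distrib_left by (intro sum.cong refl) (simp add: sym[of _ z])
      also have "(\<Sum>w<n. (t * a z w * e w + t^2 * a z w * of_bool (w = z))) = t * (\<Sum>w<n. a z w * e w) + t^2 * a z z"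
        by (simp only: sum.distrib s1) (simp add: sum_distrib_left mult.assoc)
      finally show ?thesis using Qe by simp
    qed
    have "2 * (\<nu> * e z - (\<Sum>w<n. a z w * e w)) = 0"
    proof (rule linear_coeff_zero[of _ "\<nu> - a z z"])
      fix t
      show "2 * (\<nu> * e z - (\<Sum>w<n. a z w * e w)) * t + (\<nu> - a z z) * t^2 \<ge> 0"
        using bound[of "D t"] unfolding ND QD by (simp add: algebra_simps)
    qed
    then show ?thesis by simp
  qed
  have "\<nu> > 0"
  proof -
    obtain z where z: "z < n" "e z > 0" using ex by blast
    have "(\<Sum>w<n. a z w * e w) > 0"
      by (rule sum_pos2[of _ z]) (use z pos in \<open>auto intro!: mult_nonneg_nonneg less_imp_le[OF pos] simp: e_def\<close>)
    then show ?thesis using eig[OF z(1)] z(2) by (simp add: zero_less_mult_iff)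
  qed
  then show thesis
    by (rule that[of \<nu> e]) (use ex eig bound in \<open>auto simp: e_def Q_def N_def\<close>)
qed

context bd_chain
begin

lemma potential_cong: "(\<And>z. z < n \<Longrightarrow> d z = d' z) \<Longrightarrow> potential d x = potential d' x"
  unfolding potential_def by (intro sum.cong) auto

lemma green_pos: "z < n \<Longrightarrow> w < n \<Longrightarrow> green z w > 0"
  unfolding green_def by (intro mult_pos_pos below_pos above_pos) auto

text \<open>Rescaling the increments by the square root of the conductances turns the Rayleigh quotient of \<open>green\<close>
against the Dirichlet form into a standard symmetric eigenvalue problem.\<close>

lemma extremal_flux:
  obtains \<nu> d where "\<nu> > 0" "poincare \<nu>" "\<And>z. z < n \<Longrightarrow> d z \<ge> 0" "\<exists>z<n. d z > 0"
    "\<And>z. z < n \<Longrightarrow> (\<Sum>w<n. d w * green z w) = \<nu> * (cond z * d z)"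
proof -
  define h where "h z = sqrt (cond z)" for z
  have h: "h z > 0" "h z * h z = cond z" if "z < n" for z
    using cond_pos[OF that] by (auto simp: h_def)
  obtain \<nu> e where ne: "\<nu> > 0" "\<And>z. e z \<ge> 0" "\<exists>z<n. e z > 0"
    "\<And>z. z < n \<Longrightarrow> (\<Sum>w<n. green z w / (h z * h w) * e w) = \<nu> * e z"
    "\<And>d. (\<Sum>z<n. \<Sum>w<n. green z w / (h z * h w) * d z * d w) \<le> \<nu> * (\<Sum>z<n. (d z)^2)"
    by (rule symmetric_form_maximum[of n "\<lambda>z w. green z w / (h z * h w)"])
      (use n_pos green_pos h in \<open>auto simp: green_sym mult.commute\<close>)
  show thesis
  proof (rule that[of \<nu> "\<lambda>z. e z / h z"])
    show "poincare \<nu>" unfolding poincare_def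
    proof
      fix d
      have "(\<Sum>z<n. \<Sum>w<n. green z w * d z * d w) =
         (\<Sum>z<n. \<Sum>w<n. green z w / (h z * h w) * (h z * d z) * (h w * d w))"
        by (intro sum.cong refl) (use h in \<open>auto simp: less_imp_neq[symmetric]\<close>)
      also have "\<dots> \<le> \<nu> * (\<Sum>z<n. (h z * d z)^2)" by (rule ne(5))
      also have "(\<Sum>z<n. (h z * d z)^2) = (\<Sum>z<n. cond z * (d z)^2)"
        by (intro sum.cong refl) (simp add: power_mult_distrib power2_eq_square[of "h _"] h)
      finally show "(\<Sum>z<n. \<Sum>w<n. green z w * d z * d w) \<le> \<nu> * (\<Sum>z<n. cond z * (d z)^2)" .
    qed
    fix z assume z: "z < n"
    show "e z / h z \<ge> 0" using ne(2)[of z] h(1)[OF z] by simp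
    have "(\<Sum>w<n. e w / h w * green z w) = h z * (\<Sum>w<n. green z w / (h z * h w) * e w)"
      unfolding sum_distrib_left by (intro sum.cong refl) (use h[OF z] in auto)
    also have "\<dots> = \<nu> * ((h z * h z) * (e z / h z))" using ne(4)[OF z] h(1)[OF z] by simp
    finally show "(\<Sum>w<n. e w / h w * green z w) = \<nu> * (cond z * (e z / h z))" using h[OF z] by simp
  next
    show "\<exists>z<n. e z / h z > 0" using ne(3) h(1) by (meson divide_pos_pos)
  qed (use ne in auto)
qed

lemma abs_step_le:
  assumes x: "x \<le> n" and b: "\<And>y. y \<le> n \<Longrightarrow> \<bar>f y\<bar> \<le> b"
  shows "\<bar>step f x\<bar> \<le> b"
proof -
  have b0: "b \<ge> 0" using b[of 0] by simp
  have 1: "\<bar>p x * f (Suc x)\<bar> \<le> p x * b"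
    using b[of "Suc x"] p_nonneg[OF x] p_n x by (cases "x = n") (auto simp: abs_mult intro!: mult_left_mono)
  have 2: "\<bar>q x * f (x - 1)\<bar> \<le> q x * b"
    using b[of "x - 1"] q_nonneg[OF x] x by (auto simp: abs_mult intro!: mult_left_mono)
  have 3: "\<bar>(1 - p x - q x) * f x\<bar> \<le> (1 - p x - q x) * b"
    using b[of x] pq_le[OF x] x by (auto simp: abs_mult intro!: mult_left_mono)
  have "\<bar>step f x\<bar> \<le> p x * b + q x * b + (1 - p x - q x) * b"
    unfolding step_def using 1 2 3 by linarith
  also have "\<dots> = b" by (simp add: algebra_simps)
  finally show ?thesis .
qed

text \<open>\<open>step\<close> is an averaging operator, so it does not increase the maximum of \<open>\<bar>f\<bar>\<close>.\<close>

lemma eigenvalue_range: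
  assumes eig: "\<And>x. x \<le> n \<Longrightarrow> step f x = (1 - l) * f x" and nz: "\<exists>x\<le>n. f x \<noteq> 0"
  shows "0 \<le> l" "l \<le> 2"
proof -
  define m where "m = Max ((\<lambda>x. \<bar>f x\<bar>) ` {..n})"
  have le: "\<bar>f y\<bar> \<le> m" if "y \<le> n" for y unfolding m_def using that by (intro Max_ge) auto
  have "m \<in> (\<lambda>x. \<bar>f x\<bar>) ` {..n}" unfolding m_def by (intro Max_in) auto
  then obtain x where x: "x \<le> n" "m = \<bar>f x\<bar>" by auto
  have "m > 0" using nz le by force
  have "\<bar>1 - l\<bar> * m \<le> 1 * m"
    using abs_step_le[OF x(1), of f m] le eig[OF x(1)] x(2) by (simp add: abs_mult)
  then have "\<bar>1 - l\<bar> \<le> 1" using \<open>m > 0\<close> by (simp only: mult_le_cancel_right_pos)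
  then show "0 \<le> l" "l \<le> 2" by linarith+
qed

lemma eq_potential:
  assumes mean: "(\<Sum>y\<le>n. \<pi> y * f y) = 0" and x: "x \<le> n"
  shows "f x = potential (\<lambda>z. f z - f (Suc z)) x"
proof -
  let ?g = "potential (\<lambda>z. f z - f (Suc z))"
  have *: "f y - ?g y = f 0 - ?g 0" if "y \<le> n" for y
    using that
  proof (induction y)
    case (Suc y)
    then show ?case using potential_diff[of y "\<lambda>z. f z - f (Suc z)"] by simp
  qed simp
  have "(\<Sum>y\<le>n. \<pi> y * (f y - ?g y)) = (\<Sum>y\<le>n. \<pi> y * (f 0 - ?g 0))"
    by (intro sum.cong refl) (metis * atMost_iff)
  also have "\<dots> = f 0 - ?g 0" by (simp add: sum_distrib_right[symmetric] pi_sum)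
  finally have "f 0 - ?g 0 = 0"
    by (simp add: right_diff_distrib sum_subtractf mean potential_mean)
  then show ?thesis using *[OF x] by simp
qed

text \<open>An eigenfunction for \<open>l \<noteq> 0\<close> has mean zero, and its Dirichlet form is \<open>l\<close> times its variance.\<close>

lemma eigenvalue_ge:
  assumes P: "poincare \<nu>" "\<nu> > 0" and l: "l \<noteq> 0"
    and eig: "\<And>x. x \<le> n \<Longrightarrow> step f x = (1 - l) * f x" and nz: "\<exists>x\<le>n. f x \<noteq> 0"
  shows "1 / \<nu> \<le> l"
proof -
  have lpos: "l > 0" using eigenvalue_range[OF eig nz] l by simp
  have "(\<Sum>y\<le>n. \<pi> y * ((1 - l) * f y)) = (\<Sum>y\<le>n. \<pi> y * f y)"
    using pi_step[of f] eig by simp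
  moreover have "(\<Sum>y\<le>n. \<pi> y * ((1 - l) * f y)) = (1 - l) * (\<Sum>y\<le>n. \<pi> y * f y)"
    by (simp add: sum_distrib_left mult.left_commute)
  ultimately have mean: "(\<Sum>y\<le>n. \<pi> y * f y) = 0" using l by (simp add: algebra_simps)
  define d where "d z = f z - f (Suc z)" for z
  have f: "f x = potential d x" if "x \<le> n" for x
    using eq_potential[OF mean that] by (simp add: d_def[abs_def])
  have fl: "cond z * d z = l * (\<Sum>w<n. d w * green z w)" if "z < n" for z
  proof -
    have "cond z * d z = (\<Sum>y\<le>z. \<pi> y * (f y - step f y))"
      using flux_sum[of z f] that by (simp add: d_def)
    also have "\<dots> = (\<Sum>y\<le>z. l * (\<pi> y * potential d y))"
    proof (intro sum.cong refl)
      fix y assume "y \<in> {..z}"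
      then have "y \<le> n" using that by simp
      then show "\<pi> y * (f y - step f y) = l * (\<pi> y * potential d y)"
        unfolding eig[OF \<open>y \<le> n\<close>] f[OF \<open>y \<le> n\<close>, symmetric] by (simp add: left_diff_distrib)
    qed
    finally show ?thesis using that by (simp only: sum_distrib_left[symmetric] potential_mass less_imp_le)
  qed
  let ?C = "\<Sum>z<n. cond z * (d z)^2" and ?Q = "\<Sum>z<n. \<Sum>w<n. green z w * d z * d w"
  have CQ: "?C = l * ?Q"
  proof -
    have "?C = (\<Sum>z<n. d z * (cond z * d z))"
      by (intro sum.cong refl) (simp add: power2_eq_square)
    also have "\<dots> = (\<Sum>z<n. d z * (l * (\<Sum>w<n. d w * green z w)))"
      by (intro sum.cong refl) (simp add: fl)
    finally show ?thesis by (simp add: sum_distrib_left mult_ac)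
  qed
  have "?Q \<le> \<nu> * ?C" using P by (simp add: poincare_def)
  then have "l * ?Q \<le> l * (\<nu> * ?C)" using lpos by (intro mult_left_mono) auto
  then have "?C \<le> l * (\<nu> * ?C)" unfolding CQ[symmetric] .
  then have "1 * ?C \<le> (l * \<nu>) * ?C" by (simp only: mult.assoc mult_1_left)
  moreover have "?C > 0"
  proof -
    have "\<exists>z<n. d z \<noteq> 0"
    proof (rule ccontr)
      assume "\<not> ?thesis"
      then have "potential d x = 0" for x by (simp add: potential_def)
      then show False using f nz by auto
    qed
    then obtain z where "z < n" "d z \<noteq> 0" by blast
    then show ?thesis
      by (intro sum_pos2[of _ z]) (auto intro!: mult_pos_pos cond_pos mult_nonneg_nonneg less_imp_le[OF cond_pos])
  qed
  ultimately have "1 \<le> l * \<nu>" by (simp only: mult_le_cancel_right_pos)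
  then show ?thesis using P(2) by (simp add: field_simps)
qed

text \<open>The nonnegative increments of \<open>extremal_flux\<close> are those of a decreasing eigenfunction, and by
\<open>eigenvalue_ge\<close> its eigenvalue \<open>1 / \<nu>\<close> is the smallest non-zero one.\<close>

lemma monotone_eigenfunction:
  obtains \<nu> \<psi> where "\<nu> > 0" "poincare \<nu>" "\<And>x. x \<le> n \<Longrightarrow> step \<psi> x = (1 - 1 / \<nu>) * \<psi> x"
    "\<And>x. x \<le> n \<Longrightarrow> \<psi> x \<le> \<psi> 0" "\<psi> 0 > 0" "(\<Sum>y\<le>n. \<pi> y * \<psi> y) = 0"
proof -
  obtain \<nu> d where nd: "\<nu> > 0" "poincare \<nu>" "\<And>z. z < n \<Longrightarrow> d z \<ge> 0" "\<exists>z<n. d z > 0"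
    "\<And>z. z < n \<Longrightarrow> (\<Sum>w<n. d w * green z w) = \<nu> * (cond z * d z)"
    using extremal_flux by blast
  show thesis
  proof (rule that[OF nd(1,2), of "potential d"])
    fix x assume x: "x \<le> n"
    define g where "g z = (\<Sum>y\<le>z. \<pi> y * (potential d y / \<nu>))" for z
    have g: "g z = (\<Sum>w<n. d w * green z w) / \<nu>" if "z \<le> n" for z
      using potential_mass[OF that, of d] by (simp add: g_def sum_divide_distrib[symmetric])
    have eq: "potential (\<lambda>z. g z / cond z) y = potential d y" for y
    proof (rule potential_cong)
      fix z assume "z < n"
      then show "g z / cond z = d z" using cond_pos[of z] nd(1,5) by (simp add: g)
    qed
    have "step (potential (\<lambda>z. g z / cond z)) x = potential (\<lambda>z. g z / cond z) x - potential d x / \<nu>"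
      by (rule poisson_solution[OF x])
         (use potential_mean[of d] in \<open>auto simp: g_def sum_divide_distrib[symmetric]\<close>)
    moreover have "potential (\<lambda>z. g z / cond z) = potential d" using eq by (rule ext)
    ultimately show "step (potential d) x = (1 - 1 / \<nu>) * potential d x"
      by (simp add: algebra_simps)
    show "potential d x \<le> potential d 0" using x
    proof (induction x)
      case (Suc x)
      then show ?case using potential_diff[of x d] nd(3)[of x] by simp
    qed simp
  next
    obtain z where z: "z < n" "d z > 0" using nd(4) by blast
    show "potential d 0 > 0" unfolding potential_0
      by (rule sum_pos2[of _ z]) (use z nd(3) above_pos above_nonneg in auto)
  qed (rule potential_mean)
qed

end

section \<open>Tail sums and Chebyshev bounds for sequences\<close>

text \<open>For a tail \<open>a\<close> of a random time, \<open>U\<close> and \<open>W\<close> are its iterated tail sums once they are known to vanish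
at infinity. The domination by \<open>C * a\<close> provides this: boundedness of \<open>U\<close> makes \<open>a\<close> summable, hence null,
and then \<open>U\<close> and \<open>W\<close> are null too.\<close>

lemma summed_tails:
  fixes a U W :: "nat \<Rightarrow> real"
  assumes a: "\<And>m. a m \<ge> 0" "\<And>m. a (Suc m) \<le> a m"
    and U: "\<And>m. U m - U (Suc m) = a m" and W: "\<And>m. W m - W (Suc m) = U m"
    and C: "\<And>m. \<bar>U m\<bar> \<le> C * a m" "\<And>m. \<bar>W m\<bar> \<le> C * a m"
  shows "a sums U 0" "(\<lambda>m. real (m + 1) * a m) sums W 0" "a \<longlonglongrightarrow> 0"
proof -
  have dec: "a m \<le> a 0" for m
    by (induction m) (use a(2) order_trans in auto)
  have sumU: "(\<Sum>k<m. a k) = U 0 - U m" for m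
    by (induction m) (simp_all add: U[symmetric])
  have sumW: "(\<Sum>k<m. U k) = W 0 - W m" for m
    by (induction m) (simp_all add: W[symmetric])
  have C0: "C * a m \<le> \<bar>C\<bar> * a 0" for m
    using dec[of m] a(1)[of m] by (intro mult_mono) auto
  have "summable a"
  proof (rule summableI_nonneg_bounded)
    show "(\<Sum>k<m. a k) \<le> U 0 + \<bar>C\<bar> * a 0" for m
      unfolding sumU using C(1)[of m] C0[of m] by linarith
  qed (rule a(1))
  then show a0: "a \<longlonglongrightarrow> 0" by (rule summable_LIMSEQ_zero)
  have Ca: "(\<lambda>m. C * a m) \<longlonglongrightarrow> 0" using tendsto_mult_right_zero[OF a0] .
  have U0: "U \<longlonglongrightarrow> 0" and W0: "W \<longlonglongrightarrow> 0"
    by (rule Lim_null_comparison[OF _ Ca], use C in auto)+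
  have "(\<lambda>m. U 0 - U m) \<longlonglongrightarrow> U 0 - 0" by (intro tendsto_intros U0)
  then show sU: "a sums U 0" unfolding sums_def sumU by simp
  have Unn: "U m \<ge> 0" for m
  proof (rule LIMSEQ_le_const2[OF U0])
    have "U k \<le> U m" if "m \<le> k" for k
      using that
    proof (induction k rule: dec_induct)
      case (step k)
      then show ?case using U[of k] a(1)[of k] by linarith
    qed simp
    then show "\<exists>N. \<forall>k\<ge>N. U k \<le> U m" by blast
  qed
  define Z where "Z m = (\<Sum>k<m. real (k + 1) * a k)" for m
  have Z: "Z m = W 0 - W m - real m * U m" for m
  proof (induction m)
    case (Suc m)
    then show ?case using U[of m] W[of m] by (simp add: Z_def algebra_simps)
  qed (simp add: Z_def)
  have "summable (\<lambda>m. real (m + 1) * a m)"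
  proof (rule summableI_nonneg_bounded)
    show "(\<Sum>k<m. real (k + 1) * a k) \<le> W 0 + \<bar>C\<bar> * a 0" for m
    proof -
      have "real m * U m \<ge> 0" using Unn by simp
      then show ?thesis using Z[of m] C(2)[of m] C0[of m] unfolding Z_def by linarith
    qed
  qed (use a(1) in simp)
  then obtain L where L: "Z \<longlonglongrightarrow> L" unfolding Z_def[abs_def] summable_def sums_def by blast
  have mULe: "real m * U m \<le> L - Z m" for m
  proof -
    have "real m * (U m - U l) \<le> Z l - Z m" if "l \<ge> m" for l
      using that
    proof (induction l rule: dec_induct)
      case (step l)
      have "real m * a l \<le> real (l + 1) * a l" using step a(1) by (intro mult_right_mono) auto
      then show ?case using step U[of l] by (simp add: Z_def algebra_simps)
    qed simp
    moreover have "(\<lambda>l. real m * (U m - U l)) \<longlonglongrightarrow> real m * (U m - 0)"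
      by (intro tendsto_intros U0)
    moreover have "(\<lambda>l. Z l - Z m) \<longlonglongrightarrow> L - Z m" by (intro tendsto_intros L)
    ultimately have "real m * (U m - 0) \<le> L - Z m" by (intro LIMSEQ_le) auto
    then show ?thesis by simp
  qed
  have "(\<lambda>m. L - Z m) \<longlonglongrightarrow> L - L" by (intro tendsto_intros L)
  then have LZ: "(\<lambda>m. L - Z m) \<longlonglongrightarrow> 0" by simp
  have mU: "(\<lambda>m. real m * U m) \<longlonglongrightarrow> 0"
  proof (rule Lim_null_comparison[OF _ LZ], rule always_eventually, rule allI)
    fix m
    show "norm (real m * U m) \<le> L - Z m" using mULe[of m] Unn[of m] by simp
  qed
  have "Z \<longlonglongrightarrow> W 0 - 0 - 0" unfolding Z[abs_def] by (intro tendsto_intros W0 mU)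
  then show "(\<lambda>m. real (m + 1) * a m) sums W 0" by (simp add: sums_def Z_def[abs_def])
qed

lemma decreasing_term_le:
  fixes h :: "nat \<Rightarrow> real"
  assumes h: "\<And>m. h m \<ge> 0" "\<And>m. h (Suc m) \<le> h m" and t: "h sums t"
  shows "h m \<le> t / (real m + 1)"
proof -
  have dec: "h m \<le> h k" if "k \<le> m" for k
    using that
  proof (induction m rule: dec_induct)
    case (step m) then show ?case using h(2)[of m] by linarith
  qed simp
  have "(real m + 1) * h m = (\<Sum>k<Suc m. h m)" by (simp add: algebra_simps)
  also have "\<dots> \<le> (\<Sum>k<Suc m. h k)" by (intro sum_mono dec) auto
  also have "\<dots> \<le> t"
    using t h(1) by (metis finite_lessThan sum_le_suminf sums_unique sums_summable)
  finally show ?thesis by (simp add: field_simps)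
qed

text \<open>Chebyshev's inequality for the integer valued law with tail \<open>h\<close>; the value \<open>v\<close> is its variance, since
\<open>s\<close> is the expectation of \<open>T(T+1)/2\<close>.\<close>

lemma tail_chebyshev:
  fixes h :: "nat \<Rightarrow> real"
  assumes h: "\<And>m. h m \<ge> 0" "\<And>m. h m \<le> 1" "\<And>m. h (Suc m) \<le> h m"
    and t: "h sums t" and s: "(\<lambda>m. real (m + 1) * h m) sums s"
    and v: "v = 2 * s - t - t^2" and a: "a > 0"
  shows "real m \<ge> t + a \<Longrightarrow> h m \<le> v / a^2" "real m \<le> t - a \<Longrightarrow> 1 - h m \<le> v / a^2"
proof -
  define g where "g m = (real m - t)^2" for m
  \<comment> \<open>The point masses of the law, and the truncated expectation of \<open>g(T)\<close> by summation by parts.\<close>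
  define P where "P m = (case m of 0 \<Rightarrow> 1 - h 0 | Suc k \<Rightarrow> h k - h (Suc k))" for m
  have P0: "P m \<ge> 0" for m using h by (cases m) (auto simp: P_def)
  define V where "V L = g 0 + (\<Sum>m<L. (g (Suc m) - g m) * h m)" for L
  have hL: "h \<longlonglongrightarrow> 0" using t summable_LIMSEQ_zero by (auto simp: summable_def)
  have "(\<lambda>m. 2 * (real (m + 1) * h m) - (1 + 2 * t) * h m) sums (2 * s - (1 + 2 * t) * t)"
    by (intro sums_diff sums_mult s t)
  moreover have "2 * (real (m + 1) * h m) - (1 + 2 * t) * h m = (g (Suc m) - g m) * h m" for m
    by (simp add: g_def power2_eq_square algebra_simps)
  ultimately have "(\<lambda>m. (g (Suc m) - g m) * h m) sums (2 * s - (1 + 2 * t) * t)" by simp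
  then have "V \<longlonglongrightarrow> g 0 + (2 * s - (1 + 2 * t) * t)"
    unfolding V_def[abs_def] sums_def by (intro tendsto_intros)
  moreover have "g 0 + (2 * s - (1 + 2 * t) * t) = v"
    by (simp add: v g_def power2_eq_square algebra_simps)
  ultimately have V: "V \<longlonglongrightarrow> v" by simp
  have id: "(\<Sum>m\<le>L. P m * g m) = V L - g L * h L" for L
    by (induction L) (simp_all add: P_def V_def algebra_simps)
  have PV: "(\<Sum>m\<le>L. P m * g m) \<le> V L" for L
    unfolding id using h(1)[of L] by (simp add: g_def)
  have Psum: "(\<Sum>m\<le>L. P m) = 1 - h L" for L
    by (induction L) (simp_all add: P_def)
  {
    assume m: "real m \<ge> t + a"
    have "a^2 * (h m - h L) \<le> V L" if "L \<ge> m" for L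
    proof -
      have "{..L} = {..m} \<union> {m<..L}" "{..m} \<inter> {m<..L} = {}" using that by auto
      then have split: "(\<Sum>k\<le>L. f k) = (\<Sum>k\<le>m. f k) + (\<Sum>k\<in>{m<..L}. f k)" for f :: "nat \<Rightarrow> real"
        by (simp add: sum.union_disjoint)
      have "a^2 * (h m - h L) = (\<Sum>k\<in>{m<..L}. P k * a^2)"
        using split[of P] Psum[of L] Psum[of m] by (simp add: sum_distrib_right[symmetric])
      also have "\<dots> \<le> (\<Sum>k\<in>{m<..L}. P k * g k)"
        unfolding g_def using m a by (intro sum_mono mult_left_mono P0 power_mono) auto
      also have "\<dots> \<le> (\<Sum>k\<le>L. P k * g k)"
        unfolding split[of "\<lambda>k. P k * g k"] using P0 by (simp add: sum_nonneg g_def)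
      finally show ?thesis using PV[of L] by simp
    qed
    moreover have "(\<lambda>L. a^2 * (h m - h L)) \<longlonglongrightarrow> a^2 * (h m - 0)" by (intro tendsto_intros hL)
    ultimately have "a^2 * (h m - 0) \<le> v" by (intro LIMSEQ_le[OF _ V]) auto
    then show "h m \<le> v / a^2" using a by (simp add: pos_le_divide_eq mult.commute)
  }
  {
    assume m: "real m \<le> t - a"
    have "a^2 * (1 - h m) \<le> V L" if "L \<ge> m" for L
    proof -
      have "a^2 * (1 - h m) = (\<Sum>k\<le>m. P k * a^2)"
        using Psum[of m] by (simp add: sum_distrib_right[symmetric])
      also have "\<dots> \<le> (\<Sum>k\<le>m. P k * g k)"
        unfolding g_def power2_commute[of _ t] using m a by (intro sum_mono mult_left_mono P0 power_mono) auto
      also have "\<dots> \<le> (\<Sum>k\<le>L. P k * g k)"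
        using that P0 by (intro sum_mono2) (auto simp: g_def)
      finally show ?thesis using PV[of L] by simp
    qed
    then have "a^2 * (1 - h m) \<le> v" by (intro LIMSEQ_le[OF tendsto_const V]) auto
    then show "1 - h m \<le> v / a^2" using a by (simp add: pos_le_divide_eq mult.commute)
  }
qed

section \<open>Separation in discrete time\<close>

context bd_chain
begin

definition kernel :: "real mat" where
  "kernel = mat (Suc n) (Suc n) (\<lambda>(i, j).
     if j = Suc i then p i else if i = Suc j then q i else if j = i then 1 - p i - q i else 0)"

lemma kernel_carrier: "kernel \<in> carrier_mat (Suc n) (Suc n)"
  by (simp add: kernel_def)

lemma kernel_row:
  assumes x: "x \<le> n"
  shows "(\<Sum>y\<le>n. kernel $$ (x, y) * f y) = step f x"
proof -
  have "(\<Sum>y\<le>n. kernel $$ (x, y) * f y) =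
    (\<Sum>y\<le>n. (if y = Suc x then p x * f y else 0) + (if y = x - 1 then (if x = 0 then 0 else q x * f y) else 0)
      + (if y = x then (1 - p x - q x) * f y else 0))"
    using x by (intro sum.cong refl) (auto simp: kernel_def)
  also have "\<dots> = step f x"
    using x p_n q_0 by (cases "x = n") (auto simp: sum.distrib step_def)
  finally show ?thesis .
qed

lemma kernel_reversible:
  assumes "x \<le> n" "y \<le> n"
  shows "\<pi> x * kernel $$ (x, y) = \<pi> y * kernel $$ (y, x)"
proof -
  have "\<pi> x * p x = \<pi> (Suc x) * q (Suc x)" if "Suc x \<le> n" for x
    using detailed_balance[of x] that by simp
  then show ?thesis using assms by (auto simp: kernel_def)
qed

lemma kernel_adjoint:
  assumes y: "y \<le> n"
  shows "(\<Sum>x\<le>n. (\<pi> x * f x) * kernel $$ (x, y)) = \<pi> y * step f y"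
proof -
  have "(\<Sum>x\<le>n. (\<pi> x * f x) * kernel $$ (x, y)) = (\<Sum>x\<le>n. \<pi> y * (kernel $$ (y, x) * f x))"
    using kernel_reversible[OF _ y] by (intro sum.cong refl) (simp add: mult_ac)
  then show ?thesis by (simp add: sum_distrib_left[symmetric] kernel_row[OF y])
qed

lemma step_self_adjoint:
  "(\<Sum>x\<le>n. \<pi> x * step f x * g x) = (\<Sum>x\<le>n. \<pi> x * f x * step g x)"
proof -
  have "(\<Sum>x\<le>n. \<pi> x * step f x * g x) = (\<Sum>y\<le>n. \<Sum>x\<le>n. (\<pi> x * f x) * kernel $$ (x, y) * g y)"
    by (intro sum.cong refl) (simp add: kernel_adjoint[symmetric] sum_distrib_right)
  also have "\<dots> = (\<Sum>x\<le>n. \<Sum>y\<le>n. (\<pi> x * f x) * (kernel $$ (x, y) * g y))"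
    by (subst sum.swap) (simp add: mult.assoc)
  also have "\<dots> = (\<Sum>x\<le>n. \<pi> x * f x * step g x)"
    by (intro sum.cong refl) (simp add: kernel_row[symmetric] sum_distrib_left)
  finally show ?thesis .
qed

text \<open>The density of \<open>K^m(0,\<cdot>)\<close> with respect to \<open>\<pi>\<close>. By reversibility it evolves under \<open>step\<close>.\<close>

definition dens :: "nat \<Rightarrow> nat \<Rightarrow> real" where
  "dens m = (step ^^ m) (\<lambda>x. of_bool (x = 0) / \<pi> 0)"

lemma dens_Suc: "dens (Suc m) = step (dens m)"
  by (simp add: dens_def)

lemma dens_0: "dens 0 x = of_bool (x = 0) / \<pi> 0"
  by (simp add: dens_def)

text \<open>Stated for an arbitrary matrix \<open>A\<close> and its adjoint \<open>T\<close>, since it also serves for the generator of the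
semigroup.\<close>

lemma mat_power_density:
  assumes A: "A \<in> carrier_mat (Suc n) (Suc n)"
    and T: "\<And>f y. y \<le> n \<Longrightarrow> (\<Sum>x\<le>n. (\<pi> x * f x) * A $$ (x, y)) = \<pi> y * T f y"
    and y: "y \<le> n"
  shows "(A ^\<^sub>m k) $$ (0, y) = \<pi> y * (T ^^ k) (\<lambda>x. of_bool (x = 0) / \<pi> 0) y"
  using y
proof (induction k arbitrary: y)
  case 0
  then show ?case using A pi_pos[of 0] by auto
next
  case (Suc k)
  have "(A ^\<^sub>m Suc k) $$ (0, y) = (\<Sum>x\<le>n. (A ^\<^sub>m k) $$ (0, x) * A $$ (x, y))"
    using A Suc(2) by (simp add: scalar_prod_def atLeast0LessThan lessThan_Suc_atMost)
  also have "\<dots> = (\<Sum>x\<le>n. (\<pi> x * (T ^^ k) (\<lambda>x. of_bool (x = 0) / \<pi> 0) x) * A $$ (x, y))"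
    by (intro sum.cong refl) (simp add: Suc(1))
  finally show ?case using T[OF Suc(2)] by simp
qed

lemma kernel_power: "y \<le> n \<Longrightarrow> (kernel ^\<^sub>m m) $$ (0, y) = \<pi> y * dens m y"
  unfolding dens_def by (rule mat_power_density[OF kernel_carrier kernel_adjoint])

text \<open>The expectation of \<open>f\<close> at time \<open>m\<close> for the chain started at \<open>0\<close>.\<close>

definition pairing :: "nat \<Rightarrow> (nat \<Rightarrow> real) \<Rightarrow> real" where
  "pairing m f = (\<Sum>x\<le>n. \<pi> x * dens m x * f x)"

lemma pairing_0: "pairing 0 f = f 0"
proof -
  have "pairing 0 f = (\<Sum>x\<le>n. if x = 0 then f x else 0)"
    unfolding pairing_def using pi_pos[of 0] by (intro sum.cong) (auto simp: dens_0)
  then show ?thesis by simp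
qed

lemma pairing_Suc: "pairing (Suc m) f = pairing m (step f)"
  by (simp add: pairing_def dens_Suc step_self_adjoint)

lemma step_const: "step (\<lambda>_. c) = (\<lambda>_. c)"
  by (rule ext) (simp add: step_def algebra_simps)

lemma pairing_const: "pairing m (\<lambda>_. c) = c"
  by (induction m) (simp_all add: pairing_0 pairing_Suc step_const)

lemma pairing_cong: "(\<And>x. x \<le> n \<Longrightarrow> f x = g x) \<Longrightarrow> pairing m f = pairing m g"
  unfolding pairing_def by (intro sum.cong) auto

lemma pairing_diff: "pairing m (\<lambda>x. f x - g x) = pairing m f - pairing m g"
  by (simp add: pairing_def right_diff_distrib sum_subtractf)

lemma pairing_mult: "pairing m (\<lambda>x. c * f x) = c * pairing m f"
  by (simp add: pairing_def sum_distrib_left mult_ac)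

text \<open>Separation at time \<open>m\<close> whenever the density is smallest at \<open>n\<close>.\<close>

definition sep_tail :: "nat \<Rightarrow> real" where
  "sep_tail m = 1 - dens m n"

end

locale monotone_bd_chain = bd_chain +
  assumes mono_cond: "i < n \<Longrightarrow> p i + q (Suc i) \<le> 1"
begin

text \<open>The increment of \<open>step f\<close> is a combination of increments of \<open>f\<close>, in which the one at \<open>x\<close> has the
coefficient \<open>1 - p x - q (Suc x)\<close>.\<close>

lemma step_antimono:
  assumes f: "\<And>x. x < n \<Longrightarrow> f (Suc x) \<le> f x" and x: "x < n"
  shows "step f (Suc x) \<le> step f x"
proof -
  have "(1 - p x - q (Suc x)) * (f x - f (Suc x)) \<ge> 0"
    using mono_cond[OF x] f[OF x] by simp
  moreover have "q x * (f (x - 1) - f x) \<ge> 0"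
    using f[of "x - 1"] q_nonneg[of x] q_0 x by (cases x) auto
  moreover have "p (Suc x) * (f (Suc x) - f (Suc (Suc x))) \<ge> 0"
    using f[of "Suc x"] p_nonneg[of "Suc x"] p_n x by (cases "Suc x = n") auto
  moreover have "step f x - step f (Suc x) = (1 - p x - q (Suc x)) * (f x - f (Suc x))
      + q x * (f (x - 1) - f x) + p (Suc x) * (f (Suc x) - f (Suc (Suc x)))"
    by (simp add: step_def algebra_simps)
  ultimately show ?thesis by linarith
qed

lemma dens_antimono_Suc: "x < n \<Longrightarrow> dens m (Suc x) \<le> dens m x"
proof (induction m arbitrary: x)
  case 0
  then show ?case using pi_pos[of 0] by (auto simp: dens_0)
next
  case (Suc m)
  then show ?case unfolding dens_Suc by (intro step_antimono) auto
qed

lemma dens_ge_last: "x \<le> n \<Longrightarrow> dens m n \<le> dens m x"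
proof (induction rule: inc_induct)
  case (step x)
  then show ?case using dens_antimono_Suc[of x m] by linarith
qed simp

lemma dens_nonneg: "x \<le> n \<Longrightarrow> dens m x \<ge> 0"
proof (induction m arbitrary: x)
  case 0
  then show ?case using pi_pos[of 0] by (simp add: dens_0)
next
  case (Suc m)
  have "p x * dens m (Suc x) \<ge> 0"
    using Suc p_nonneg[of x] p_n by (cases "x = n") auto
  moreover have "q x * dens m (x - 1) \<ge> 0" "(1 - p x - q x) * dens m x \<ge> 0"
    using Suc q_nonneg[of x] pq_le[of x] by auto
  ultimately show ?case by (simp add: dens_Suc step_def)
qed

lemma sep_tail_eq_pairing: "pairing m (\<lambda>x. 1 - of_bool (x = n) / \<pi> n) = sep_tail m"
proof -
  have "pairing m (\<lambda>x. of_bool (x = n) / \<pi> n) = (\<Sum>x\<le>n. if x = n then dens m x else 0)"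
    unfolding pairing_def using pi_pos[of n] by (intro sum.cong) auto
  then show ?thesis by (simp add: pairing_diff pairing_const sep_tail_def)
qed

lemma pi_dens_excess: "(\<Sum>x\<le>n. \<pi> x * (dens m x - dens m n)) = sep_tail m"
proof -
  have "(\<Sum>x\<le>n. \<pi> x * dens m x) = 1" using pairing_const[of m 1] by (simp add: pairing_def)
  then show ?thesis
    by (simp add: right_diff_distrib sum_subtractf sum_distrib_right[symmetric] pi_sum sep_tail_def)
qed

lemma sep_tail_range: "sep_tail m \<ge> 0" "sep_tail m \<le> 1"
proof -
  show "sep_tail m \<ge> 0"
    unfolding pi_dens_excess[symmetric]
    by (intro sum_nonneg mult_nonneg_nonneg) (auto simp: pi_nonneg dens_ge_last)
  show "sep_tail m \<le> 1" using dens_nonneg[of n m] by (simp add: sep_tail_def)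
qed

lemma sep_tail_dec: "sep_tail (Suc m) \<le> sep_tail m"
proof -
  have "q n * (dens m (n - 1) - dens m n) \<ge> 0"
    using dens_ge_last[of "n - 1" m] q_nonneg[of n] by simp
  then show ?thesis by (simp add: sep_tail_def dens_Suc step_def p_n algebra_simps)
qed

text \<open>Subtracting the minimum of the density isolates the part of \<open>K^m(0,\<cdot>)\<close> that has not yet equilibrated,
whose total mass is \<open>sep_tail m\<close>.\<close>

lemma pairing_mean_zero:
  assumes "(\<Sum>x\<le>n. \<pi> x * f x) = 0"
  shows "pairing m f = (\<Sum>x\<le>n. \<pi> x * (dens m x - dens m n) * f x)"
proof -
  have "(\<Sum>x\<le>n. \<pi> x * (dens m x - dens m n) * f x) = pairing m f - dens m n * (\<Sum>x\<le>n. \<pi> x * f x)"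
    by (simp add: pairing_def sum_distrib_left algebra_simps flip: sum_subtractf)
  then show ?thesis using assms by simp
qed

lemma pairing_le:
  assumes "(\<Sum>x\<le>n. \<pi> x * f x) = 0" "\<And>x. x \<le> n \<Longrightarrow> f x \<le> c"
  shows "pairing m f \<le> c * sep_tail m"
proof -
  have "pairing m f \<le> (\<Sum>x\<le>n. \<pi> x * (dens m x - dens m n) * c)"
    unfolding pairing_mean_zero[OF assms(1)]
    by (intro sum_mono mult_left_mono mult_nonneg_nonneg assms(2)) (auto simp: pi_nonneg dens_ge_last)
  also have "\<dots> = sep_tail m * c" by (simp only: sum_distrib_right[symmetric] pi_dens_excess)
  finally show ?thesis by (simp add: mult.commute)
qed

lemma abs_pairing_le:
  assumes m: "(\<Sum>x\<le>n. \<pi> x * f x) = 0" and c: "\<And>x. x \<le> n \<Longrightarrow> \<bar>f x\<bar> \<le> c"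
  shows "\<bar>pairing m f\<bar> \<le> c * sep_tail m"
proof -
  have f: "f x \<le> c" "- f x \<le> c" if "x \<le> n" for x using c[OF that] by auto
  have "pairing m f \<le> c * sep_tail m" using pairing_le[OF m] f by blast
  moreover have "pairing m (\<lambda>x. - f x) \<le> c * sep_tail m"
    using m f by (intro pairing_le) (simp_all add: sum_negf)
  moreover have "pairing m (\<lambda>x. - f x) = - pairing m f" by (simp add: pairing_def sum_negf)
  ultimately show ?thesis by linarith
qed

lemma sep_tail_sums:
  shows "sep_tail sums sep_mean" "(\<lambda>m. real (m + 1) * sep_tail m) sums sep_chi 0" "sep_tail \<longlonglongrightarrow> 0"
proof -
  define c where "c = Max ((\<lambda>x. max \<bar>sep_phi x\<bar> \<bar>sep_chi x\<bar>) ` {..n})"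
  have "max \<bar>sep_phi x\<bar> \<bar>sep_chi x\<bar> \<le> c" if "x \<le> n" for x
    unfolding c_def using that by (intro Max_ge) auto
  then have c: "\<bar>sep_phi x\<bar> \<le> c" "\<bar>sep_chi x\<bar> \<le> c" if "x \<le> n" for x using that by force+
  have U: "pairing m sep_phi - pairing (Suc m) sep_phi = sep_tail m" for m
  proof -
    have "pairing m sep_phi - pairing (Suc m) sep_phi = pairing m (\<lambda>x. sep_phi x - step sep_phi x)"
      by (simp add: pairing_Suc pairing_diff)
    also have "\<dots> = pairing m (\<lambda>x. 1 - of_bool (x = n) / \<pi> n)"
      by (intro pairing_cong) (simp add: sep_phi_poisson)
    finally show ?thesis by (simp add: sep_tail_eq_pairing)
  qed
  have W: "pairing m sep_chi - pairing (Suc m) sep_chi = pairing m sep_phi" for m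
  proof -
    have "pairing m sep_chi - pairing (Suc m) sep_chi = pairing m (\<lambda>x. sep_chi x - step sep_chi x)"
      by (simp add: pairing_Suc pairing_diff)
    also have "\<dots> = pairing m sep_phi"
      by (intro pairing_cong) (simp add: sep_chi_poisson)
    finally show ?thesis .
  qed
  note * = summed_tails[of sep_tail "\<lambda>m. pairing m sep_phi" "\<lambda>m. pairing m sep_chi" c,
      OF sep_tail_range(1) sep_tail_dec U W abs_pairing_le[OF sep_phi_mean] abs_pairing_le[OF sep_chi_mean]]
  show "sep_tail sums sep_mean" "(\<lambda>m. real (m + 1) * sep_tail m) sums sep_chi 0" "sep_tail \<longlonglongrightarrow> 0"
    using * c by (simp_all add: pairing_0 sep_phi_0)
qed

lemma sep_tail_chebyshev:
  assumes "a > 0"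
  shows "real m \<ge> sep_mean + a \<Longrightarrow> sep_tail m \<le> (sep_var - sep_mean) / a^2"
    "real m \<le> sep_mean - a \<Longrightarrow> 1 - sep_tail m \<le> (sep_var - sep_mean) / a^2"
  by (rule tail_chebyshev[OF sep_tail_range sep_tail_dec sep_tail_sums(1,2) _ assms];
      simp add: sep_var_eq[symmetric])+

lemma sep_tail_markov: "sep_tail m \<le> sep_mean / (real m + 1)"
  by (rule decreasing_term_le[OF sep_tail_range(1) sep_tail_dec sep_tail_sums(1)])

text \<open>The part that has not yet equilibrated averages \<open>\<psi>\<close> to at most its maximum \<open>\<psi> 0\<close>, while the expectation
of \<open>\<psi>\<close> at time \<open>m\<close> is \<open>r ^ m * \<psi> 0\<close>.\<close>

lemma sep_tail_ge_power:
  assumes eig: "\<And>x. x \<le> n \<Longrightarrow> step \<psi> x = r * \<psi> x" and le: "\<And>x. x \<le> n \<Longrightarrow> \<psi> x \<le> \<psi> 0"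
    and pos: "\<psi> 0 > 0" and mean: "(\<Sum>y\<le>n. \<pi> y * \<psi> y) = 0"
  shows "r ^ m \<le> sep_tail m"
proof -
  have "pairing m \<psi> = r ^ m * \<psi> 0"
  proof (induction m)
    case (Suc m)
    have "pairing (Suc m) \<psi> = pairing m (\<lambda>x. r * \<psi> x)"
      unfolding pairing_Suc by (intro pairing_cong eig)
    then show ?case using Suc by (simp add: pairing_mult)
  qed (simp add: pairing_0)
  then have "r ^ m * \<psi> 0 \<le> sep_tail m * \<psi> 0"
    using pairing_le[OF mean le, of m] by (simp add: mult.commute)
  then show ?thesis using pos by (simp only: mult_le_cancel_right_pos)
qed

lemma sep_discrete_eq: "sep_discrete n kernel \<pi> 0 m = sep_tail m"
proof -
  have "(\<lambda>x. 1 - (kernel ^\<^sub>m m) $$ (0, x) / \<pi> x) ` {0..n} = (\<lambda>x. 1 - dens m x) ` {0..n}"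
    by (intro image_cong refl) (use pi_pos in \<open>auto simp: kernel_power less_imp_neq[symmetric]\<close>)
  moreover have "Max ((\<lambda>x. 1 - dens m x) ` {0..n}) = sep_tail m"
    by (rule Max_eqI) (auto simp: sep_tail_def dens_ge_last)
  ultimately show ?thesis by (simp add: sep_discrete_def sep_def)
qed

end

section \<open>Poisson mixtures\<close>

definition poi :: "real \<Rightarrow> nat \<Rightarrow> real" where
  "poi \<tau> m = exp (- \<tau>) * (\<tau> ^ m / fact m)"

lemma poi_nonneg: "\<tau> \<ge> 0 \<Longrightarrow> poi \<tau> m \<ge> 0"
  by (simp add: poi_def)

lemma exp_sums: "(\<lambda>m. x ^ m / fact m) sums exp (x::real)"
  using exp_converges[of x] by (simp add: field_simps scaleR_conv_of_real)

lemma poi_power_sums: "(\<lambda>m. poi \<tau> m * r ^ m) sums exp (\<tau> * (r - 1))"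
proof -
  have "(\<lambda>m. exp (- \<tau>) * ((\<tau> * r) ^ m / fact m)) sums (exp (- \<tau>) * exp (\<tau> * r))"
    by (intro sums_mult exp_sums)
  then show ?thesis
    by (simp add: poi_def power_mult_distrib exp_add[symmetric] algebra_simps)
qed

lemma poi_sums: "poi \<tau> sums 1"
  using poi_power_sums[of \<tau> 1] by simp

lemma poi_Suc: "poi \<tau> (Suc m) * real (Suc m) = \<tau> * poi \<tau> m"
proof -
  have "fact (Suc m) = real (Suc m) * fact m" by simp
  then show ?thesis unfolding poi_def by (simp del: fact_Suc of_nat_Suc)
qed

lemma poi_mean_sums: "(\<lambda>m. poi \<tau> m * real m) sums \<tau>"
proof -
  have "(\<lambda>m. poi \<tau> (Suc m) * real (Suc m)) sums (\<tau> * 1)"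
    unfolding poi_Suc by (intro sums_mult poi_sums)
  then show ?thesis using sums_Suc_iff[of "\<lambda>m. poi \<tau> m * real m" \<tau>] by simp
qed

lemma poi_factorial_moment_sums: "(\<lambda>m. poi \<tau> m * (real m * (real m - 1))) sums \<tau>^2"
proof -
  have eq: "poi \<tau> (Suc m) * (real (Suc m) * (real (Suc m) - 1)) = \<tau> * (poi \<tau> m * real m)" for m
    using poi_Suc[of \<tau> m] by (metis add_diff_cancel_left' mult.assoc of_nat_Suc)
  have "(\<lambda>m. poi \<tau> (Suc m) * (real (Suc m) * (real (Suc m) - 1))) sums (\<tau> * \<tau>)"
    unfolding eq by (intro sums_mult poi_mean_sums)
  then show ?thesis
    using sums_Suc_iff[of "\<lambda>m. poi \<tau> m * (real m * (real m - 1))" "\<tau> * \<tau>"]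
    by (simp add: power2_eq_square)
qed

lemma poi_variance_sums: "(\<lambda>m. poi \<tau> m * (real m - \<tau>)^2) sums \<tau>"
proof -
  have "(\<lambda>m. poi \<tau> m * (real m * (real m - 1)) + (1 - 2 * \<tau>) * (poi \<tau> m * real m) + \<tau>^2 * poi \<tau> m)
      sums (\<tau>^2 + (1 - 2 * \<tau>) * \<tau> + \<tau>^2 * 1)"
    by (intro sums_add sums_mult poi_factorial_moment_sums poi_mean_sums poi_sums)
  moreover have "poi \<tau> m * (real m * (real m - 1)) + (1 - 2 * \<tau>) * (poi \<tau> m * real m) + \<tau>^2 * poi \<tau> m
      = poi \<tau> m * (real m - \<tau>)^2" for m
    by (simp add: power2_eq_square algebra_simps)
  ultimately show ?thesis by (simp add: power2_eq_square algebra_simps)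
qed

lemma poi_summable:
  assumes "\<tau> \<ge> 0" "\<And>m. \<bar>h m\<bar> \<le> c"
  shows "summable (\<lambda>m. poi \<tau> m * h m)"
proof (rule summable_comparison_test')
  show "summable (\<lambda>m. poi \<tau> m * c)" using poi_sums[of \<tau>] by (intro summable_mult2) (rule sums_summable)
  show "norm (poi \<tau> m * h m) \<le> poi \<tau> m * c" for m
    using assms(2)[of m] poi_nonneg[OF assms(1), of m] by (simp add: abs_mult mult_left_mono)
qed

definition poisson_mix :: "real \<Rightarrow> (nat \<Rightarrow> real) \<Rightarrow> real" where
  "poisson_mix \<tau> h = (\<Sum>m. poi \<tau> m * h m)"

lemma poisson_mix_le:
  assumes "\<tau> \<ge> 0" "\<And>m. \<bar>h m\<bar> \<le> c" "\<And>m. h m \<le> g m" "(\<lambda>m. poi \<tau> m * g m) sums s"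
  shows "poisson_mix \<tau> h \<le> s"
  unfolding poisson_mix_def
  by (rule sums_le[OF _ summable_sums[OF poi_summable[OF assms(1,2)]] assms(4)])
     (use assms poi_nonneg in \<open>auto intro: mult_left_mono\<close>)

lemma poisson_mix_ge_exp:
  assumes "\<tau> \<ge> 0" "\<And>m. \<bar>h m\<bar> \<le> c" "\<And>m. r ^ m \<le> h m"
  shows "exp (\<tau> * (r - 1)) \<le> poisson_mix \<tau> h"
  unfolding poisson_mix_def
  by (rule sums_le[OF _ poi_power_sums summable_sums[OF poi_summable[OF assms(1,2)]]])
     (use assms poi_nonneg in \<open>auto intro: mult_left_mono\<close>)

text \<open>The expectation of \<open>1 / (N + 1)\<close> under the Poisson law of parameter \<open>\<tau>\<close> is at most \<open>1 / \<tau>\<close>.\<close>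

lemma poisson_mix_markov:
  assumes "\<tau> > 0" "\<And>m. \<bar>h m\<bar> \<le> c" "\<And>m. h m \<le> t / (real m + 1)" "t \<ge> 0"
  shows "poisson_mix \<tau> h \<le> t / \<tau>"
proof -
  have "(\<lambda>m. poi \<tau> (Suc m)) sums (1 - poi \<tau> 0)"
    using sums_Suc_iff[of "poi \<tau>" "1 - poi \<tau> 0"] poi_sums[of \<tau>] by simp
  then have "(\<lambda>m. t / \<tau> * poi \<tau> (Suc m)) sums (t / \<tau> * (1 - poi \<tau> 0))" by (rule sums_mult)
  moreover have "t / \<tau> * poi \<tau> (Suc m) = poi \<tau> m * (t / (real m + 1))" for m
    using poi_Suc[of \<tau> m] assms(1) by (simp add: field_simps)
  ultimately have "(\<lambda>m. poi \<tau> m * (t / (real m + 1))) sums (t / \<tau> * (1 - poi \<tau> 0))" by simp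
  then have "poisson_mix \<tau> h \<le> t / \<tau> * (1 - poi \<tau> 0)"
    using assms by (intro poisson_mix_le[of \<tau> h c "\<lambda>m. t / (real m + 1)"]) auto
  also have "\<dots> \<le> t / \<tau>"
    using assms poi_nonneg[of \<tau> 0] by (intro mult_left_le) auto
  finally show ?thesis .
qed

lemma poi_chebyshev_sums: "(\<lambda>m. poi \<tau> m * (B + (real m - \<tau>)^2 / a^2)) sums (B + \<tau> / a^2)"
proof -
  have "(\<lambda>m. B * poi \<tau> m + poi \<tau> m * (real m - \<tau>)^2 / a^2) sums (B * 1 + \<tau> / a^2)"
    by (intro sums_add sums_mult sums_divide poi_sums poi_variance_sums)
  then show ?thesis by (simp add: algebra_simps)
qed

text \<open>With the clock at mean \<open>t + 2a\<close>, either it has passed \<open>t + a\<close>, or it deviates from its mean by at least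
\<open>a\<close>, an event of probability at most \<open>\<tau> / a^2\<close>.\<close>

lemma poisson_mix_upper:
  assumes a: "a > 0" and \<tau>: "\<tau> = t + 2 * a" "\<tau> \<ge> 0" and h: "\<And>m. 0 \<le> h m" "\<And>m. h m \<le> 1" and B: "B \<ge> 0"
    and hB: "\<And>m. real m \<ge> t + a \<Longrightarrow> h m \<le> B"
  shows "poisson_mix \<tau> h \<le> B + \<tau> / a^2"
proof (rule poisson_mix_le[OF \<tau>(2), of h 1, OF _ _ poi_chebyshev_sums])
  fix m
  show "\<bar>h m\<bar> \<le> 1" using h[of m] by simp
  show "h m \<le> B + (real m - \<tau>)^2 / a^2"
  proof (cases "real m \<ge> t + a")
    case True
    then show ?thesis using hB[OF True] by (simp add: add_increasing2)
  next
    case False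
    then have "a^2 \<le> (\<tau> - real m)^2" using a \<tau> by (intro power_mono) auto
    then have "1 \<le> (real m - \<tau>)^2 / a^2" using a by (simp add: power2_commute)
    then show ?thesis using h(2)[of m] B by linarith
  qed
qed

lemma poisson_mix_lower:
  assumes a: "a > 0" and \<tau>: "\<tau> \<le> t - 2 * a" "\<tau> \<ge> 0" and h: "\<And>m. 0 \<le> h m" "\<And>m. h m \<le> 1" and B: "B \<ge> 0"
    and hB: "\<And>m. real m \<le> t - a \<Longrightarrow> 1 - h m \<le> B"
  shows "1 - poisson_mix \<tau> h \<le> B + \<tau> / a^2"
proof -
  have ab: "\<bar>h m\<bar> \<le> 1" for m using h[of m] by simp
  have "(\<lambda>m. poi \<tau> m - poi \<tau> m * h m) sums (1 - poisson_mix \<tau> h)"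
    unfolding poisson_mix_def
    by (intro sums_diff poi_sums summable_sums poi_summable[OF \<tau>(2) ab])
  then have "poisson_mix \<tau> (\<lambda>m. 1 - h m) = 1 - poisson_mix \<tau> h"
    unfolding poisson_mix_def by (simp add: right_diff_distrib sums_iff)
  moreover have "poisson_mix \<tau> (\<lambda>m. 1 - h m) \<le> B + \<tau> / a^2"
  proof (rule poisson_mix_le[OF \<tau>(2), of _ 1, OF _ _ poi_chebyshev_sums])
    fix m
    show "\<bar>1 - h m\<bar> \<le> 1" using h[of m] by simp
    show "1 - h m \<le> B + (real m - \<tau>)^2 / a^2"
    proof (cases "real m \<le> t - a")
      case True
      then show ?thesis using hB[OF True] by (simp add: add_increasing2)
    next
      case False
      then have "a^2 \<le> (real m - \<tau>)^2" using a \<tau> by (intro power_mono) auto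
      then have "1 \<le> (real m - \<tau>)^2 / a^2" using a by simp
      then show ?thesis using h(1)[of m] B by linarith
    qed
  qed
  ultimately show ?thesis by simp
qed

section \<open>Separation in continuous time\<close>

context bd_chain
begin

lemma sep_mean_nonneg: "sep_mean \<ge> 0"
  unfolding sep_mean_def
  by (intro sum_nonneg divide_nonneg_pos mult_nonneg_nonneg above_nonneg less_imp_le[OF below_pos])
     (auto intro: cond_pos)

text \<open>Halving the rates makes any birth and death chain monotone, since \<open>p i\<close> and \<open>q (Suc i)\<close> are at most \<open>1\<close>.\<close>

lemma lazy_chain: "monotone_bd_chain n (\<lambda>i. p i / 2) (\<lambda>i. q i / 2) \<pi>"
proof
  fix i assume i: "i < n"
  have "p i \<le> 1" using pq_le[of i] q_nonneg[of i] i by simp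
  moreover have "q (Suc i) \<le> 1" using pq_le[of "Suc i"] p_nonneg[of "Suc i"] i by simp
  ultimately show "p i / 2 + q (Suc i) / 2 \<le> 1" by simp
  show "\<pi> i * (p i / 2) = \<pi> (Suc i) * (q (Suc i) / 2)" using detailed_balance[OF i] by simp
next
  fix i assume "i \<le> n"
  then show "p i / 2 + q i / 2 \<le> 1" "\<pi> i > 0" using pq_le[of i] pi_pos[of i] by auto
qed (use n_pos p_pos q_pos p_n q_0 pi_sum in auto)

end

context bd_chain
begin

interpretation lazy: monotone_bd_chain n "\<lambda>i. p i / 2" "\<lambda>i. q i / 2" \<pi>
  by (rule lazy_chain)

lemma lazy_step: "lazy.step f x = (f x + step f x) / 2"
  by (simp add: lazy.step_def step_def field_simps)

lemma lazy_cond: "lazy.cond z = cond z / 2"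
  by (simp add: lazy.cond_def cond_def)

lemma lazy_sep_mean: "lazy.sep_mean = 2 * sep_mean"
  unfolding lazy.sep_mean_def sep_mean_def sum_distrib_left lazy_cond
  by (intro sum.cong refl) simp

lemma lazy_sep_var: "lazy.sep_var = 4 * sep_var"
  unfolding lazy.sep_var_def sep_var_def sum_distrib_left lazy_cond
  by (intro sum.cong refl) simp

text \<open>\<open>I - K\<close> is twice \<open>I - (I + K)/2\<close>, whence the clock of parameter \<open>2 * t\<close>.\<close>

definition heat_tail :: "real \<Rightarrow> real" where
  "heat_tail t = poisson_mix (2 * t) lazy.sep_tail"

lemma abs_lazy_tail: "\<bar>lazy.sep_tail m\<bar> \<le> 1"
  using lazy.sep_tail_range[of m] by simp

lemma step_sum: "step (\<lambda>x. \<Sum>j\<in>J. c j * g j x) x = (\<Sum>j\<in>J. c j * step (g j) x)"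
  by (simp add: step_def sum_distrib_left distrib_left sum.distrib mult.left_commute)

text \<open>The binomial theorem for the commuting operators \<open>\<tau> * step\<close> and \<open>- \<tau>\<close>.\<close>

lemma shifted_power:
  assumes T: "\<And>f y. T f y = \<tau> * step f y - \<tau> * f y"
  shows "(T ^^ k) f y = (\<Sum>j\<le>k. real (k choose j) * \<tau> ^ j * (- \<tau>) ^ (k - j) * (step ^^ j) f y)"
proof (induction k arbitrary: y)
  case (Suc k)
  let ?c = "\<lambda>j. real (k choose j) * \<tau> ^ j * (- \<tau>) ^ (k - j)" and ?a = "\<lambda>j. (step ^^ j) f y"
  let ?b = "\<lambda>j. real (k choose j) * \<tau> ^ j * (- \<tau>) ^ (Suc k - j) * ?a j"
  have IH: "(T ^^ k) f = (\<lambda>y. \<Sum>j\<le>k. ?c j * (step ^^ j) f y)" using Suc by (intro ext)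
  have "(T ^^ Suc k) f y = \<tau> * (\<Sum>j\<le>k. ?c j * ?a (Suc j)) - \<tau> * (\<Sum>j\<le>k. ?c j * ?a j)"
    by (simp add: T IH step_sum)
  also have "\<tau> * (\<Sum>j\<le>k. ?c j * ?a (Suc j)) =
      (\<Sum>j\<le>k. real (k choose j) * \<tau> ^ Suc j * (- \<tau>) ^ (k - j) * ?a (Suc j))"
    unfolding sum_distrib_left by (intro sum.cong refl) simp
  also have "\<tau> * (\<Sum>j\<le>k. ?c j * ?a j) = - (\<Sum>j\<le>k. ?b j)"
    unfolding sum_distrib_left sum_negf[symmetric]
    by (intro sum.cong refl) (simp add: Suc_diff_le)
  also have "(\<Sum>j\<le>k. ?b j) = (\<Sum>j\<le>Suc k. ?b j)" by simp
  also have "\<dots> = ?b 0 + (\<Sum>j\<le>k. ?b (Suc j))" by (rule sum.atMost_Suc_shift)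
  finally have "(T ^^ Suc k) f y = ?b 0 +
     ((\<Sum>j\<le>k. real (k choose j) * \<tau> ^ Suc j * (- \<tau>) ^ (k - j) * ?a (Suc j)) + (\<Sum>j\<le>k. ?b (Suc j)))"
    by simp
  also have "\<dots> = ?b 0 + (\<Sum>j\<le>k. real (Suc k choose Suc j) * \<tau> ^ Suc j * (- \<tau>) ^ (Suc k - Suc j) * ?a (Suc j))"
    unfolding sum.distrib[symmetric]
    by (intro arg_cong2[of _ _ _ _ "(+)"] sum.cong refl) (simp add: algebra_simps)
  also have "\<dots> = (\<Sum>j\<le>Suc k. real (Suc k choose j) * \<tau> ^ j * (- \<tau>) ^ (Suc k - j) * ?a j)"
    by (subst sum.atMost_Suc_shift) simp
  finally show ?case .
qed simp

text \<open>The exponential series of \<open>\<tau> (L - I)\<close> is the Cauchy product of those of \<open>\<tau> L\<close> and \<open>- \<tau>\<close>, for \<open>L = step\<close>.\<close>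

lemma shifted_exponential_sums:
  assumes T: "\<And>f y. T f y = \<tau> * step f y - \<tau> * f y"
    and c: "\<And>j. \<bar>(step ^^ j) f y\<bar> \<le> c"
  shows "(\<lambda>k. (T ^^ k) f y / fact k) sums poisson_mix \<tau> (\<lambda>j. (step ^^ j) f y)"
proof -
  let ?a = "\<lambda>j. (step ^^ j) f y"
  have s1: "summable (\<lambda>j. norm (\<tau> ^ j / fact j * ?a j))"
  proof (rule summable_comparison_test')
    show "summable (\<lambda>j. \<bar>\<tau>\<bar> ^ j / fact j * c)"
      by (intro summable_mult2 sums_summable[OF exp_sums])
    show "norm (norm (\<tau> ^ j / fact j * ?a j)) \<le> \<bar>\<tau>\<bar> ^ j / fact j * c" for j
      using c[of j] by (simp add: abs_mult power_abs mult_left_mono divide_right_mono)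
  qed
  have s2: "summable (\<lambda>j. norm ((- \<tau>) ^ j / fact j))"
    using sums_summable[OF exp_sums[of "\<bar>\<tau>\<bar>"]] by (simp add: power_abs)
  have "(\<lambda>k. \<Sum>j\<le>k. (\<tau> ^ j / fact j * ?a j) * ((- \<tau>) ^ (k - j) / fact (k - j))) sums
      ((\<Sum>j. \<tau> ^ j / fact j * ?a j) * (\<Sum>j. (- \<tau>) ^ j / fact j))"
    by (rule Cauchy_product_sums[OF s1 s2])
  moreover have "(\<Sum>j\<le>k. (\<tau> ^ j / fact j * ?a j) * ((- \<tau>) ^ (k - j) / fact (k - j))) = (T ^^ k) f y / fact k" for k
    unfolding shifted_power[of T, OF T] sum_divide_distrib
    by (intro sum.cong refl) (simp add: binomial_fact)
  moreover have "(\<Sum>j. (- \<tau>) ^ j / fact j) = exp (- \<tau>)" using exp_sums[of "- \<tau>"] by (simp add: sums_iff)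
  moreover have "(\<Sum>j. \<tau> ^ j / fact j * ?a j) * exp (- \<tau>) = poisson_mix \<tau> ?a"
  proof -
    have "summable (\<lambda>j. \<tau> ^ j / fact j * ?a j)" using s1 by (rule summable_norm_cancel)
    from suminf_mult[OF this, of "exp (- \<tau>)"] show ?thesis
      by (simp add: poisson_mix_def poi_def mult_ac)
  qed
  ultimately show ?thesis by simp
qed

lemma dens_bounded: "y \<le> n \<Longrightarrow> \<bar>dens m y\<bar> \<le> 1 / \<pi> 0"
proof (induction m arbitrary: y)
  case 0
  then show ?case using pi_pos[of 0] by (simp add: dens_0)
next
  case (Suc m)
  then show ?case unfolding dens_Suc by (intro abs_step_le) auto
qed

end

context bd_chain
begin

interpretation lazy: monotone_bd_chain n "\<lambda>i. p i / 2" "\<lambda>i. q i / 2" \<pi>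
  by (rule lazy_chain)

lemma heat_entry:
  assumes y: "y \<le> n"
  shows "heat_semigroup n kernel t $$ (0, y) = \<pi> y * poisson_mix (2 * t) (\<lambda>m. lazy.dens m y)"
proof -
  define A where "A = (- t) \<cdot>\<^sub>m (1\<^sub>m (Suc n) - kernel)"
  define T where "T f y = 2 * t * lazy.step f y - 2 * t * f y" for f and y :: nat
  have A: "A \<in> carrier_mat (Suc n) (Suc n)"
    unfolding A_def by (intro smult_carrier_mat minus_carrier_mat kernel_carrier)
  have AT: "(\<Sum>x\<le>n. (\<pi> x * f x) * A $$ (x, y)) = \<pi> y * T f y" if y: "y \<le> n" for f y
  proof -
    have "(\<Sum>x\<le>n. (\<pi> x * f x) * A $$ (x, y)) =
       (\<Sum>x\<le>n. - t * (if x = y then \<pi> x * f x else 0) + t * ((\<pi> x * f x) * kernel $$ (x, y)))"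
      using kernel_carrier y by (intro sum.cong refl) (auto simp: A_def algebra_simps)
    also have "\<dots> = - t * (\<pi> y * f y) + t * (\<pi> y * step f y)"
      unfolding sum.distrib sum_distrib_left[symmetric] kernel_adjoint[OF y] using y by simp
    finally show ?thesis by (simp add: T_def lazy_step algebra_simps)
  qed
  let ?d = "\<lambda>x. of_bool (x = 0) / \<pi> 0"
  have "(\<lambda>k. (T ^^ k) ?d y / fact k) sums poisson_mix (2 * t) (\<lambda>m. lazy.dens m y)"
    unfolding lazy.dens_def
    by (rule lazy.shifted_exponential_sums[of T "2 * t" ?d y "1 / \<pi> 0"])
       (use lazy.dens_bounded[OF y] in \<open>auto simp: T_def lazy.dens_def\<close>)
  then have "(\<lambda>k. \<pi> y * ((T ^^ k) ?d y / fact k)) sums (\<pi> y * poisson_mix (2 * t) (\<lambda>m. lazy.dens m y))"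
    by (rule sums_mult)
  moreover have "\<pi> y * ((T ^^ k) ?d y / fact k) = (A ^\<^sub>m k) $$ (0, y) / fact k" for k
    by (subst mat_power_density[of A T, OF A AT y]) simp_all
  ultimately have "(\<lambda>k. (A ^\<^sub>m k) $$ (0, y) / fact k) sums (\<pi> y * poisson_mix (2 * t) (\<lambda>m. lazy.dens m y))"
    by simp
  then have "(\<Sum>k. (A ^\<^sub>m k) $$ (0, y) / fact k) = \<pi> y * poisson_mix (2 * t) (\<lambda>m. lazy.dens m y)"
    by (simp add: sums_iff)
  then show ?thesis
    using A y unfolding heat_semigroup_def mat_exp_def A_def[symmetric] by auto
qed

lemma sep_continuous_eq:
  assumes t: "t \<ge> 0"
  shows "sep_continuous n kernel \<pi> 0 t = heat_tail t"
proof -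
  have bd: "\<bar>lazy.dens m x\<bar> \<le> 1 / \<pi> 0" if "x \<le> n" for m x by (rule lazy.dens_bounded[OF that])
  have "(\<lambda>x. 1 - heat_semigroup n kernel t $$ (0, x) / \<pi> x) ` {0..n} =
      (\<lambda>x. 1 - poisson_mix (2 * t) (\<lambda>m. lazy.dens m x)) ` {0..n}"
  proof (intro image_cong refl)
    fix x assume "x \<in> {0..n}"
    then have x: "x \<le> n" by simp
    show "1 - heat_semigroup n kernel t $$ (0, x) / \<pi> x = 1 - poisson_mix (2 * t) (\<lambda>m. lazy.dens m x)"
      using pi_pos[OF x] by (simp add: heat_entry[OF x])
  qed
  moreover have "Max ((\<lambda>x. 1 - poisson_mix (2 * t) (\<lambda>m. lazy.dens m x)) ` {0..n}) =
      1 - poisson_mix (2 * t) (\<lambda>m. lazy.dens m n)"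
  proof (rule Max_eqI)
    fix v assume "v \<in> (\<lambda>x. 1 - poisson_mix (2 * t) (\<lambda>m. lazy.dens m x)) ` {0..n}"
    then obtain x where x: "x \<le> n" and v: "v = 1 - poisson_mix (2 * t) (\<lambda>m. lazy.dens m x)" by auto
    have "poisson_mix (2 * t) (\<lambda>m. lazy.dens m n) \<le> poisson_mix (2 * t) (\<lambda>m. lazy.dens m x)"
      unfolding poisson_mix_def
      by (intro suminf_le mult_left_mono poi_nonneg lazy.dens_ge_last poi_summable[OF _ bd])
         (use t x in auto)
    then show "v \<le> 1 - poisson_mix (2 * t) (\<lambda>m. lazy.dens m n)" using v by simp
  qed auto
  moreover have "heat_tail t = 1 - poisson_mix (2 * t) (\<lambda>m. lazy.dens m n)"
  proof -
    have "(\<lambda>m. poi (2 * t) m - poi (2 * t) m * lazy.dens m n) sums (1 - poisson_mix (2 * t) (\<lambda>m. lazy.dens m n))"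
      unfolding poisson_mix_def
      by (intro sums_diff poi_sums summable_sums poi_summable[OF _ bd]) (use t in auto)
    then show ?thesis
      by (simp add: heat_tail_def poisson_mix_def lazy.sep_tail_def right_diff_distrib sums_iff)
  qed
  ultimately show ?thesis by (simp add: sep_continuous_def sep_def)
qed

text \<open>The lazy chain has mean \<open>2 t\<close> and variance \<open>4 v - 2 t\<close>, and the clock adds the variance \<open>2 (t + a)\<close>:
the contributions of \<open>t\<close> cancel.\<close>

lemma heat_tail_upper:
  assumes "a > 0"
  shows "heat_tail (sep_mean + a) \<le> (4 * sep_var + 2 * a) / a^2"
proof -
  have B: "(lazy.sep_var - lazy.sep_mean) / a^2 \<ge> 0"
  proof -
    obtain m where "real m \<ge> lazy.sep_mean + a" using real_arch_simple by blast
    from lazy.sep_tail_chebyshev(1)[OF assms this] show ?thesis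
      using lazy.sep_tail_range(1)[of m] by linarith
  qed
  have "heat_tail (sep_mean + a) \<le> (lazy.sep_var - lazy.sep_mean) / a^2 + (2 * (sep_mean + a)) / a^2"
    unfolding heat_tail_def
    by (rule poisson_mix_upper[OF assms, of _ lazy.sep_mean])
       (use B assms sep_mean_nonneg lazy.sep_tail_range lazy.sep_tail_chebyshev(1)[OF assms]
         in \<open>auto simp: lazy_sep_mean\<close>)
  also have "\<dots> = (4 * sep_var + 2 * a) / a^2"
    unfolding add_divide_distrib[symmetric] lazy_sep_mean lazy_sep_var by simp
  finally show ?thesis .
qed

lemma heat_tail_lower:
  assumes "a > 0" "0 \<le> y" "y \<le> sep_mean - a"
  shows "1 - heat_tail y \<le> 4 * sep_var / a^2"
proof -
  have B: "(lazy.sep_var - lazy.sep_mean) / a^2 \<ge> 0"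
  proof -
    obtain m where "real m \<ge> lazy.sep_mean + a" using real_arch_simple by blast
    from lazy.sep_tail_chebyshev(1)[OF assms(1) this] show ?thesis
      using lazy.sep_tail_range(1)[of m] by linarith
  qed
  have "1 - heat_tail y \<le> (lazy.sep_var - lazy.sep_mean) / a^2 + (2 * y) / a^2"
    unfolding heat_tail_def
    by (rule poisson_mix_lower[OF assms(1), of _ lazy.sep_mean])
       (use B assms sep_mean_nonneg lazy.sep_tail_range lazy.sep_tail_chebyshev(2)[OF assms(1)]
         in \<open>auto simp: lazy_sep_mean\<close>)
  also have "\<dots> \<le> 4 * sep_var / a^2"
    unfolding add_divide_distrib[symmetric] lazy_sep_mean lazy_sep_var
    using assms by (intro divide_right_mono) auto
  finally show ?thesis .
qed

lemma heat_tail_markov: "y > 0 \<Longrightarrow> heat_tail y \<le> sep_mean / y"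
proof -
  assume y: "y > 0"
  have "heat_tail y \<le> lazy.sep_mean / (2 * y)"
    unfolding heat_tail_def
    by (rule poisson_mix_markov[of _ _ 1]) (use y abs_lazy_tail lazy.sep_tail_markov lazy.sep_mean_nonneg in auto)
  then show ?thesis by (simp add: lazy_sep_mean)
qed

lemma heat_tail_ge_exp:
  assumes nu: "\<nu> > 0" and eig: "\<And>x. x \<le> n \<Longrightarrow> step \<psi> x = (1 - 1 / \<nu>) * \<psi> x"
    and le: "\<And>x. x \<le> n \<Longrightarrow> \<psi> x \<le> \<psi> 0"
    and pos: "\<psi> 0 > 0" and mean: "(\<Sum>y\<le>n. \<pi> y * \<psi> y) = 0" and t: "t \<ge> 0"
  shows "exp (- t / \<nu>) \<le> heat_tail t"
proof -
  have "exp (2 * t * ((1 - 1 / (2 * \<nu>)) - 1)) \<le> heat_tail t"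
    unfolding heat_tail_def
  proof (rule poisson_mix_ge_exp[OF _ abs_lazy_tail])
    show "(1 - 1 / (2 * \<nu>)) ^ m \<le> lazy.sep_tail m" for m
      by (rule lazy.sep_tail_ge_power[OF _ le pos mean])
         (use nu in \<open>simp_all add: lazy_step eig field_simps\<close>)
  qed (use t in simp)
  then show ?thesis by simp
qed

lemma eigenvalue_iff:
  "eigenvalue (1\<^sub>m (Suc n) - kernel) l \<longleftrightarrow>
    (\<exists>f. (\<exists>x\<le>n. f x \<noteq> 0) \<and> (\<forall>x\<le>n. step f x = (1 - l) * f x))"
proof -
  let ?A = "1\<^sub>m (Suc n) - kernel"
  have dim: "dim_row kernel = Suc n" "dim_col kernel = Suc n" using kernel_carrier by auto
  have row: "(?A *\<^sub>v v) $ x = v $ x - step (\<lambda>y. v $ y) x" if "x \<le> n" "v \<in> carrier_vec (Suc n)" for v x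
  proof -
    have "(?A *\<^sub>v v) $ x = (\<Sum>y\<le>n. (1\<^sub>m (Suc n) - kernel) $$ (x, y) * v $ y)"
      using that dim by (auto simp: scalar_prod_def atLeast0LessThan lessThan_Suc_atMost)
    also have "\<dots> = (\<Sum>y\<le>n. (if y = x then v $ y else 0) - kernel $$ (x, y) * v $ y)"
      using that dim by (intro sum.cong refl) (auto simp: left_diff_distrib)
    also have "\<dots> = v $ x - step (\<lambda>y. v $ y) x"
      using that by (simp add: sum_subtractf kernel_row)
    finally show ?thesis .
  qed
  show ?thesis
  proof
    assume "eigenvalue ?A l"
    then obtain v where v: "v \<in> carrier_vec (Suc n)" "v \<noteq> 0\<^sub>v (Suc n)" "?A *\<^sub>v v = l \<cdot>\<^sub>v v"
      unfolding eigenvalue_def eigenvector_def using dim by auto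
    have "\<exists>x\<le>n. v $ x \<noteq> 0"
    proof (rule ccontr)
      assume "\<not> ?thesis"
      then have "v = 0\<^sub>v (Suc n)" using v(1) by (intro eq_vecI) auto
      then show False using v(2) by simp
    qed
    moreover have "step (\<lambda>y. v $ y) x = (1 - l) * v $ x" if "x \<le> n" for x
      using row[OF that v(1)] v that by (simp add: left_diff_distrib)
    ultimately show "\<exists>f. (\<exists>x\<le>n. f x \<noteq> 0) \<and> (\<forall>x\<le>n. step f x = (1 - l) * f x)" by blast
  next
    assume "\<exists>f. (\<exists>x\<le>n. f x \<noteq> 0) \<and> (\<forall>x\<le>n. step f x = (1 - l) * f x)"
    then obtain f where f: "\<exists>x\<le>n. f x \<noteq> 0" "\<And>x. x \<le> n \<Longrightarrow> step f x = (1 - l) * f x" by blast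
    let ?v = "vec (Suc n) f"
    have st: "step (\<lambda>y. ?v $ y) x = step f x" if "x \<le> n" for x
      unfolding kernel_row[OF that, symmetric] by (intro sum.cong refl) auto
    have "?A *\<^sub>v ?v = l \<cdot>\<^sub>v ?v"
    proof (rule eq_vecI)
      fix x assume "x < dim_vec (l \<cdot>\<^sub>v ?v)"
      then have x: "x \<le> n" by simp
      show "(?A *\<^sub>v ?v) $ x = (l \<cdot>\<^sub>v ?v) $ x"
        using row[OF x, of ?v] st[OF x] f(2)[OF x] x by (simp add: left_diff_distrib)
    qed (use dim in simp)
    moreover have "?v \<noteq> 0\<^sub>v (Suc n)"
    proof
      assume "?v = 0\<^sub>v (Suc n)"
      then have "f x = 0" if "x \<le> n" for x using that
        by (metis index_vec index_zero_vec(1) le_imp_less_Suc)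
      then show False using f(1) by blast
    qed
    ultimately show "eigenvalue ?A l"
      unfolding eigenvalue_def eigenvector_def using dim by (intro exI[of _ ?v]) auto
  qed
qed

text \<open>The eigenfunction of \<open>monotone_eigenfunction\<close> shows that \<open>1 / \<nu>\<close> is attained, and \<open>eigenvalue_ge\<close> that nothing
smaller is.\<close>

lemma spectral_gap_eigenfunction:
  defines "l \<equiv> spectral_gap n kernel"
  obtains \<psi> where "l > 0" "l \<le> 2" "poincare (1 / l)" "\<And>x. x \<le> n \<Longrightarrow> step \<psi> x = (1 - l) * \<psi> x"
    "\<And>x. x \<le> n \<Longrightarrow> \<psi> x \<le> \<psi> 0" "\<psi> 0 > 0" "(\<Sum>y\<le>n. \<pi> y * \<psi> y) = 0"
proof -
  obtain \<nu> \<psi> where e: "\<nu> > 0" "poincare \<nu>" "\<And>x. x \<le> n \<Longrightarrow> step \<psi> x = (1 - 1 / \<nu>) * \<psi> x"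
    "\<And>x. x \<le> n \<Longrightarrow> \<psi> x \<le> \<psi> 0" "\<psi> 0 > 0" "(\<Sum>y\<le>n. \<pi> y * \<psi> y) = 0"
    using monotone_eigenfunction by blast
  have nz: "\<exists>x\<le>n. \<psi> x \<noteq> 0" using e(5) by force
  have "spectral_gap n kernel = 1 / \<nu>"
    unfolding spectral_gap_def
  proof (rule Min_eqI)
    have "1\<^sub>m (Suc n) - kernel \<in> carrier_mat (Suc n) (Suc n)" by (intro minus_carrier_mat kernel_carrier)
    then have "finite (spectrum (1\<^sub>m (Suc n) - kernel))" by (rule card_finite_spectrum(1))
    then show "finite {l. eigenvalue (1\<^sub>m (Suc n) - kernel) l \<and> l \<noteq> 0}"
      by (rule rev_finite_subset) (auto simp: spectrum_def)
  next
    fix k assume "k \<in> {l. eigenvalue (1\<^sub>m (Suc n) - kernel) l \<and> l \<noteq> 0}"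
    then show "1 / \<nu> \<le> k"
      unfolding eigenvalue_iff using eigenvalue_ge[OF e(2,1)] by blast
  next
    show "1 / \<nu> \<in> {l. eigenvalue (1\<^sub>m (Suc n) - kernel) l \<and> l \<noteq> 0}"
      unfolding eigenvalue_iff using nz e(1,3) by auto
  qed
  then have l: "l = 1 / \<nu>" by (simp add: l_def)
  show thesis
    by (rule that[of \<psi>])
      (use e eigenvalue_range[OF e(3) nz] in \<open>simp_all add: l\<close>)
qed

end

section \<open>Rates and reversibility of an irreducible birth and death matrix\<close>

text \<open>Stationarity says that the net stationary flow out of each state vanishes; as no flow leaves to the left
of \<open>0\<close>, it vanishes across every edge, which is detailed balance.\<close>

lemma birth_death_chain:
  assumes K: "birth_death n K" and irr: "irreducible_matrix K" and st: "stationary n K \<pi>" and n: "n \<ge> 1"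
  obtains p q where "bd_chain n p q \<pi>" "K = bd_chain.kernel n p q"
proof -
  obtain p q r where pqr: "\<And>i. i \<le> n \<Longrightarrow> p i \<ge> 0 \<and> q i \<ge> 0 \<and> r i \<ge> 0 \<and> p i + q i + r i = 1"
    and pn: "p n = 0" and q0: "q 0 = 0"
    and Keq: "K = mat (Suc n) (Suc n) (\<lambda>(i, j).
              if j = Suc i then p i else if i = Suc j then q i else if j = i then r i else 0)"
    using K unfolding birth_death_def by blast
  have Kc: "K \<in> carrier_mat (Suc n) (Suc n)" by (simp add: Keq)
  have Ke: "K $$ (i, j) = (if j = Suc i then p i else if i = Suc j then q i else if j = i then r i else 0)"
    if "i \<le> n" "j \<le> n" for i j
    using that by (simp add: Keq)
  have pow: "(K ^\<^sub>m Suc m) $$ (x, y) = (\<Sum>z\<le>n. (K ^\<^sub>m m) $$ (x, z) * K $$ (z, y))" if "x \<le> n" "y \<le> n" for m x y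
    using Kc that pow_carrier_mat[OF Kc, of m]
    by (simp add: scalar_prod_def atLeast0LessThan lessThan_Suc_atMost)
  have dim: "dim_row K = Suc n" using Kc by auto
  have reach: "\<exists>m. (K ^\<^sub>m m) $$ (x, y) > 0" if "x \<le> n" "y \<le> n" for x y
    using irr that unfolding irreducible_matrix_def dim by auto
  \<comment> \<open>A missing edge would confine the chain to one side of it.\<close>
  have p_pos: "p i > 0" if i: "i < n" for i
  proof (rule ccontr)
    assume "\<not> ?thesis"
    then have p: "p i = 0" using pqr[of i] i by force
    have "(K ^\<^sub>m m) $$ (x, y) = 0" if "x \<le> i" "i < y" "y \<le> n" for m x y
      using that
    proof (induction m arbitrary: y)
      case 0 then show ?case using Kc i by auto
    next
      case (Suc m)
      have "(K ^\<^sub>m m) $$ (x, z) * K $$ (z, y) = 0" if "z \<le> n" for z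
      proof (cases "z \<le> i")
        case True
        then show ?thesis using Ke[of z y] p Suc.prems that by (auto simp: le_less)
      next
        case False
        then show ?thesis using Suc.IH[of z] Suc.prems that by simp
      qed
      then have "(\<Sum>z\<le>n. (K ^\<^sub>m m) $$ (x, z) * K $$ (z, y)) = 0" by (intro sum.neutral) auto
      then show ?case using pow[of x y m] Suc.prems i by simp
    qed
    then show False using reach[of i "Suc i"] i by force
  qed
  have q_pos: "q (Suc i) > 0" if i: "i < n" for i
  proof (rule ccontr)
    assume "\<not> ?thesis"
    then have q: "q (Suc i) = 0" using pqr[of "Suc i"] i by force
    have "(K ^\<^sub>m m) $$ (x, y) = 0" if "i < x" "x \<le> n" "y \<le> i" for m x y
      using that
    proof (induction m arbitrary: y)
      case 0 then show ?case using Kc i by auto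
    next
      case (Suc m)
      have "(K ^\<^sub>m m) $$ (x, z) * K $$ (z, y) = 0" if "z \<le> n" for z
      proof (cases "i < z")
        case True
        show ?thesis
        proof (cases "z = Suc y")
          case z: True
          with True Suc.prems have "y = i" by simp
          then show ?thesis using z q i Ke[of z y] by simp
        next
          case False
          then show ?thesis using True Ke[of z y] Suc.prems that by simp
        qed
      next
        case False
        then show ?thesis using Suc.IH[of z] Suc.prems that by simp
      qed
      then have "(\<Sum>z\<le>n. (K ^\<^sub>m m) $$ (x, z) * K $$ (z, y)) = 0" by (intro sum.neutral) auto
      then show ?case using pow[of x y m] Suc.prems i by simp
    qed
    then show False using reach[of "Suc i" i] i by force
  qed
  have stn: "\<And>x. x \<le> n \<Longrightarrow> \<pi> x \<ge> 0" "(\<Sum>x\<le>n. \<pi> x) = 1"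
    "\<And>y. y \<le> n \<Longrightarrow> (\<Sum>x\<le>n. \<pi> x * K $$ (x, y)) = \<pi> y"
    using st by (auto simp: stationary_def)
  have col: "\<pi> y = (if y = 0 then 0 else \<pi> (y - 1) * p (y - 1)) + (if y < n then \<pi> (Suc y) * q (Suc y) else 0)
      + \<pi> y * (1 - p y - q y)" if y: "y \<le> n" for y
  proof -
    have "(\<Sum>x\<le>n. \<pi> x * K $$ (x, y)) = (\<Sum>x\<le>n. (if x = y - 1 then (if y = 0 then 0 else \<pi> x * p x) else 0)
        + (if x = Suc y then \<pi> x * q x else 0) + (if x = y then \<pi> x * (1 - p x - q x) else 0))"
    proof (intro sum.cong refl)
      fix x assume "x \<in> {..n}"
      then have x: "x \<le> n" by simp
      have r: "r x = 1 - p x - q x" using pqr[OF x] by linarith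
      show "\<pi> x * K $$ (x, y) = (if x = y - 1 then (if y = 0 then 0 else \<pi> x * p x) else 0)
        + (if x = Suc y then \<pi> x * q x else 0) + (if x = y then \<pi> x * (1 - p x - q x) else 0)"
        unfolding Ke[OF x y] r by (cases y) auto
    qed
    moreover have "y - 1 \<le> n" using y by simp
    ultimately show ?thesis using stn(3)[OF y] y n
      by (cases y; cases "y < n") (simp_all add: sum.distrib Suc_le_eq)
  qed
  have db: "\<pi> i * p i = \<pi> (Suc i) * q (Suc i)" if "i < n" for i
    using that
  proof (induction i)
    case 0
    then show ?case using col[of 0] q0 by (simp add: algebra_simps)
  next
    case (Suc i)
    then show ?case using col[of "Suc i"] by (simp add: algebra_simps)
  qed
  have "\<pi> 0 > 0"
  proof (rule ccontr)
    assume "\<not> ?thesis"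
    then have 0: "\<pi> 0 = 0" using stn(1)[of 0] by simp
    have "\<pi> i = 0" if "i \<le> n" for i
      using that
    proof (induction i)
      case (Suc i)
      then show ?case using db[of i] q_pos[of i] by simp
    qed (rule 0)
    then show False using stn(2) by simp
  qed
  have pi_pos: "\<pi> i > 0" if "i \<le> n" for i
    using that
  proof (induction i)
    case (Suc i)
    then have "\<pi> (Suc i) * q (Suc i) > 0" using db[of i] p_pos[of i] by (metis Suc_le_eq less_imp_le mult_pos_pos)
    then show ?case using q_pos[of i] Suc.prems by (simp add: zero_less_mult_iff)
  qed (rule \<open>\<pi> 0 > 0\<close>)
  have bd: "bd_chain n p q \<pi>"
  proof
    show "p i + q i \<le> 1" if "i \<le> n" for i using pqr[OF that] by linarith
  qed (use n p_pos q_pos pn q0 pi_pos stn(2) db in auto)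
  moreover have "K = bd_chain.kernel n p q"
    unfolding bd_chain.kernel_def[OF bd] Keq
  proof (rule cong_mat)
    fix i j assume "i < Suc n" "j < Suc n"
    then have "r i = 1 - p i - q i" using pqr[of i] by simp
    then show "(case (i, j) of (i, j) \<Rightarrow> if j = Suc i then p i else if i = Suc j then q i else if j = i then r i else 0) =
      (case (i, j) of (i, j) \<Rightarrow> if j = Suc i then p i else if i = Suc j then q i else if j = i then 1 - p i - q i else 0)"
      by simp
  qed simp_all
  ultimately show thesis by (rule that)
qed

section \<open>Hitting times in discrete time\<close>

text \<open>Summation by parts; the weights \<open>d = 1\<close> and \<open>d m = 2 (m + 1)\<close> give \<open>T\<close> and \<open>T^2 + T\<close>.\<close>

lemma nat_valued_moment:
  fixes T :: "'a \<Rightarrow> nat"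
  assumes P: "prob_space P" and T[measurable]: "T \<in> measurable P (count_space UNIV)"
    and tail: "\<And>m. measure P {\<omega> \<in> space P. m < T \<omega>} = a m"
    and d: "\<And>m. d m \<ge> 0" and s: "(\<lambda>m. d m * a m) sums s"
  shows "has_bochner_integral P (\<lambda>\<omega>. \<Sum>m<T \<omega>. d m) s"
proof (rule has_bochner_integral_nn_integral)
  interpret prob_space P by fact
  have a: "a m \<ge> 0" for m unfolding tail[symmetric] by simp
  show "0 \<le> s" using sums_le[OF _ sums_zero s] d a by simp
  have "(\<integral>\<^sup>+\<omega>. ennreal (\<Sum>m<T \<omega>. d m) \<partial>P) =
      (\<integral>\<^sup>+\<omega>. (\<Sum>m. ennreal (d m) * indicator {\<omega> \<in> space P. m < T \<omega>} \<omega>) \<partial>P)"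
  proof (rule nn_integral_cong)
    fix \<omega> assume "\<omega> \<in> space P"
    then have "(\<Sum>m. ennreal (d m) * indicator {\<omega> \<in> space P. m < T \<omega>} \<omega>) =
       (\<Sum>m<T \<omega>. ennreal (d m) * indicator {\<omega> \<in> space P. m < T \<omega>} \<omega>)"
      by (intro suminf_finite) auto
    also have "\<dots> = (\<Sum>m<T \<omega>. ennreal (d m))"
      using \<open>\<omega> \<in> space P\<close> by (intro sum.cong) auto
    finally show "ennreal (\<Sum>m<T \<omega>. d m) = (\<Sum>m. ennreal (d m) * indicator {\<omega> \<in> space P. m < T \<omega>} \<omega>)"
      using d by (simp add: sum_ennreal)
  qed
  also have "\<dots> = (\<Sum>m. ennreal (d m * a m))"
    by (subst nn_integral_suminf)
       (auto simp: nn_integral_cmult_indicator emeasure_eq_measure tail ennreal_mult d a)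
  also have "\<dots> = ennreal s"
    using d a s by (intro suminf_ennreal_eq) auto
  finally show "(\<integral>\<^sup>+\<omega>. ennreal (\<Sum>m<T \<omega>. d m) \<partial>P) = ennreal s" .
qed (use d in \<open>auto intro!: sum_nonneg\<close>)

locale hitting = bd_chain n p q \<pi> + prob_space P
  for n :: nat and p q \<pi> :: "nat \<Rightarrow> real" and P :: "'a measure" +
  fixes X :: "nat \<Rightarrow> 'a \<Rightarrow> nat" and j M :: nat
  assumes mc: "markov_chain P n kernel j X" and j_le: "j \<le> n" and M_le: "M \<le> n"
begin

lemma X_le: "\<omega> \<in> space P \<Longrightarrow> X m \<omega> \<le> n"
  using mc measurable_space[of "X m" P "count_space {0..n}" \<omega>] by (auto simp: markov_chain_def)

lemma X_measurable[measurable]: "X m \<in> measurable P (count_space UNIV)"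
proof -
  have "X m \<in> measurable P (count_space {0..n})" using mc by (auto simp: markov_chain_def)
  from measurable_compose[OF this, of "\<lambda>x. x" "count_space UNIV"] show ?thesis by simp
qed

lemma X_0: "AE \<omega> in P. X 0 \<omega> = j"
  using mc by (auto simp: markov_chain_def)

lemma markov:
  assumes y: "y \<le> n"
  shows "prob {\<omega> \<in> space P. (\<forall>k\<le>m. X k \<omega> = x k) \<and> X (Suc m) \<omega> = y} =
    prob {\<omega> \<in> space P. \<forall>k\<le>m. X k \<omega> = x k} * kernel $$ (x m, y)"
proof (cases "prob {\<omega> \<in> space P. \<forall>k\<le>m. X k \<omega> = x k} > 0")
  case True
  then have "cond_prob P (\<lambda>\<omega>. X (Suc m) \<omega> = y) (\<lambda>\<omega>. \<forall>k\<le>m. X k \<omega> = x k) = kernel $$ (x m, y)"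
    using mc y by (auto simp: markov_chain_def)
  then show ?thesis using True by (simp add: cond_prob_def conj_commute field_simps)
next
  case False
  then have 0: "prob {\<omega> \<in> space P. \<forall>k\<le>m. X k \<omega> = x k} = 0"
    by (simp add: zero_less_measure_iff)
  have "prob {\<omega> \<in> space P. (\<forall>k\<le>m. X k \<omega> = x k) \<and> X (Suc m) \<omega> = y} \<le>
      prob {\<omega> \<in> space P. \<forall>k\<le>m. X k \<omega> = x k}"
    by (intro finite_measure_mono) auto
  then show ?thesis using 0 measure_nonneg[of P] by (simp add: antisym)
qed

text \<open>The tail of the hitting time.\<close>

definition avoid :: "nat \<Rightarrow> real" where
  "avoid m = prob {\<omega> \<in> space P. \<forall>k\<le>m. X k \<omega> \<noteq> M}"

definition occ :: "nat \<Rightarrow> nat \<Rightarrow> real" where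
  "occ m y = prob {\<omega> \<in> space P. (\<forall>k\<le>m. X k \<omega> \<noteq> M) \<and> X m \<omega> = y}"

text \<open>The Markov property is given for events prescribing a whole path, so events that avoid \<open>M\<close> are cut into
such paths.\<close>

lemma path_partition:
  assumes Q[measurable]: "Measurable.pred P Q"
  shows "prob {\<omega> \<in> space P. (\<forall>k\<le>m. X k \<omega> \<noteq> M) \<and> Q \<omega>} =
    (\<Sum>x\<in>PiE {..m} (\<lambda>_. {..n} - {M}). prob {\<omega> \<in> space P. (\<forall>k\<le>m. X k \<omega> = x k) \<and> Q \<omega>})"
proof -
  let ?I = "PiE {..m} (\<lambda>_. {..n} - {M})"
  let ?A = "\<lambda>x. {\<omega> \<in> space P. (\<forall>k\<le>m. X k \<omega> = x k) \<and> Q \<omega>}"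
  have "{\<omega> \<in> space P. (\<forall>k\<le>m. X k \<omega> \<noteq> M) \<and> Q \<omega>} = (\<Union>x\<in>?I. ?A x)"
  proof (intro equalityI subsetI)
    fix \<omega> assume w: "\<omega> \<in> {\<omega> \<in> space P. (\<forall>k\<le>m. X k \<omega> \<noteq> M) \<and> Q \<omega>}"
    then have "restrict (\<lambda>k. X k \<omega>) {..m} \<in> ?I" using X_le by (auto simp: PiE_iff)
    moreover have "\<omega> \<in> ?A (restrict (\<lambda>k. X k \<omega>) {..m})" using w by auto
    ultimately show "\<omega> \<in> (\<Union>x\<in>?I. ?A x)" by blast
  next
    fix \<omega> assume "\<omega> \<in> (\<Union>x\<in>?I. ?A x)"
    then obtain x where x: "x \<in> ?I" "\<omega> \<in> ?A x" by blast
    have "X k \<omega> \<noteq> M" if "k \<le> m" for k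
      using x that PiE_mem[OF x(1), of k] by auto
    then show "\<omega> \<in> {\<omega> \<in> space P. (\<forall>k\<le>m. X k \<omega> \<noteq> M) \<and> Q \<omega>}" using x by auto
  qed
  moreover have "prob (\<Union>x\<in>?I. ?A x) = (\<Sum>x\<in>?I. prob (?A x))"
  proof (rule finite_measure_finite_Union)
    show "disjoint_family_on ?A ?I"
    proof (unfold disjoint_family_on_def, intro ballI impI equals0I)
      fix x y \<omega> assume xy: "x \<in> ?I" "y \<in> ?I" "x \<noteq> y" "\<omega> \<in> ?A x \<inter> ?A y"
      have "x k = y k" for k
      proof (cases "k \<le> m")
        case True then show ?thesis using xy(4) by auto
      next
        case False then show ?thesis using xy(1,2) by (auto simp: PiE_iff extensional_def)
      qed
      then show False using xy(3) by (auto intro: ext)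
    qed
  qed (auto intro!: finite_PiE)
  ultimately show ?thesis by simp
qed

lemma occ_eq: "occ m y = (\<Sum>x\<in>PiE {..m} (\<lambda>_. {..n} - {M}).
    of_bool (x m = y) * prob {\<omega> \<in> space P. \<forall>k\<le>m. X k \<omega> = x k})"
proof -
  have "{\<omega> \<in> space P. (\<forall>k\<le>m. X k \<omega> = x k) \<and> X m \<omega> = y} =
     (if x m = y then {\<omega> \<in> space P. \<forall>k\<le>m. X k \<omega> = x k} else {})" for x by auto
  then show ?thesis
    unfolding occ_def by (subst path_partition) (auto intro!: sum.cong)
qed

lemma occ_Suc:
  assumes y: "y \<le> n" "y \<noteq> M"
  shows "occ (Suc m) y = (\<Sum>z\<le>n. occ m z * kernel $$ (z, y))"
proof -
  let ?I = "PiE {..m} (\<lambda>_. {..n} - {M})"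
  have "occ (Suc m) y = prob {\<omega> \<in> space P. (\<forall>k\<le>m. X k \<omega> \<noteq> M) \<and> X (Suc m) \<omega> = y}"
    unfolding occ_def using y by (intro arg_cong[of _ _ prob]) (auto simp: le_Suc_eq)
  also have "\<dots> = (\<Sum>x\<in>?I. prob {\<omega> \<in> space P. \<forall>k\<le>m. X k \<omega> = x k} * kernel $$ (x m, y))"
    by (subst path_partition) (simp_all add: markov[OF y(1)])
  also have "\<dots> = (\<Sum>x\<in>?I. \<Sum>z\<le>n. of_bool (x m = z) * prob {\<omega> \<in> space P. \<forall>k\<le>m. X k \<omega> = x k} * kernel $$ (z, y))"
  proof (intro sum.cong refl)
    fix x assume "x \<in> ?I"
    then have "x m \<le> n" by (auto simp: PiE_iff)
    have "(\<Sum>z\<le>n. of_bool (x m = z) * prob {\<omega> \<in> space P. \<forall>k\<le>m. X k \<omega> = x k} * kernel $$ (z, y)) =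
      (\<Sum>z\<le>n. if z = x m then prob {\<omega> \<in> space P. \<forall>k\<le>m. X k \<omega> = x k} * kernel $$ (z, y) else 0)"
      by (intro sum.cong) auto
    then show "prob {\<omega> \<in> space P. \<forall>k\<le>m. X k \<omega> = x k} * kernel $$ (x m, y) =
      (\<Sum>z\<le>n. of_bool (x m = z) * prob {\<omega> \<in> space P. \<forall>k\<le>m. X k \<omega> = x k} * kernel $$ (z, y))"
      using \<open>x m \<le> n\<close> by simp
  qed
  also have "\<dots> = (\<Sum>z\<le>n. occ m z * kernel $$ (z, y))"
    by (subst sum.swap) (simp add: occ_eq sum_distrib_right)
  finally show ?thesis .
qed

lemma occ_M: "occ m M = 0"
proof -
  have "{\<omega> \<in> space P. (\<forall>k\<le>m. X k \<omega> \<noteq> M) \<and> X m \<omega> = M} = {}" by auto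
  then show ?thesis by (simp only: occ_def measure_empty)
qed

lemma occ_sum: "(\<Sum>y\<le>n. occ m y) = avoid m"
proof -
  have "avoid m = prob (\<Union>y\<in>{..n}. {\<omega> \<in> space P. (\<forall>k\<le>m. X k \<omega> \<noteq> M) \<and> X m \<omega> = y})"
    unfolding avoid_def by (intro arg_cong[of _ _ prob]) (use X_le in auto)
  also have "\<dots> = (\<Sum>y\<le>n. occ m y)"
    unfolding occ_def by (intro finite_measure_finite_Union) (auto simp: disjoint_family_on_def)
  finally show ?thesis by simp
qed

text \<open>The expectation of \<open>f (X m)\<close> on the event that \<open>M\<close> has not been visited up to time \<open>m\<close>.\<close>

definition killed :: "nat \<Rightarrow> (nat \<Rightarrow> real) \<Rightarrow> real" where
  "killed m f = (\<Sum>y\<le>n. occ m y * f y)"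

lemma killed_0:
  assumes "f M = 0"
  shows "killed 0 f = f j"
proof -
  have "occ 0 y = of_bool (y = j \<and> j \<noteq> M)" for y
  proof -
    have "occ 0 y = prob {\<omega> \<in> space P. X 0 \<omega> \<noteq> M \<and> X 0 \<omega> = y}" by (simp add: occ_def)
    also have "\<dots> = prob {\<omega> \<in> space P. j \<noteq> M \<and> j = y}"
      by (intro measure_eq_AE) (use X_0 in auto)
    finally show ?thesis by (auto simp: prob_space)
  qed
  then have "killed 0 f = (\<Sum>y\<le>n. if y = j then (if j \<noteq> M then f y else 0) else 0)"
    unfolding killed_def by (intro sum.cong) auto
  then show ?thesis using j_le assms by auto
qed

lemma killed_Suc:
  assumes "f M = 0"
  shows "killed (Suc m) f = killed m (step f)"
proof -
  have "killed (Suc m) f = (\<Sum>y\<le>n. \<Sum>z\<le>n. occ m z * kernel $$ (z, y) * f y)"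
    unfolding killed_def
  proof (intro sum.cong refl)
    fix y assume "y \<in> {..n}"
    then show "occ (Suc m) y * f y = (\<Sum>z\<le>n. occ m z * kernel $$ (z, y) * f y)"
      using assms occ_Suc[of y m] by (cases "y = M") (simp_all add: sum_distrib_right)
  qed
  also have "\<dots> = (\<Sum>z\<le>n. occ m z * (\<Sum>y\<le>n. kernel $$ (z, y) * f y))"
    by (subst sum.swap) (simp add: sum_distrib_left mult.assoc)
  finally show ?thesis by (simp add: killed_def kernel_row)
qed

lemma killed_cong: "(\<And>y. y \<le> n \<Longrightarrow> y \<noteq> M \<Longrightarrow> f y = g y) \<Longrightarrow> killed m f = killed m g"
  unfolding killed_def by (intro sum.cong refl) (metis atMost_iff mult_zero_left occ_M)

lemma killed_diff: "killed m f - killed m g = killed m (\<lambda>y. f y - g y)"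
  by (simp add: killed_def right_diff_distrib sum_subtractf)

lemma abs_killed_le: "(\<And>y. y \<le> n \<Longrightarrow> \<bar>f y\<bar> \<le> c) \<Longrightarrow> \<bar>killed m f\<bar> \<le> c * avoid m"
proof -
  assume c: "\<And>y. y \<le> n \<Longrightarrow> \<bar>f y\<bar> \<le> c"
  have "\<bar>killed m f\<bar> \<le> (\<Sum>y\<le>n. \<bar>occ m y * f y\<bar>)" unfolding killed_def by (rule sum_abs)
  also have "\<dots> \<le> (\<Sum>y\<le>n. occ m y * c)"
    by (intro sum_mono) (use c in \<open>auto simp: abs_mult occ_def intro!: mult_left_mono\<close>)
  also have "\<dots> = avoid m * c" by (simp only: sum_distrib_right[symmetric] occ_sum)
  finally show ?thesis by (simp add: mult.commute)
qed

lemma avoid_nonneg: "avoid m \<ge> 0" and avoid_le_1: "avoid m \<le> 1"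
  by (simp_all add: avoid_def)

lemma avoid_Suc_le: "avoid (Suc m) \<le> avoid m"
  unfolding avoid_def by (intro finite_measure_mono) (auto dest: le_SucI)

lemma avoid_sums: "avoid sums hit_mean M j" "(\<lambda>m. real (m + 1) * avoid m) sums hit_second M j"
    "avoid \<longlonglongrightarrow> 0"
proof -
  define c where "c = Max ((\<lambda>x. max \<bar>hit_mean M x\<bar> \<bar>hit_second M x\<bar>) ` {..n})"
  have "max \<bar>hit_mean M x\<bar> \<bar>hit_second M x\<bar> \<le> c" if "x \<le> n" for x
    unfolding c_def using that by (intro Max_ge) auto
  then have c: "\<bar>hit_mean M x\<bar> \<le> c" "\<bar>hit_second M x\<bar> \<le> c" if "x \<le> n" for x using that by force+
  have U: "killed m (hit_mean M) - killed (Suc m) (hit_mean M) = avoid m" for m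
  proof -
    have "killed m (hit_mean M) - killed (Suc m) (hit_mean M) = killed m (\<lambda>y. hit_mean M y - step (hit_mean M) y)"
      by (simp add: killed_Suc hit_potentials_at_target killed_diff)
    also have "\<dots> = killed m (\<lambda>_. 1)"
      by (intro killed_cong) (simp add: hit_mean_poisson M_le)
    finally show ?thesis by (simp add: killed_def occ_sum)
  qed
  have W: "killed m (hit_second M) - killed (Suc m) (hit_second M) = killed m (hit_mean M)" for m
  proof -
    have "killed m (hit_second M) - killed (Suc m) (hit_second M) = killed m (\<lambda>y. hit_second M y - step (hit_second M) y)"
      by (simp add: killed_Suc hit_potentials_at_target killed_diff)
    also have "\<dots> = killed m (hit_mean M)"
      by (intro killed_cong) (simp add: hit_second_poisson M_le)
    finally show ?thesis .
  qed
  note * = summed_tails[of avoid "\<lambda>m. killed m (hit_mean M)" "\<lambda>m. killed m (hit_second M)" c,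
      OF avoid_nonneg avoid_Suc_le U W abs_killed_le abs_killed_le]
  show "avoid sums hit_mean M j" "(\<lambda>m. real (m + 1) * avoid m) sums hit_second M j" "avoid \<longlonglongrightarrow> 0"
    using * c by (simp_all add: killed_0 hit_potentials_at_target)
qed

lemma avoid_markov: "avoid m \<le> hit_mean M j / (real m + 1)"
  by (rule decreasing_term_le[OF avoid_nonneg avoid_Suc_le avoid_sums(1)])

lemma AE_hits: "AE \<omega> in P. \<exists>m. X m \<omega> = M"
proof (rule AE_I')
  have "prob {\<omega> \<in> space P. \<forall>m. X m \<omega> \<noteq> M} \<le> avoid m" for m
    unfolding avoid_def by (intro finite_measure_mono) auto
  then have "prob {\<omega> \<in> space P. \<forall>m. X m \<omega> \<noteq> M} \<le> 0"
    by (intro LIMSEQ_le_const[OF avoid_sums(3)]) auto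
  then show "{\<omega> \<in> space P. \<forall>m. X m \<omega> \<noteq> M} \<in> null_sets P"
    by (intro null_setsI) (auto simp: emeasure_eq_measure measure_le_0_iff)
qed auto

text \<open>On the null event that \<open>M\<close> is never visited, the infimum of the empty set is some fixed number.\<close>

definition first_hit :: "'a \<Rightarrow> nat" where
  "first_hit \<omega> = Inf {m. X m \<omega> = M}"

lemma first_hit_gt:
  assumes "\<exists>m. X m \<omega> = M"
  shows "m < first_hit \<omega> \<longleftrightarrow> (\<forall>k\<le>m. X k \<omega> \<noteq> M)"
proof
  assume "m < first_hit \<omega>"
  then show "\<forall>k\<le>m. X k \<omega> \<noteq> M"
    unfolding first_hit_def by (metis (mono_tags) le_less_trans mem_Collect_eq not_less wellorder_Inf_le1)
next
  assume "\<forall>k\<le>m. X k \<omega> \<noteq> M"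
  moreover have "X (first_hit \<omega>) \<omega> = M"
    using assms Inf_nat_def1[of "{m. X m \<omega> = M}"] by (auto simp: first_hit_def)
  ultimately show "m < first_hit \<omega>" by (metis not_le)
qed

lemma first_hit_measurable[measurable]: "first_hit \<in> measurable P (count_space UNIV)"
proof (rule measurable_count_space_eq_countable[THEN iffD2], simp, intro conjI ballI)
  fix k
  have "first_hit -` {k} \<inter> space P = {\<omega> \<in> space P.
     (if \<exists>m. X m \<omega> = M then X k \<omega> = M \<and> (\<forall>i<k. X i \<omega> \<noteq> M) else k = Inf {})}"
  proof (rule Set.set_eqI)
    fix \<omega>
    have "first_hit \<omega> = k \<longleftrightarrow> (if \<exists>m. X m \<omega> = M then X k \<omega> = M \<and> (\<forall>i<k. X i \<omega> \<noteq> M) else k = Inf {})"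
    proof (cases "\<exists>m. X m \<omega> = M")
      case True
      have fh: "X (first_hit \<omega>) \<omega> = M"
        using True Inf_nat_def1[of "{m. X m \<omega> = M}"] by (auto simp: first_hit_def)
      have lt: "X i \<omega> \<noteq> M" if "i < first_hit \<omega>" for i
        using first_hit_gt[OF True, of i] that by auto
      show ?thesis using True fh lt by (metis linorder_neqE_nat)
    next
      case False
      then have "{m. X m \<omega> = M} = {}" by simp
      then show ?thesis using False by (auto simp: first_hit_def)
    qed
    then show "\<omega> \<in> first_hit -` {k} \<inter> space P \<longleftrightarrow> \<omega> \<in> {\<omega> \<in> space P.
       (if \<exists>m. X m \<omega> = M then X k \<omega> = M \<and> (\<forall>i<k. X i \<omega> \<noteq> M) else k = Inf {})}"
      by auto
  qed
  then show "first_hit -` {k} \<inter> space P \<in> sets P" by simp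
qed auto

lemma first_hit_tail: "prob {\<omega> \<in> space P. m < first_hit \<omega>} = avoid m"
  unfolding avoid_def
proof (rule measure_eq_AE)
  show "AE \<omega> in P. \<omega> \<in> {\<omega> \<in> space P. m < first_hit \<omega>} \<longleftrightarrow> \<omega> \<in> {\<omega> \<in> space P. \<forall>k\<le>m. X k \<omega> \<noteq> M}"
    using AE_hits by eventually_elim (auto simp: first_hit_gt)
qed auto

lemma hitting_time_moments:
  "expectation (hitting_time X M) = hit_mean M j"
  "variance (hitting_time X M) = 2 * hit_second M j - hit_mean M j - (hit_mean M j)^2"
proof -
  have T: "hitting_time X M = (\<lambda>\<omega>. real (first_hit \<omega>))"
    by (simp add: hitting_time_def first_hit_def fun_eq_iff)
  have 1: "has_bochner_integral P (\<lambda>\<omega>. \<Sum>m<first_hit \<omega>. 1) (hit_mean M j)"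
    by (rule nat_valued_moment[OF prob_space_axioms first_hit_measurable first_hit_tail])
       (use avoid_sums(1) in auto)
  then have e: "has_bochner_integral P (hitting_time X M) (hit_mean M j)" by (simp add: T)
  have s2: "(\<lambda>m. 2 * real (m + 1) * avoid m) sums (2 * hit_second M j)"
    using sums_mult[OF avoid_sums(2), of 2] by (simp only: mult.assoc)
  have "has_bochner_integral P (\<lambda>\<omega>. \<Sum>m<first_hit \<omega>. 2 * real (m + 1)) (2 * hit_second M j)"
    by (rule nat_valued_moment[OF prob_space_axioms first_hit_measurable first_hit_tail])
       (use s2 in auto)
  moreover have sum_eq: "(\<Sum>m<k. 2 * real (m + 1)) = (real k)^2 + real k" for k
    by (induction k) (simp_all add: power2_eq_square algebra_simps)
  ultimately have "has_bochner_integral P (\<lambda>\<omega>. (real (first_hit \<omega>))^2 + real (first_hit \<omega>)) (2 * hit_second M j)"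
    by (simp only: sum_eq)
  from has_bochner_integral_diff[OF this e]
  have e2: "has_bochner_integral P (\<lambda>\<omega>. (hitting_time X M \<omega>)^2) (2 * hit_second M j - hit_mean M j)"
    by (simp add: T)
  show E: "expectation (hitting_time X M) = hit_mean M j"
    using e by (rule has_bochner_integral_integral_eq)
  show "variance (hitting_time X M) = 2 * hit_second M j - hit_mean M j - (hit_mean M j)^2"
    using e e2 by (subst variance_eq) (auto simp: has_bochner_integral_iff)
qed

end

section \<open>Hitting times in continuous time\<close>

lemma poi_measurable[measurable]: "(\<lambda>t. poi t m) \<in> borel_measurable borel"
  unfolding poi_def by measurable

lemma nn_integral_poi: "(\<integral>\<^sup>+t. ennreal (poi t m) * indicator {0..} t \<partial>lborel) = 1"
proof -
  have "(\<integral>\<^sup>+t. ennreal (poi t m) * indicator {0..} t \<partial>lborel) =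
     (\<integral>\<^sup>+t. ennreal (1 / fact m) * (ennreal (t ^ m * exp (- t)) * indicator {0..} t) \<partial>lborel)"
  proof (rule nn_integral_cong)
    fix t :: real
    show "ennreal (poi t m) * indicator {0..} t =
        ennreal (1 / fact m) * (ennreal (t ^ m * exp (- t)) * indicator {0..} t)"
    proof (cases "t \<ge> 0")
      case True
      have "poi t m = 1 / fact m * (t ^ m * exp (- t))" by (simp add: poi_def)
      then show ?thesis using True by (simp add: ennreal_mult[symmetric])
    qed simp
  qed
  also have "\<dots> = ennreal (1 / fact m) * ennreal (fact m)"
    by (subst nn_integral_cmult) (auto simp: nn_intergal_power_times_exp_Ici)
  also have "\<dots> = 1" by (simp add: ennreal_mult[symmetric])
  finally show ?thesis .
qed

lemma nn_integral_t_poi: "(\<integral>\<^sup>+t. ennreal (2 * t * poi t m) * indicator {0..} t \<partial>lborel) = ennreal (2 * real (m + 1))"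
proof -
  have eq: "2 * t * poi t m = 2 * real (m + 1) * poi t (Suc m)" for t
    using arg_cong[OF poi_Suc[of t m], of "\<lambda>x. 2 * x"] by (simp only: mult_ac Suc_eq_plus1)
  have "(\<integral>\<^sup>+t. ennreal (2 * t * poi t m) * indicator {0..} t \<partial>lborel) =
     (\<integral>\<^sup>+t. ennreal (2 * real (m + 1)) * (ennreal (poi t (Suc m)) * indicator {0..} t) \<partial>lborel)"
    unfolding eq by (intro nn_integral_cong) (auto simp: ennreal_mult poi_nonneg split: split_indicator)
  also have "\<dots> = ennreal (2 * real (m + 1)) * 1"
    by (subst nn_integral_cmult) (auto simp: nn_integral_poi)
  finally show ?thesis by simp
qed

text \<open>The left hand side integrates a primitive of \<open>d\<close> at \<open>T\<close>; exchanging the two integrals leaves \<open>d\<close> against the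
tail of \<open>T\<close>, to be integrated term by term.\<close>

lemma poisson_mixture_layers:
  fixes T :: "'a \<Rightarrow> real"
  assumes P: "prob_space P" and T[measurable]: "T \<in> borel_measurable P"
    and tail: "\<And>t. t \<ge> 0 \<Longrightarrow> measure P {\<omega> \<in> space P. t < T \<omega>} = poisson_mix t a"
    and a: "\<And>m. 0 \<le> a m" "\<And>m. a m \<le> 1"
    and d[measurable]: "d \<in> borel_measurable borel" and d0: "\<And>t. t \<ge> 0 \<Longrightarrow> d t \<ge> 0"
    and r: "\<And>m. r m \<ge> 0" "\<And>m. (\<integral>\<^sup>+t. ennreal (d t * poi t m) * indicator {0..} t \<partial>lborel) = ennreal (r m)"
    and s: "(\<lambda>m. r m * a m) sums s"
  shows "(\<integral>\<^sup>+\<omega>. (\<integral>\<^sup>+t. ennreal (d t) * indicator {0..<T \<omega>} t \<partial>lborel) \<partial>P) = ennreal s"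
proof -
  interpret prob_space P by fact
  interpret pair_sigma_finite lborel P by unfold_locales
  let ?f = "\<lambda>t \<omega>. ennreal (d t) * (indicator {0..} t * indicator {z. fst z < T (snd z)} (t, \<omega>))"
  have "(\<integral>\<^sup>+\<omega>. (\<integral>\<^sup>+t. ennreal (d t) * indicator {0..<T \<omega>} t \<partial>lborel) \<partial>P) = (\<integral>\<^sup>+\<omega>. (\<integral>\<^sup>+t. ?f t \<omega> \<partial>lborel) \<partial>P)"
    by (intro nn_integral_cong) (auto split: split_indicator)
  also have "\<dots> = (\<integral>\<^sup>+t. (\<integral>\<^sup>+\<omega>. ?f t \<omega> \<partial>P) \<partial>lborel)"
    by (rule Fubini') measurable
  also have "\<dots> = (\<integral>\<^sup>+t. (\<Sum>m. (ennreal (d t * poi t m) * indicator {0..} t) * ennreal (a m)) \<partial>lborel)"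
  proof (rule nn_integral_cong)
    fix t :: real
    show "(\<integral>\<^sup>+\<omega>. ?f t \<omega> \<partial>P) = (\<Sum>m. (ennreal (d t * poi t m) * indicator {0..} t) * ennreal (a m))"
    proof (cases "t \<ge> 0")
      case True
      have ab: "\<bar>a m\<bar> \<le> 1" for m using a[of m] by simp
      have "(\<integral>\<^sup>+\<omega>. ?f t \<omega> \<partial>P) = (\<integral>\<^sup>+\<omega>. ennreal (d t) * indicator {\<omega> \<in> space P. t < T \<omega>} \<omega> \<partial>P)"
        using True by (intro nn_integral_cong) (auto split: split_indicator)
      also have "\<dots> = ennreal (d t) * ennreal (poisson_mix t a)"
        by (simp add: nn_integral_cmult_indicator emeasure_eq_measure tail[OF True])
      also have "ennreal (poisson_mix t a) = (\<Sum>m. ennreal (poi t m * a m))"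
        unfolding poisson_mix_def
        by (intro suminf_ennreal2[symmetric] mult_nonneg_nonneg poi_nonneg True a poi_summable[OF True ab])
      also have "ennreal (d t) * \<dots> = (\<Sum>m. ennreal (d t) * ennreal (poi t m * a m))"
        by (rule ennreal_suminf_cmult[symmetric])
      finally show ?thesis
        using True d0[OF True] poi_nonneg[OF True] a by (simp add: ennreal_mult mult.assoc)
    qed simp
  qed
  also have "\<dots> = (\<Sum>m. ennreal (r m * a m))"
    by (subst nn_integral_suminf) (simp_all add: nn_integral_multc r ennreal_mult a)
  also have "\<dots> = ennreal s"
    using r(1) a s by (intro suminf_ennreal_eq) auto
  finally show ?thesis .
qed

lemma poisson_mixture_moments:
  fixes T :: "'a \<Rightarrow> real"
  assumes P: "prob_space P" and T[measurable]: "T \<in> borel_measurable P"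
    and pos: "AE \<omega> in P. T \<omega> \<ge> 0"
    and tail: "\<And>t. t \<ge> 0 \<Longrightarrow> measure P {\<omega> \<in> space P. t < T \<omega>} = poisson_mix t a"
    and a: "\<And>m. 0 \<le> a m" "\<And>m. a m \<le> 1"
    and u: "a sums u" and w: "(\<lambda>m. real (m + 1) * a m) sums w"
  shows "has_bochner_integral P T u" "has_bochner_integral P (\<lambda>\<omega>. (T \<omega>)^2) (2 * w)"
proof -
  have nn: "u \<ge> 0" "w \<ge> 0"
    using sums_le[OF _ sums_zero u] sums_le[OF _ sums_zero w] a by simp_all
  show "has_bochner_integral P T u"
  proof (rule has_bochner_integral_nn_integral[OF T pos nn(1)])
    have "(\<integral>\<^sup>+t. ennreal 1 * indicator {0..<x} t \<partial>lborel) = ennreal x" for x :: real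
      by (cases "x \<ge> 0") (auto simp: ennreal_neg)
    then have "(\<integral>\<^sup>+\<omega>. ennreal (T \<omega>) \<partial>P) = (\<integral>\<^sup>+\<omega>. (\<integral>\<^sup>+t. ennreal 1 * indicator {0..<T \<omega>} t \<partial>lborel) \<partial>P)"
      by (intro nn_integral_cong) (rule sym)
    also have "\<dots> = ennreal u"
      by (rule poisson_mixture_layers[OF P T tail a, where r = "\<lambda>_. 1"])
         (use u in \<open>auto simp: nn_integral_poi\<close>)
    finally show "(\<integral>\<^sup>+\<omega>. ennreal (T \<omega>) \<partial>P) = ennreal u" .
  qed
  show "has_bochner_integral P (\<lambda>\<omega>. (T \<omega>)^2) (2 * w)"
  proof (rule has_bochner_integral_nn_integral)
    have sq: "(\<integral>\<^sup>+t. ennreal (2 * t) * indicator {0..<x} t \<partial>lborel) = ennreal (x^2)" if "x \<ge> 0" for x :: real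
    proof -
      have "(\<integral>\<^sup>+t. ennreal (2 * t) * indicator {0..<x} t \<partial>lborel) = (\<integral>\<^sup>+t. ennreal (2 * t) * indicator {0..x} t \<partial>lborel)"
        by (intro nn_integral_cong_AE eventually_mono[OF AE_lborel_singleton[of x]]) (auto split: split_indicator)
      also have "\<dots> = ennreal (x^2 - 0^2)"
        by (rule nn_integral_FTC_Icc[where F = "\<lambda>t. t^2"])
           (use that in \<open>auto intro!: derivative_eq_intros\<close>)
      finally show ?thesis by simp
    qed
    have s2: "(\<lambda>m. 2 * real (m + 1) * a m) sums (2 * w)"
      using sums_mult[OF w, of 2] by (simp only: mult.assoc)
    have "(\<integral>\<^sup>+\<omega>. ennreal ((T \<omega>)^2) \<partial>P) = (\<integral>\<^sup>+\<omega>. (\<integral>\<^sup>+t. ennreal (2 * t) * indicator {0..<T \<omega>} t \<partial>lborel) \<partial>P)"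
      by (rule nn_integral_cong_AE) (use pos in \<open>eventually_elim, simp add: sq\<close>)
    also have "\<dots> = ennreal (2 * w)"
      by (rule poisson_mixture_layers[OF P T tail a, where r = "\<lambda>m. 2 * real (m + 1)"])
         (use s2 nn_integral_t_poi in auto)
    finally show "(\<integral>\<^sup>+\<omega>. ennreal ((T \<omega>)^2) \<partial>P) = ennreal (2 * w)" .
  qed (use nn in auto)
qed

text \<open>A nondecreasing path that grows by at most one over each cell of a grid cannot skip an integer.\<close>

lemma grid_surjective:
  fixes f :: "real \<Rightarrow> nat"
  assumes t: "t \<ge> 0" and L: "L > 0" and f0: "f 0 = 0"
    and inc: "\<And>i. i < L \<Longrightarrow> f (real (Suc i) * t / real L) \<le> f (real i * t / real L) + 1"
    and k: "k \<le> f t"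
  shows "\<exists>s\<in>{0..t}. f s = k"
proof -
  have "\<forall>k \<le> f (real i * t / real L). \<exists>s\<in>{0..t}. f s = k" if "i \<le> L" for i
    using that
  proof (induction i)
    case 0
    then show ?case using f0 t by (auto intro!: bexI[of _ 0])
  next
    case (Suc i)
    show ?case
    proof (intro allI impI)
      fix k assume k: "k \<le> f (real (Suc i) * t / real L)"
      show "\<exists>s\<in>{0..t}. f s = k"
      proof (cases "k \<le> f (real i * t / real L)")
        case True
        then show ?thesis using Suc by auto
      next
        case False
        then have "k = f (real (Suc i) * t / real L)" using inc[of i] k Suc.prems by simp
        moreover have "real (Suc i) * t / real L \<in> {0..t}"
        proof -
          have "real (Suc i) * t \<le> real L * t" using Suc.prems t by (intro mult_right_mono) auto
          then show ?thesis using t L by (simp add: divide_le_eq mult.commute del: of_nat_Suc)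
        qed
        ultimately show ?thesis by blast
      qed
    qed
  qed
  from this[of L] show ?thesis using k L by simp
qed

locale continuous_hitting = hitting n p q \<pi> P X j M
  for n :: nat and p q \<pi> :: "nat \<Rightarrow> real" and P :: "'a measure" and X :: "nat \<Rightarrow> 'a \<Rightarrow> nat" and j M :: nat +
  fixes N :: "real \<Rightarrow> 'a \<Rightarrow> nat"
  assumes realizes: "realizes_chain P n kernel j X N"
begin

lemma N_facts:
  shows N_measurable: "t \<ge> 0 \<Longrightarrow> N t \<in> measurable P (count_space UNIV)"
    and N_0: "\<omega> \<in> space P \<Longrightarrow> N 0 \<omega> = 0"
    and N_mono: "\<omega> \<in> space P \<Longrightarrow> 0 \<le> s \<Longrightarrow> s \<le> t \<Longrightarrow> N s \<omega> \<le> N t \<omega>"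
    and N_right: "\<omega> \<in> space P \<Longrightarrow> t \<ge> 0 \<Longrightarrow> continuous (at_right t) (\<lambda>s. N s \<omega>)"
    and N_increment: "0 \<le> s \<Longrightarrow> s < t \<Longrightarrow>
      distr P (count_space UNIV) (\<lambda>\<omega>. N t \<omega> - N s \<omega>) = measure_pmf (poisson_pmf (t - s))"
  using realizes unfolding realizes_chain_def poisson_process_def
  by (auto simp: mono_on_def)

lemma increment_prob:
  assumes "0 \<le> s" "s < t"
  shows "prob {\<omega> \<in> space P. N t \<omega> - N s \<omega> = k} = poi (t - s) k"
proof -
  have [measurable]: "N s \<in> measurable P (count_space UNIV)" "N t \<in> measurable P (count_space UNIV)"
    using assms by (auto intro: N_measurable)
  have "poi (t - s) k = measure (distr P (count_space UNIV) (\<lambda>\<omega>. N t \<omega> - N s \<omega>)) {k}"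
    using assms by (simp add: N_increment measure_pmf_single poi_def)
  also have "\<dots> = prob ((\<lambda>\<omega>. N t \<omega> - N s \<omega>) -` {k} \<inter> space P)"
    by (intro measure_distr) auto
  also have "(\<lambda>\<omega>. N t \<omega> - N s \<omega>) -` {k} \<inter> space P = {\<omega> \<in> space P. N t \<omega> - N s \<omega> = k}" by auto
  finally show ?thesis by simp
qed

lemma N_prob:
  assumes "t \<ge> 0"
  shows "prob {\<omega> \<in> space P. N t \<omega> = k} = poi t k"
proof (cases "t = 0")
  case True
  have "{\<omega> \<in> space P. N t \<omega> = k} = (if k = 0 then space P else {})" using True N_0 by auto
  then show ?thesis using True by (auto simp: poi_def prob_space power_0_left)
next
  case False
  have "{\<omega> \<in> space P. N t \<omega> = k} = {\<omega> \<in> space P. N t \<omega> - N 0 \<omega> = k}" using N_0 by auto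
  then show ?thesis using increment_prob[of 0 t k] False assms by simp
qed

text \<open>The discrete chain has avoided \<open>M\<close> up to the number of clock rings by time \<open>t\<close>. Up to null events this is
\<open>t < T\<close>, provided that the clock does not skip integers.\<close>

definition clock_avoid :: "real \<Rightarrow> 'a set" where
  "clock_avoid t = {\<omega> \<in> space P. \<forall>k\<le>N t \<omega>. X k \<omega> \<noteq> M}"

lemma avoid_event_generated:
  "{\<omega> \<in> space P. \<forall>k\<le>m. X k \<omega> \<noteq> M} \<in> sigma_sets (space P) {X m -` A \<inter> space P | m A. True}"
proof -
  define G where "G = {X m -` A \<inter> space P | m A. True}"
  have basic: "X k -` (- {M}) \<inter> space P \<in> sigma_sets (space P) G" for k
    by (rule sigma_sets.Basic) (unfold G_def, blast)
  have Int: "A \<inter> B \<in> sigma_sets (space P) G" if "A \<in> sigma_sets (space P) G" "B \<in> sigma_sets (space P) G" for A B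
  proof -
    have "sigma_algebra (space P) (sigma_sets (space P) G)"
      by (rule sigma_algebra_sigma_sets) (auto simp: G_def)
    then interpret S: sigma_algebra "space P" "sigma_sets (space P) G" .
    show ?thesis using that by (rule S.Int)
  qed
  have step: "{\<omega> \<in> space P. \<forall>k\<le>Suc m. X k \<omega> \<noteq> M} =
      {\<omega> \<in> space P. \<forall>k\<le>m. X k \<omega> \<noteq> M} \<inter> (X (Suc m) -` (- {M}) \<inter> space P)" for m
    by (auto simp: le_Suc_eq)
  have start: "{\<omega> \<in> space P. \<forall>k\<le>0. X k \<omega> \<noteq> M} = X 0 -` (- {M}) \<inter> space P"
    by auto
  show ?thesis unfolding G_def[symmetric]
  proof (induction m)
    case 0
    show ?case unfolding start by (rule basic)
  next
    case (Suc m)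
    show ?case unfolding step by (rule Int[OF Suc basic])
  qed
qed

lemma clock_avoid_prob:
  assumes t: "t \<ge> 0"
  shows "clock_avoid t \<in> events" "prob (clock_avoid t) = poisson_mix t avoid"
proof -
  have Nt[measurable]: "N t \<in> measurable P (count_space UNIV)" using t by (rule N_measurable)
  let ?A = "\<lambda>m. {\<omega> \<in> space P. \<forall>k\<le>m. X k \<omega> \<noteq> M} \<inter> (N t -` {m} \<inter> space P)"
  have eq: "clock_avoid t = (\<Union>m. ?A m)" by (auto simp: clock_avoid_def)
  have sets: "?A m \<in> events" for m by measurable
  then show "clock_avoid t \<in> events" unfolding eq by auto
  have "prob (?A m) = poi t m * avoid m" for m
  proof -
    have "prob (?A m) = prob {\<omega> \<in> space P. \<forall>k\<le>m. X k \<omega> \<noteq> M} * prob (N t -` {m} \<inter> space P)"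
    proof (rule indep_setD)
      show "indep_set (sigma_sets (space P) {X m -` A \<inter> space P | m A. True})
         (sigma_sets (space P) {N t -` A \<inter> space P | t A. 0 \<le> t})"
        using realizes by (simp add: realizes_chain_def)
      show "N t -` {m} \<inter> space P \<in> sigma_sets (space P) {N t -` A \<inter> space P | t A. 0 \<le> t}"
        using t by (intro sigma_sets.Basic) blast
    qed (rule avoid_event_generated)
    moreover have "N t -` {m} \<inter> space P = {\<omega> \<in> space P. N t \<omega> = m}" by auto
    ultimately show ?thesis by (simp add: avoid_def N_prob[OF t])
  qed
  moreover have "(\<lambda>m. prob (?A m)) sums prob (clock_avoid t)"
    unfolding eq by (rule finite_measure_UNION) (use sets in \<open>auto simp: disjoint_family_on_def\<close>)
  ultimately show "prob (clock_avoid t) = poisson_mix t avoid"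
    by (simp add: poisson_mix_def sums_iff)
qed

definition double_rings :: "real \<Rightarrow> nat \<Rightarrow> 'a set" where
  "double_rings t L = (\<Union>i<L. {\<omega> \<in> space P. N (real (Suc i) * t / real L) \<omega> - N (real i * t / real L) \<omega> \<ge> 2})"

text \<open>A Poisson increment of parameter \<open>h = t / L\<close> is at least two with probability at most \<open>h^2\<close>, and there
are \<open>L\<close> cells. The bound vanishes as \<open>L\<close> grows.\<close>

lemma double_rings_prob:
  assumes t: "t > 0" and L: "L > 0"
  shows "double_rings t L \<in> events" "prob (double_rings t L) \<le> t^2 / real L"
proof -
  let ?g = "\<lambda>i. real i * t / real L"
  let ?J = "\<lambda>i. {\<omega> \<in> space P. N (?g (Suc i)) \<omega> - N (?g i) \<omega> \<ge> 2}"
  have g: "0 \<le> ?g i" for i using t by simp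
  have Ng[measurable]: "N (?g i) \<in> measurable P (count_space UNIV)" for i by (rule N_measurable[OF g])
  have ev: "?J i \<in> events" for i by measurable
  show "double_rings t L \<in> events" unfolding double_rings_def using ev by auto
  have J: "prob (?J i) \<le> (t / real L)^2" for i
  proof -
    define h where "h = t / real L"
    have h: "h > 0" using t L by (simp add: h_def)
    have gg: "?g (Suc i) - ?g i = h" by (simp add: h_def add_divide_distrib distrib_right)
    then have lt: "?g i < ?g (Suc i)" using h by linarith
    define Z where "Z \<omega> = N (?g (Suc i)) \<omega> - N (?g i) \<omega>" for \<omega>
    have [measurable]: "Z \<in> measurable P (count_space UNIV)"
      unfolding Z_def by measurable
    let ?E = "\<lambda>k. {\<omega> \<in> space P. Z \<omega> = k}"
    have Eev: "?E k \<in> events" for k by measurable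
    have J_eq: "?J i = space P - (?E 0 \<union> ?E 1)" unfolding Z_def[symmetric] by auto
    have "prob (?J i) = 1 - prob (?E 0 \<union> ?E 1)"
      unfolding J_eq by (intro prob_compl sets.Un Eev)
    also have "prob (?E 0 \<union> ?E 1) = prob (?E 0) + prob (?E 1)"
      by (rule finite_measure_Union) (use Eev in auto)
    also have "\<dots> = poi h 0 + poi h 1"
      unfolding Z_def increment_prob[OF g lt] gg ..
    also have "1 - (poi h 0 + poi h 1) = 1 - exp (- h) * (1 + h)" by (simp add: poi_def distrib_left)
    also have "\<dots> \<le> 1 - (1 - h) * (1 + h)"
      using exp_ge_add_one_self[of "- h"] h by (intro diff_left_mono mult_right_mono) auto
    also have "\<dots> = h^2" by (simp add: power2_eq_square algebra_simps)
    finally show ?thesis by (simp add: h_def)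
  qed
  have "prob (double_rings t L) \<le> (\<Sum>i<L. prob (?J i))"
    unfolding double_rings_def by (rule finite_measure_subadditive_finite) (use ev in auto)
  also have "\<dots> \<le> (\<Sum>i<L. (t / real L)^2)" by (intro sum_mono J)
  also have "\<dots> = t^2 / real L" using L by (simp add: power2_eq_square)
  finally show "prob (double_rings t L) \<le> t^2 / real L" .
qed

lemma no_double_rings_visits:
  assumes t: "t > 0" "L > 0" and w: "\<omega> \<in> space P" "\<omega> \<notin> double_rings t L" and k: "k \<le> N t \<omega>"
  shows "\<exists>s\<in>{0..t}. N s \<omega> = k"
proof (rule grid_surjective[OF less_imp_le[OF t(1)] t(2)])
  fix i assume i: "i < L"
  then have "N (real (Suc i) * t / real L) \<omega> - N (real i * t / real L) \<omega> < 2"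
    using w by (auto simp: double_rings_def not_le)
  then show "N (real (Suc i) * t / real L) \<omega> \<le> N (real i * t / real L) \<omega> + 1" by linarith
qed (use N_0 w k in auto)

abbreviation T :: "'a \<Rightarrow> real" where
  "T \<equiv> hitting_time_continuous X N M"

definition hit_event :: "'a set" where
  "hit_event = {\<omega> \<in> space P. \<exists>t\<ge>0. X (N t \<omega>) \<omega> = M}"

text \<open>A right continuous path in a discrete space is constant on a short interval to the right of each time;
this lets the infimum be attained and replaces arbitrary times by rational ones.\<close>

lemma right_constant:
  assumes "\<omega> \<in> space P" "t \<ge> 0"
  obtains b where "b > t" "\<And>s. t \<le> s \<Longrightarrow> s < b \<Longrightarrow> N s \<omega> = N t \<omega>"
proof -
  have "((\<lambda>s. N s \<omega>) \<longlongrightarrow> N t \<omega>) (at_right t)"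
    using N_right[OF assms] by (simp add: continuous_within)
  then have "eventually (\<lambda>s. N s \<omega> = N t \<omega>) (at_right t)"
    by (simp add: tendsto_discrete)
  then obtain b where "b > t" "\<And>s. s > t \<Longrightarrow> s < b \<Longrightarrow> N s \<omega> = N t \<omega>"
    unfolding eventually_at_right_field by auto
  then show thesis by (intro that[of b]) (auto simp: le_less)
qed

lemma T_less_imp:
  assumes w: "\<omega> \<in> hit_event" and "T \<omega> < c"
  shows "\<exists>s\<ge>0. s < c \<and> X (N s \<omega>) \<omega> = M"
proof -
  have "{t. 0 \<le> t \<and> X (N t \<omega>) \<omega> = M} \<noteq> {}" using w by (auto simp: hit_event_def)
  then show ?thesis using cInf_lessD[of "{t. 0 \<le> t \<and> X (N t \<omega>) \<omega> = M}" c] assms(2)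
    by (auto simp: hitting_time_continuous_def)
qed

lemma T_le: "s \<ge> 0 \<Longrightarrow> X (N s \<omega>) \<omega> = M \<Longrightarrow> T \<omega> \<le> s"
  unfolding hitting_time_continuous_def by (intro cInf_lower) (auto intro!: bdd_belowI[of _ 0])

lemma rational_time:
  assumes w: "\<omega> \<in> space P" and s: "s \<ge> 0" "s < c" "X (N s \<omega>) \<omega> = M"
  shows "\<exists>r\<in>\<rat>. 0 \<le> r \<and> r < c \<and> X (N r \<omega>) \<omega> = M"
proof -
  obtain b where b: "b > s" "\<And>r. s \<le> r \<Longrightarrow> r < b \<Longrightarrow> N r \<omega> = N s \<omega>"
    using right_constant[OF w s(1)] by blast
  obtain r where "r \<in> \<rat>" "s < r" "r < min b c" using Rats_dense_in_real[of s "min b c"] b(1) s(2) by auto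
  then show ?thesis using b(2)[of r] s by (intro bexI[of _ r]) auto
qed

lemma state_event:
  assumes "r \<ge> 0"
  shows "{\<omega> \<in> space P. X (N r \<omega>) \<omega> = M} \<in> events"
proof -
  have [measurable]: "N r \<in> measurable P (count_space UNIV)" using assms by (rule N_measurable)
  have [measurable]: "(\<lambda>\<omega>. X (N r \<omega>) \<omega>) \<in> measurable P (count_space UNIV)"
    by (rule measurable_compose_countable) measurable
  show ?thesis by measurable
qed

lemma rational_union_event:
  "(\<Union>r\<in>{r\<in>\<rat>. 0 \<le> r \<and> Q r}. {\<omega> \<in> space P. X (N r \<omega>) \<omega> = M}) \<in> events"
proof (rule sets.countable_UN')
  show "countable {r \<in> \<rat>. 0 \<le> r \<and> Q r}"
    by (rule countable_subset[OF _ countable_rat]) auto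
qed (use state_event in auto)

lemma hit_event_sets: "hit_event \<in> events"
proof -
  have "hit_event = (\<Union>r\<in>{r\<in>\<rat>. 0 \<le> r \<and> True}. {\<omega> \<in> space P. X (N r \<omega>) \<omega> = M})"
  proof (intro equalityI subsetI)
    fix \<omega> assume "\<omega> \<in> hit_event"
    then obtain t where t: "\<omega> \<in> space P" "t \<ge> 0" "X (N t \<omega>) \<omega> = M" by (auto simp: hit_event_def)
    then show "\<omega> \<in> (\<Union>r\<in>{r\<in>\<rat>. 0 \<le> r \<and> True}. {\<omega> \<in> space P. X (N r \<omega>) \<omega> = M})"
      using rational_time[of \<omega> t "t + 1"] by auto
  qed (auto simp: hit_event_def)
  then show ?thesis using rational_union_event[of "\<lambda>_. True"] by simp
qed

lemma T_measurable: "T \<in> borel_measurable P"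
proof (unfold borel_measurable_iff_less, rule allI)
  fix c
  let ?U = "\<Union>r\<in>{r\<in>\<rat>. 0 \<le> r \<and> r < c}. {\<omega> \<in> space P. X (N r \<omega>) \<omega> = M}"
  have "{\<omega> \<in> space P. T \<omega> < c} = ?U \<union> (if Inf {} < c then space P - hit_event else {})"
  proof (rule Set.set_eqI)
    fix \<omega>
    show "\<omega> \<in> {\<omega> \<in> space P. T \<omega> < c} \<longleftrightarrow> \<omega> \<in> ?U \<union> (if Inf {} < c then space P - hit_event else {})"
    proof (cases "\<omega> \<in> hit_event")
      case True
      then have w: "\<omega> \<in> space P" by (simp add: hit_event_def)
      have "T \<omega> < c \<longleftrightarrow> (\<exists>r\<in>\<rat>. 0 \<le> r \<and> r < c \<and> X (N r \<omega>) \<omega> = M)"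
        using T_less_imp[OF True, of c] rational_time[OF w, of _ c] T_le[of _ \<omega>] by (meson le_less_trans)
      then show ?thesis using w True by auto
    next
      case False
      show ?thesis
      proof (cases "\<omega> \<in> space P")
        case w: True
        have "{t. 0 \<le> t \<and> X (N t \<omega>) \<omega> = M} = {}" using False w by (auto simp: hit_event_def)
        then have "T \<omega> = Inf {}" by (simp only: hitting_time_continuous_def)
        moreover have "\<omega> \<notin> ?U" using False w by (auto simp: hit_event_def)
        ultimately show ?thesis using w False by simp
      qed auto
    qed
  qed
  then show "{\<omega> \<in> space P. T \<omega> < c} \<in> events"
    using rational_union_event[of "\<lambda>r. r < c"] hit_event_sets by auto
qed

lemma clock_avoid_imp_T:
  assumes w: "\<omega> \<in> clock_avoid t" "\<omega> \<in> hit_event" and t: "t \<ge> 0"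
  shows "t < T \<omega>"
proof (rule ccontr)
  have sp: "\<omega> \<in> space P" using w by (simp add: clock_avoid_def)
  assume "\<not> t < T \<omega>"
  moreover obtain b where b: "b > t" "\<And>s. t \<le> s \<Longrightarrow> s < b \<Longrightarrow> N s \<omega> = N t \<omega>"
    using right_constant[OF sp t] by blast
  ultimately obtain s where s: "s \<ge> 0" "s < b" "X (N s \<omega>) \<omega> = M"
    using T_less_imp[OF w(2), of b] by auto
  have "N s \<omega> \<le> N t \<omega>"
    using N_mono[OF sp s(1), of t] b(2)[of s] s(2) by (cases "s \<le> t") auto
  then show False using w(1) s(3) by (auto simp: clock_avoid_def)
qed

lemma T_imp_clock_avoid:
  assumes w: "\<omega> \<in> space P" and av: "\<And>s. 0 \<le> s \<Longrightarrow> s \<le> t \<Longrightarrow> X (N s \<omega>) \<omega> \<noteq> M" and t: "t > 0" "L > 0"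
  shows "\<omega> \<in> clock_avoid t \<union> double_rings t L"
proof (cases "\<omega> \<in> double_rings t L")
  case False
  have "X k \<omega> \<noteq> M" if k: "k \<le> N t \<omega>" for k
  proof -
    obtain s where "0 \<le> s" "s \<le> t" "N s \<omega> = k"
      using no_double_rings_visits[OF t w False k] by auto
    with av[of s] show ?thesis by simp
  qed
  then show ?thesis using w by (simp add: clock_avoid_def)
qed simp

text \<open>Outside \<open>double_rings t L\<close>, avoiding \<open>M\<close> in continuous time on \<open>[0,t]\<close> amounts to avoiding it at every clock ring;
then \<open>L\<close> tends to infinity.\<close>

lemma prob_le_clock_avoid:
  assumes A: "A \<in> events" and t: "t > 0"
    and av: "\<And>\<omega> s. \<omega> \<in> A \<Longrightarrow> 0 \<le> s \<Longrightarrow> s \<le> t \<Longrightarrow> X (N s \<omega>) \<omega> \<noteq> M"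
  shows "prob A \<le> prob (clock_avoid t)"
proof -
  have "prob A \<le> prob (clock_avoid t) + t^2 / real (Suc L)" for L
  proof -
    have "A \<subseteq> clock_avoid t \<union> double_rings t (Suc L)"
    proof
      fix \<omega> assume w: "\<omega> \<in> A"
      then have "\<omega> \<in> space P" using A sets.sets_into_space by auto
      then show "\<omega> \<in> clock_avoid t \<union> double_rings t (Suc L)"
        by (rule T_imp_clock_avoid) (use av[OF w] t in auto)
    qed
    then have "prob A \<le> prob (clock_avoid t \<union> double_rings t (Suc L))"
      using double_rings_prob(1)[OF t, of "Suc L"] clock_avoid_prob(1)[of t] t by (intro finite_measure_mono) auto
    also have "\<dots> \<le> prob (clock_avoid t) + prob (double_rings t (Suc L))"
      using double_rings_prob(1)[OF t, of "Suc L"] clock_avoid_prob(1)[of t] t by (intro measure_Un_le) auto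
    also have "\<dots> \<le> prob (clock_avoid t) + t^2 / real (Suc L)"
      using double_rings_prob(2)[OF t, of "Suc L"] by simp
    finally show ?thesis .
  qed
  moreover have "(\<lambda>L. prob (clock_avoid t) + t^2 / real (Suc L)) \<longlonglongrightarrow> prob (clock_avoid t) + 0"
    by (intro tendsto_add tendsto_const tendsto_divide_0[OF tendsto_const]
        filterlim_at_top_imp_at_infinity filterlim_compose[OF filterlim_real_sequentially filterlim_Suc])
  ultimately show ?thesis by (intro LIMSEQ_le_const[of _ "prob (clock_avoid t)"]) auto
qed

lemma AE_hit_event: "AE \<omega> in P. \<omega> \<in> hit_event"
proof (rule AE_I')
  have "prob (space P - hit_event) \<le> hit_mean M j / real (Suc k)" for k
  proof -
    have "prob (space P - hit_event) \<le> prob (clock_avoid (real (Suc k)))"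
      by (rule prob_le_clock_avoid) (use hit_event_sets in \<open>auto simp: hit_event_def\<close>)
    also have "\<dots> = poisson_mix (real (Suc k)) avoid" by (rule clock_avoid_prob(2)) simp
    also have "\<dots> \<le> hit_mean M j / real (Suc k)"
    proof (rule poisson_mix_markov[of _ _ 1])
      show "\<bar>avoid m\<bar> \<le> 1" for m using avoid_nonneg[of m] avoid_le_1[of m] by simp
    qed (use avoid_markov hit_mean_nonneg[OF j_le M_le] in auto)
    finally show ?thesis .
  qed
  moreover have "(\<lambda>k. hit_mean M j / real (Suc k)) \<longlonglongrightarrow> 0"
    by (intro tendsto_divide_0[OF tendsto_const] filterlim_at_top_imp_at_infinity
        filterlim_compose[OF filterlim_real_sequentially filterlim_Suc])
  ultimately have "prob (space P - hit_event) \<le> 0"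
    by (intro LIMSEQ_le_const[of _ 0]) auto
  then show "space P - hit_event \<in> null_sets P"
    using hit_event_sets by (intro null_setsI) (auto simp: emeasure_eq_measure measure_le_0_iff)
qed (auto simp: hit_event_def)

lemma T_tail:
  assumes t: "t \<ge> 0"
  shows "prob {\<omega> \<in> space P. t < T \<omega>} = poisson_mix t avoid"
proof -
  let ?A = "{\<omega> \<in> space P. t < T \<omega>}"
  have A: "?A \<in> events" using T_measurable by measurable
  have free: "X (N s \<omega>) \<omega> \<noteq> M" if "t < T \<omega>" "0 \<le> s" "s \<le> t" for s \<omega>
    using T_le[OF that(2), of \<omega>] that by auto
  have "prob ?A \<le> prob (clock_avoid t)"
  proof (cases "t = 0")
    case True
    have "?A \<subseteq> clock_avoid t"
    proof
      fix \<omega> assume w: "\<omega> \<in> ?A"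
      then have "N 0 \<omega> = 0" "X (N 0 \<omega>) \<omega> \<noteq> M" using free[of \<omega> 0] N_0 True by auto
      then show "\<omega> \<in> clock_avoid t" using w True by (simp add: clock_avoid_def)
    qed
    then show ?thesis using clock_avoid_prob(1)[OF t] by (intro finite_measure_mono)
  next
    case False
    then show ?thesis using A t free by (intro prob_le_clock_avoid) auto
  qed
  moreover have "prob (clock_avoid t) \<le> prob ?A"
  proof (rule finite_measure_mono_AE[OF _ A])
    show "AE \<omega> in P. \<omega> \<in> clock_avoid t \<longrightarrow> \<omega> \<in> ?A"
      using AE_hit_event
      by eventually_elim (use clock_avoid_imp_T t in \<open>auto simp: clock_avoid_def\<close>)
  qed
  ultimately show ?thesis using clock_avoid_prob(2)[OF t] by simp
qed

lemma hitting_time_continuous_moments: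
  "expectation T = hit_mean M j"
  "variance T = 2 * hit_second M j - (hit_mean M j)^2"
proof -
  have "AE \<omega> in P. 0 \<le> T \<omega>"
    using AE_hit_event
  proof eventually_elim
    case (elim \<omega>)
    then show ?case unfolding hitting_time_continuous_def
      by (intro cInf_greatest) (auto simp: hit_event_def)
  qed
  note m = poisson_mixture_moments[OF prob_space_axioms T_measurable this T_tail avoid_nonneg avoid_le_1 avoid_sums(1,2)]
  show "expectation T = hit_mean M j"
    using m(1) by (rule has_bochner_integral_integral_eq)
  show "variance T = 2 * hit_second M j - (hit_mean M j)^2"
    using m by (subst variance_eq) (auto simp: has_bochner_integral_iff)
qed

end

text \<open>What the asymptotic analysis needs to know about one chain: \<open>l\<close> is the spectral gap, \<open>s\<close> and \<open>B\<close> are the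
total mean and variance of the two hitting times in continuous time, \<open>t\<close> and \<open>v\<close> are the mean and variance
attached to separation in continuous time, and \<open>\<kappa>\<close> bounds the stationary masses on both sides of the
target from below.\<close>

definition moment_profile ::
    "nat \<Rightarrow> real \<Rightarrow> real \<Rightarrow> real \<Rightarrow> real \<Rightarrow> real \<Rightarrow> real \<Rightarrow> bool" where
  "moment_profile n \<kappa> l s B t v \<longleftrightarrow>
     0 < l \<and> l \<le> 2 \<and> real n \<le> s \<and> s \<le> B \<and> B \<le> 2 / (\<kappa> * l) * s \<and>
     0 \<le> t \<and> t \<le> s \<and> s - t \<le> 2 / (\<kappa> * l) \<and> (s - t)^2 \<le> 2 * B \<and>
     v \<le> 2 * B \<and> v \<le> B + 2 / (\<kappa> * l)^2"

text \<open>The separation distance \<open>d\<close> as the tail of a time of mean \<open>t\<close>: upper and lower Chebyshev bounds, the Markov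
bound, and the lower bound from the spectral gap. In discrete time the variance is \<open>v - t\<close>.\<close>

definition continuous_tail :: "real \<Rightarrow> real \<Rightarrow> real \<Rightarrow> (real \<Rightarrow> real) \<Rightarrow> bool" where
  "continuous_tail l t v d \<longleftrightarrow>
     (\<forall>a>0. d (t + a) \<le> (4 * v + 2 * a) / a^2) \<and>
     (\<forall>a>0. \<forall>y. 0 \<le> y \<and> y \<le> t - a \<longrightarrow> 1 - d y \<le> 4 * v / a^2) \<and>
     (\<forall>y>0. d y \<le> t / y) \<and> (\<forall>y\<ge>0. exp (- l * y) \<le> d y)"

definition discrete_tail :: "real \<Rightarrow> real \<Rightarrow> real \<Rightarrow> (nat \<Rightarrow> real) \<Rightarrow> bool" where
  "discrete_tail l t v d \<longleftrightarrow>
     (\<forall>a>0. \<forall>m. real m \<ge> t + a \<longrightarrow> d m \<le> (v - t) / a^2) \<and>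
     (\<forall>a>0. \<forall>m. real m \<le> t - a \<longrightarrow> 1 - d m \<le> (v - t) / a^2) \<and>
     (\<forall>m. d m \<le> t / (real m + 1)) \<and> (\<forall>m. (1 - l) ^ m \<le> d m)"

text \<open>The hitting times from \<open>0\<close> and from \<open>n\<close> see the edges left and right of \<open>M\<close>, so that together they involve
every edge once, as separation does. Their discrete and continuous versions have equal means, and
variances that differ by the mean.\<close>

lemma chain_profile:
  fixes P :: "nat \<Rightarrow> 'a measure" and X :: "nat \<Rightarrow> 'a \<Rightarrow> nat"
  assumes n: "n \<ge> 1" and K: "birth_death n K" "irreducible_matrix K" "stationary n K \<pi>"
    and M: "M \<le> n" and R: "\<And>j. j \<le> n \<Longrightarrow> realizes_chain (P j) n K j X N"
    and k: "\<kappa> > 0" "\<kappa> \<le> (\<Sum>x\<in>{0..M}. \<pi> x)" "\<kappa> \<le> (\<Sum>x\<in>{M..n}. \<pi> x)"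
  defines "s \<equiv> prob_space.expectation (P 0) (hitting_time_continuous X N M)
             + prob_space.expectation (P n) (hitting_time_continuous X N M)"
    and "B \<equiv> prob_space.variance (P 0) (hitting_time_continuous X N M)
             + prob_space.variance (P n) (hitting_time_continuous X N M)"
    and "l \<equiv> spectral_gap n K"
  obtains t v where "moment_profile n \<kappa> l s B t v" "continuous_tail l t v (sep_continuous n K \<pi> 0)"
    "s = prob_space.expectation (P 0) (hitting_time X M) + prob_space.expectation (P n) (hitting_time X M)"
    "B - s = prob_space.variance (P 0) (hitting_time X M) + prob_space.variance (P n) (hitting_time X M)"
    "(\<forall>i<n. K $$ (i, Suc i) + K $$ (Suc i, i) \<le> 1) \<Longrightarrow> s < B"
    "(\<forall>i<n. K $$ (i, Suc i) + K $$ (Suc i, i) \<le> 1) \<Longrightarrow> discrete_tail l t v (sep_discrete n K \<pi> 0)"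
proof -
  obtain p q where bd: "bd_chain n p q \<pi>" and Keq: "K = bd_chain.kernel n p q"
    using birth_death_chain[OF K n] .
  interpret bd_chain n p q \<pi> by (rule bd)
  have prob: "prob_space (P j)" and mc: "markov_chain (P j) n kernel j X" if "j \<le> n" for j
    using R[OF that] by (auto simp: realizes_chain_def markov_chain_def Keq)
  interpret P0: continuous_hitting n p q \<pi> "P 0" X 0 M N
    using prob[of 0] mc[of 0] R[of 0] M bd Keq
    by (intro continuous_hitting.intro hitting.intro hitting_axioms.intro continuous_hitting_axioms.intro) auto
  interpret Pn: continuous_hitting n p q \<pi> "P n" X n M N
    using prob[of n] mc[of n] R[of n] M bd Keq
    by (intro continuous_hitting.intro hitting.intro hitting_axioms.intro continuous_hitting_axioms.intro) auto
  have s: "s = hit_total M"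
    unfolding s_def P0.hitting_time_continuous_moments Pn.hitting_time_continuous_moments
    by (rule hit_total_eq[OF M])
  have B: "B = hit_var_left M + hit_var_right M"
    unfolding B_def P0.hitting_time_continuous_moments(2) Pn.hitting_time_continuous_moments(2)
      hit_var_left_eq[OF M] hit_var_right_eq[OF M] ..
  have l: "l = spectral_gap n kernel" by (simp add: l_def Keq)
  obtain \<psi> where e: "l > 0" "l \<le> 2" "poincare (1 / l)" "\<And>x. x \<le> n \<Longrightarrow> step \<psi> x = (1 - l) * \<psi> x"
    "\<And>x. x \<le> n \<Longrightarrow> \<psi> x \<le> \<psi> 0" "\<psi> 0 > 0" "(\<Sum>y\<le>n. \<pi> y * \<psi> y) = 0"
    using spectral_gap_eigenfunction unfolding l by blast
  have kb: "\<kappa> \<le> below z" if "M \<le> z" "z < n" for z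
    using k(2) below_mono[of M z] that by (simp add: below_def atMost_atLeast0)
  have ka: "\<kappa> \<le> above z" if "z < M" for z
  proof -
    have "(\<Sum>x\<in>{M..n}. \<pi> x) \<le> above z"
      unfolding above_def by (rule sum_mono2) (use that pi_nonneg in auto)
    then show ?thesis using k(3) by simp
  qed
  let ?A = "excess_left M" and ?A' = "excess_right M"
  have A: "0 \<le> ?A" "0 \<le> ?A'" using excess_nonneg[OF M] by auto
  have Ale: "?A \<le> 1 / (\<kappa> * l)" "?A' \<le> 1 / (\<kappa> * l)"
    using excess_left_le[OF e(3) M k(1) ka] excess_right_le[OF e(3) M k(1) kb] by (simp_all add: mult.commute)
  have Asq: "?A^2 + ?A'^2 \<le> B" unfolding B using excess_left_sq[OF M] excess_right_sq[OF M] by linarith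
  have st: "s - sep_mean = ?A + ?A'" unfolding s by (rule hit_total_minus_sep_mean[OF M])
  have AA: "2 * (?A * ?A') \<le> ?A^2 + ?A'^2" using sum_squares_bound[of ?A ?A'] by (simp add: mult.assoc)
  have AA': "?A * ?A' \<le> 1 / (\<kappa> * l)^2"
    using mult_mono[OF Ale] A e(1) k(1) by (simp add: power2_eq_square)
  have v: "sep_var \<le> B + 2 * (?A * ?A')"
    using sep_var_le[OF M] unfolding B by (simp add: mult.assoc)
  have "moment_profile n \<kappa> l s B sep_mean sep_var"
    unfolding moment_profile_def
  proof (intro conjI)
    show "real n \<le> s" unfolding s by (rule hit_total_ge[OF M])
    show "s \<le> B" unfolding s B by (rule hit_total_le_var[OF M])
    show "B \<le> 2 / (\<kappa> * l) * s"
      using hit_var_le[OF e(3) M k(1) ka kb] unfolding s B by (simp add: mult.commute)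
    show "(s - sep_mean)^2 \<le> 2 * B"
      unfolding st using AA Asq by (simp add: power2_sum)
    show "s - sep_mean \<le> 2 / (\<kappa> * l)" unfolding st using Ale by simp
    show "sep_var \<le> 2 * B" using v AA Asq by linarith
    show "sep_var \<le> B + 2 / (\<kappa> * l)^2" using v AA' by simp
  qed (use e st A sep_mean_nonneg in auto)
  moreover have "continuous_tail l sep_mean sep_var (sep_continuous n K \<pi> 0)"
    unfolding continuous_tail_def Keq
  proof (intro conjI allI impI)
    fix a :: real assume "a > 0"
    then show "sep_continuous n kernel \<pi> 0 (sep_mean + a) \<le> (4 * sep_var + 2 * a) / a^2"
      using heat_tail_upper[of a] sep_mean_nonneg by (simp add: sep_continuous_eq)
  next
    fix a y :: real assume "a > 0" "0 \<le> y \<and> y \<le> sep_mean - a"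
    then show "1 - sep_continuous n kernel \<pi> 0 y \<le> 4 * sep_var / a^2"
      using heat_tail_lower[of a y] by (simp add: sep_continuous_eq)
  next
    fix y :: real assume "y > 0"
    then show "sep_continuous n kernel \<pi> 0 y \<le> sep_mean / y"
      using heat_tail_markov[of y] by (simp add: sep_continuous_eq)
  next
    fix y :: real assume "y \<ge> 0"
    then show "exp (- l * y) \<le> sep_continuous n kernel \<pi> 0 y"
      using heat_tail_ge_exp[of "1 / l" \<psi> y] e by (simp add: sep_continuous_eq mult.commute)
  qed
  moreover have "s = prob_space.expectation (P 0) (hitting_time X M) + prob_space.expectation (P n) (hitting_time X M)"
    unfolding P0.hitting_time_moments Pn.hitting_time_moments hit_total_eq[OF M] s ..
  moreover have "B - s = prob_space.variance (P 0) (hitting_time X M) + prob_space.variance (P n) (hitting_time X M)"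
    unfolding P0.hitting_time_moments(2) Pn.hitting_time_moments(2) s B
      hit_total_eq[OF M, symmetric] hit_var_left_eq[OF M, symmetric] hit_var_right_eq[OF M, symmetric]
    by simp
  moreover have mono: "monotone_bd_chain n p q \<pi>" if "\<forall>i<n. K $$ (i, Suc i) + K $$ (Suc i, i) \<le> 1"
  proof
    fix i assume "i < n"
    then show "p i + q (Suc i) \<le> 1" using that by (auto simp: Keq kernel_def)
  qed
  moreover have "s < B" if "\<forall>i<n. K $$ (i, Suc i) + K $$ (Suc i, i) \<le> 1"
    unfolding s B using monotone_bd_chain.mono_cond[OF mono[OF that]] by (intro hit_total_less_var[OF M])
  moreover have "discrete_tail l sep_mean sep_var (sep_discrete n K \<pi> 0)"
    if h: "\<forall>i<n. K $$ (i, Suc i) + K $$ (Suc i, i) \<le> 1"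
  proof -
    interpret monotone_bd_chain n p q \<pi> by (rule mono[OF h])
    show ?thesis
      unfolding discrete_tail_def Keq sep_discrete_eq
      using sep_tail_chebyshev sep_tail_markov sep_tail_ge_power[OF e(4,5,6,7)] by auto
  qed
  ultimately show thesis using that by blast
qed

section \<open>From moments to cutoffs\<close>

text \<open>The window bound and \<open>W / s \<longlonglongrightarrow> 0\<close> already contain the cutoff itself.\<close>

lemma window_cutoffI:
  assumes pos: "\<And>n. n \<ge> 1 \<Longrightarrow> s n > 0" "\<And>n. n \<ge> 1 \<Longrightarrow> W n > 0"
    and lim: "(\<lambda>n. W n / s n) \<longlonglongrightarrow> 0"
    and bound: "\<And>\<epsilon>. 0 < \<epsilon> \<Longrightarrow> \<epsilon> < 1 \<Longrightarrow> \<exists>C. \<forall>n\<ge>1. \<bar>T n \<epsilon> - s n\<bar> \<le> C * W n"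
  shows "has_window_cutoff T s W"
  unfolding has_window_cutoff_def has_cutoff_def
proof (intro conjI exI[of _ s] allI impI)
  fix \<epsilon> :: real assume e: "0 < \<epsilon> \<and> \<epsilon> < 1"
  then obtain C where C: "\<And>n. n \<ge> 1 \<Longrightarrow> \<bar>T n \<epsilon> - s n\<bar> \<le> C * W n" using bound by blast
  have "(\<lambda>n. T n \<epsilon> / s n - 1) \<longlonglongrightarrow> 0"
  proof (rule Lim_null_comparison)
    show "eventually (\<lambda>n. norm (T n \<epsilon> / s n - 1) \<le> C * (W n / s n)) sequentially"
      using eventually_ge_at_top[of 1]
    proof eventually_elim
      case (elim n)
      have "T n \<epsilon> / s n - 1 = (T n \<epsilon> - s n) / s n" using pos(1)[OF elim] by (simp add: field_simps)
      then have "norm (T n \<epsilon> / s n - 1) = \<bar>T n \<epsilon> - s n\<bar> / s n" using pos(1)[OF elim] by simp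
      also have "\<dots> \<le> C * W n / s n" using C[OF elim] pos(1)[OF elim] by (intro divide_right_mono) auto
      finally show ?case by simp
    qed
    show "(\<lambda>n. C * (W n / s n)) \<longlonglongrightarrow> 0" using tendsto_mult_right_zero[OF lim] .
  qed
  from tendsto_add[OF this tendsto_const[of 1]] show "(\<lambda>n. T n \<epsilon> / s n) \<longlonglongrightarrow> 1" by simp
  have "limsup (\<lambda>n. ereal (\<bar>T n \<epsilon> - s n\<bar> / W n)) \<le> ereal C"
  proof (rule Limsup_bounded)
    show "eventually (\<lambda>n. ereal (\<bar>T n \<epsilon> - s n\<bar> / W n) \<le> ereal C) sequentially"
      using eventually_ge_at_top[of 1]
      by eventually_elim (use C pos(2) in \<open>simp add: pos_divide_le_eq\<close>)
  qed
  then show "limsup (\<lambda>n. ereal (\<bar>T n \<epsilon> - s n\<bar> / W n)) < \<infinity>"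
    by (rule le_less_trans) simp
qed (use pos lim in auto)

text \<open>Under a cutoff \<open>T n \<epsilon>\<close> and \<open>T n (1/2)\<close> are asymptotically equal. If \<open>s * l \<le> B\<close> held infinitely often, then
for \<open>\<epsilon>\<close> so small that \<open>c ln (1/\<epsilon>) = 2 C B\<close> the former would be at least twice the bound on the latter.\<close>

lemma cutoff_imp_product_diverges:
  assumes cut: "has_cutoff T" and lpos: "\<And>n. n \<ge> 1 \<Longrightarrow> l n > 0" and c: "c > 0" "C > 0"
    and up: "\<And>n. n \<ge> 1 \<Longrightarrow> T n (1 / 2) \<le> C * s n"
    and low: "\<And>\<epsilon> B. 0 < \<epsilon> \<Longrightarrow> \<epsilon> < 1 \<Longrightarrow>
      eventually (\<lambda>n. s n * l n \<le> B \<longrightarrow> c * ln (1 / \<epsilon>) / l n \<le> T n \<epsilon>) sequentially"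
  shows "filterlim (\<lambda>n. s n * l n) at_top sequentially"
  unfolding filterlim_at_top
proof
  fix Z :: real
  \<comment> \<open>Working with \<open>B \<ge> 1\<close> makes \<open>\<epsilon>\<close> smaller than \<open>1\<close>.\<close>
  define B where "B = max Z 1"
  define \<epsilon> where "\<epsilon> = exp (- (2 * C * B / c))"
  have B: "B \<ge> 1" "B \<ge> Z" by (auto simp: B_def)
  have e: "0 < \<epsilon>" "\<epsilon> < 1" using c B by (auto simp: \<epsilon>_def)
  have lne: "c * ln (1 / \<epsilon>) = 2 * C * B" using c by (simp add: \<epsilon>_def ln_div)
  obtain u where u: "\<And>n. n \<ge> 1 \<Longrightarrow> u n > 0"
    "\<And>\<epsilon>. 0 < \<epsilon> \<Longrightarrow> \<epsilon> < 1 \<Longrightarrow> (\<lambda>n. T n \<epsilon> / u n) \<longlonglongrightarrow> 1"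
    using cut unfolding has_cutoff_def by blast
  have "eventually (\<lambda>n. T n \<epsilon> / u n < 5 / 4) sequentially"
    using u(2)[OF e] by (rule order_tendstoD) simp
  moreover have "eventually (\<lambda>n. T n (1 / 2) / u n > 3 / 4) sequentially"
    using u(2)[of "1 / 2"] by (rule order_tendstoD) simp_all
  ultimately show "eventually (\<lambda>n. Z \<le> s n * l n) sequentially"
    using low[OF e, of B] eventually_ge_at_top[of 1]
  proof eventually_elim
    case (elim n)
    have un: "u n > 0" and ln: "l n > 0" using u(1) lpos elim by auto
    have *: "T n \<epsilon> < 5 / 4 * u n" "3 / 4 * u n < T n (1 / 2)"
      using elim(1,2) un by (simp_all add: pos_divide_less_eq pos_less_divide_eq)
    then have less: "T n \<epsilon> < 2 * (C * s n)" using up[OF elim(4)] un by linarith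
    show ?case
    proof (rule ccontr)
      assume "\<not> ?thesis"
      then have le: "s n * l n \<le> B" using B by simp
      then have "2 * C * B / l n < 2 * (C * s n)" using elim(3) less lne by simp
      then have "2 * C * B < 2 * (C * s n) * l n" using ln by (simp only: pos_divide_less_eq)
      also have "\<dots> = 2 * C * (s n * l n)" by simp
      also have "\<dots> \<le> 2 * C * B" using le c by (intro mult_left_mono) auto
      finally show False by simp
    qed
  qed
qed

lemma product_imp_ratio_diverges:
  assumes k: "\<kappa> > 0" and pr: "\<And>n. n \<ge> 1 \<Longrightarrow> moment_profile n \<kappa> (l n) (s n) (B n) (t n) (v n)"
    and lim: "filterlim (\<lambda>n. s n * l n) at_top sequentially"
  shows "filterlim (\<lambda>n. s n / sqrt (B n)) at_top sequentially"
proof (rule filterlim_at_top_mono)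
  have "filterlim (\<lambda>n. \<kappa> / 2 * (s n * l n)) at_top sequentially"
    using k by (intro filterlim_tendsto_pos_mult_at_top[OF tendsto_const _ lim]) auto
  then show "filterlim (\<lambda>n. sqrt (\<kappa> / 2 * (s n * l n))) at_top sequentially"
    by (rule filterlim_compose[OF sqrt_at_top])
  show "eventually (\<lambda>n. sqrt (\<kappa> / 2 * (s n * l n)) \<le> s n / sqrt (B n)) sequentially"
    using eventually_ge_at_top[of 1]
  proof eventually_elim
    case (elim n)
    have p: "l n > 0" "s n \<ge> 1" "B n > 0" "B n \<le> 2 / (\<kappa> * l n) * s n"
      using pr[OF elim] elim by (auto simp: moment_profile_def)
    have "\<kappa> / 2 * (s n * l n) * B n \<le> \<kappa> / 2 * (s n * l n) * (2 / (\<kappa> * l n) * s n)"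
      using p k by (intro mult_left_mono) auto
    also have "\<dots> = (s n)^2" using p k by (simp add: power2_eq_square)
    finally have "\<kappa> / 2 * (s n * l n) \<le> (s n)^2 / B n" using p by (simp add: pos_le_divide_eq)
    then have "sqrt (\<kappa> / 2 * (s n * l n)) \<le> sqrt ((s n)^2 / B n)" by simp
    also have "\<dots> = s n / sqrt (B n)" using p by (simp add: real_sqrt_divide)
    finally show ?case .
  qed
qed

lemma ratio_inverse_null:
  assumes "filterlim (\<lambda>n. s n / b n) at_top sequentially"
  shows "(\<lambda>n. b n / s n :: real) \<longlonglongrightarrow> 0"
proof -
  have "(\<lambda>n. inverse (s n / b n)) \<longlonglongrightarrow> 0"
    by (rule filterlim_compose[OF tendsto_inverse_0_at_top[OF filterlim_ident] assms])
  then show ?thesis by simp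
qed

lemma continuous_time_le:
  assumes "y \<ge> 0" "d y \<le> \<epsilon>"
  shows "mixing_time_continuous d \<epsilon> \<le> y"
  unfolding mixing_time_continuous_def
  by (rule cInf_lower) (use assms in \<open>auto intro!: bdd_belowI[of _ 0]\<close>)

lemma continuous_time_ge:
  assumes "y0 \<ge> 0" "d y0 \<le> \<epsilon>" "\<And>y. y \<ge> 0 \<Longrightarrow> d y \<le> \<epsilon> \<Longrightarrow> x \<le> y"
  shows "x \<le> mixing_time_continuous d \<epsilon>"
  unfolding mixing_time_continuous_def
  by (rule cInf_greatest) (use assms in auto)

lemma continuous_reaches:
  assumes ct: "continuous_tail l t v d" and t: "t \<ge> 0" and e: "\<epsilon> > 0"
  shows "\<exists>y\<ge>0. d y \<le> \<epsilon>"
proof -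
  let ?y = "t / \<epsilon> + 1"
  have y: "?y > 0" using t e by (simp add: add_nonneg_pos)
  have "d ?y \<le> t / ?y" using ct y by (simp add: continuous_tail_def)
  also have "\<dots> \<le> \<epsilon>" using y e by (simp add: pos_divide_le_eq distrib_left)
  finally show ?thesis using y by (intro exI[of _ ?y]) auto
qed

lemma continuous_time_ge_log:
  assumes ct: "continuous_tail l t v d" and t: "t \<ge> 0" and l: "l > 0" and e: "0 < \<epsilon>"
  shows "ln (1 / \<epsilon>) / l \<le> mixing_time_continuous d \<epsilon>"
proof -
  obtain y0 where y0: "y0 \<ge> 0" "d y0 \<le> \<epsilon>" using continuous_reaches[OF ct t e] by blast
  show ?thesis
  proof (rule continuous_time_ge[of y0 d, OF y0])
    fix y assume y: "y \<ge> 0" "d y \<le> \<epsilon>"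
    have "exp (- l * y) \<le> \<epsilon>" using ct y by (auto simp: continuous_tail_def intro: order_trans)
    then have "- l * y \<le> ln \<epsilon>" using e by (simp add: ln_ge_iff)
    then have "ln (1 / \<epsilon>) \<le> y * l" using e by (simp add: ln_div mult.commute)
    then show "ln (1 / \<epsilon>) / l \<le> y" using l by (simp add: pos_divide_le_eq)
  qed
qed

text \<open>Chebyshev at distance \<open>\<alpha> sqrt B\<close> from the mean. The bounds \<open>(8 + 2 \<alpha>)/\<alpha>^2\<close> and \<open>8/\<alpha>^2\<close> that result are at most
\<open>\<epsilon>\<close> and less than \<open>1 - \<epsilon>\<close> because \<open>\<alpha>\<close> is at least \<open>10/\<epsilon>\<close>, \<open>10/(1 - \<epsilon>)\<close> and \<open>10\<close>.\<close>

lemma continuous_time_window: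
  assumes ct: "continuous_tail l t v d" and pr: "moment_profile n \<kappa> l s B t v" and n: "n \<ge> 1"
    and e: "0 < \<epsilon>" "\<epsilon> < 1" and \<alpha>: "\<alpha> = 10 / \<epsilon> + 10 / (1 - \<epsilon>)"
  shows "\<bar>mixing_time_continuous d \<epsilon> - s\<bar> \<le> (\<alpha> + 2) * sqrt B"
proof -
  define b where "b = sqrt B"
  have p: "s \<ge> 1" "B \<ge> 1" "0 \<le> t" "t \<le> s" "(s - t)^2 \<le> 2 * B" "v \<le> 2 * B"
    using pr n by (auto simp: moment_profile_def)
  have b: "b \<ge> 1" "b^2 = B" using p by (auto simp: b_def)
  have a1: "10 / \<epsilon> \<le> \<alpha>" "10 / (1 - \<epsilon>) \<le> \<alpha>" using e \<alpha> by auto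
  have a2: "\<alpha> \<ge> 10"
  proof -
    have "10 \<le> 10 / \<epsilon>" using e by (simp add: pos_le_divide_eq)
    then show ?thesis using a1 by simp
  qed
  have a3: "10 \<le> \<alpha> * \<epsilon>" "10 \<le> \<alpha> * (1 - \<epsilon>)" using a1 e by (simp_all add: pos_divide_le_eq)
  have ab: "\<alpha> * b > 0" using a2 b by simp
  have up: "d (t + \<alpha> * b) \<le> \<epsilon>"
  proof -
    have "d (t + \<alpha> * b) \<le> (4 * v + 2 * (\<alpha> * b)) / (\<alpha> * b)^2"
      using ct ab by (simp add: continuous_tail_def)
    also have "\<dots> \<le> ((8 + 2 * \<alpha>) * b^2) / (\<alpha> * b)^2"
    proof (rule divide_right_mono)
      have "b \<le> b^2" using b(1) by (simp add: power2_eq_square)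
      then have "\<alpha> * b \<le> \<alpha> * b^2" using a2 by (intro mult_left_mono) auto
      then show "4 * v + 2 * (\<alpha> * b) \<le> (8 + 2 * \<alpha>) * b^2"
        using p(6) b(2) by (simp add: distrib_right)
    qed simp
    also have "\<dots> = (8 + 2 * \<alpha>) / \<alpha>^2" using b(1) by (simp add: power_mult_distrib)
    also have "\<dots> \<le> \<epsilon>"
    proof -
      have "10 * \<alpha> \<le> (\<alpha> * \<epsilon>) * \<alpha>" using a3 a2 by (intro mult_right_mono) auto
      moreover have "\<epsilon> * \<alpha>^2 = (\<alpha> * \<epsilon>) * \<alpha>" by (simp add: power2_eq_square)
      ultimately have "8 + 2 * \<alpha> \<le> \<epsilon> * \<alpha>^2" using a2 by linarith
      then show ?thesis using a2 by (simp add: pos_divide_le_eq)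
    qed
    finally show ?thesis .
  qed
  have low: "\<epsilon> < d y" if y: "0 \<le> y" "y \<le> t - \<alpha> * b" for y
  proof -
    have "1 - d y \<le> 4 * v / (\<alpha> * b)^2" using ct ab y by (simp add: continuous_tail_def)
    also have "\<dots> \<le> 8 * b^2 / (\<alpha> * b)^2" using p(6) b(2) by (intro divide_right_mono) auto
    also have "\<dots> = 8 / \<alpha>^2" using b(1) by (simp add: power_mult_distrib)
    also have "\<dots> < 1 - \<epsilon>"
    proof -
      have "10 * \<alpha> \<le> (\<alpha> * (1 - \<epsilon>)) * \<alpha>" using a3 a2 by (intro mult_right_mono) auto
      moreover have "(1 - \<epsilon>) * \<alpha>^2 = (\<alpha> * (1 - \<epsilon>)) * \<alpha>" by (simp add: power2_eq_square)
      ultimately have "8 < (1 - \<epsilon>) * \<alpha>^2" using a2 by linarith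
      then show ?thesis using a2 by (simp add: pos_divide_less_eq)
    qed
    finally show ?thesis by simp
  qed
  have y0: "t + \<alpha> * b \<ge> 0" using p ab by simp
  have "mixing_time_continuous d \<epsilon> \<le> t + \<alpha> * b" by (rule continuous_time_le[of _ d, OF y0 up])
  moreover have "t - \<alpha> * b \<le> mixing_time_continuous d \<epsilon>"
  proof (rule continuous_time_ge[of _ d, OF y0 up])
    fix y assume "y \<ge> 0" "d y \<le> \<epsilon>"
    then show "t - \<alpha> * b \<le> y" using low[of y] by linarith
  qed
  moreover have "s - t \<le> 2 * b"
  proof (rule power2_le_imp_le)
    show "(s - t)^2 \<le> (2 * b)^2" using p b by (simp add: power_mult_distrib)
  qed (use b in simp)
  ultimately show ?thesis unfolding b_def[symmetric] using p(4) by (simp add: distrib_right abs_le_iff)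
qed

lemma discrete_time_le:
  assumes "d m \<le> \<epsilon>"
  shows "mixing_time_discrete d \<epsilon> \<le> real m"
  unfolding mixing_time_discrete_def using assms by (simp add: Least_le)

lemma discrete_time_ge:
  assumes "d m0 \<le> \<epsilon>" "\<And>m. d m \<le> \<epsilon> \<Longrightarrow> x \<le> real m"
  shows "x \<le> mixing_time_discrete d \<epsilon>"
  unfolding mixing_time_discrete_def using LeastI[of "\<lambda>m. d m \<le> \<epsilon>", OF assms(1)] assms(2) by blast

lemma discrete_reaches:
  assumes dt: "discrete_tail l t v d" and e: "\<epsilon> > 0"
  shows "d (nat \<lceil>t / \<epsilon>\<rceil>) \<le> \<epsilon>"
proof -
  let ?m = "nat \<lceil>t / \<epsilon>\<rceil>"
  have "t / \<epsilon> \<le> real ?m" by linarith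
  then have "t \<le> \<epsilon> * (real ?m + 1)" using e by (simp add: pos_divide_le_eq distrib_left mult.commute)
  moreover have "d ?m \<le> t / (real ?m + 1)" using dt by (simp add: discrete_tail_def)
  moreover have "t / (real ?m + 1) \<le> \<epsilon>"
    using calculation(1) by (subst pos_divide_le_eq) auto
  ultimately show ?thesis by linarith
qed

lemma exp_le_one_minus:
  fixes x :: real
  assumes "0 \<le> x" "x \<le> 1 / 2"
  shows "exp (- (2 * x)) \<le> 1 - x"
proof -
  have "1 \<le> (1 - x) * (1 + 2 * x)"
  proof -
    have "x * (1 - 2 * x) \<ge> 0" using assms by (intro mult_nonneg_nonneg) auto
    then show ?thesis by (simp add: algebra_simps)
  qed
  also have "\<dots> \<le> (1 - x) * exp (2 * x)"
    using assms exp_ge_add_one_self[of "2 * x"] by (intro mult_left_mono) auto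
  finally have "1 * exp (- (2 * x)) \<le> (1 - x) * exp (2 * x) * exp (- (2 * x))"
    by (intro mult_right_mono) auto
  then show ?thesis by (simp add: mult.assoc exp_add[symmetric])
qed

lemma discrete_time_ge_log:
  assumes dt: "discrete_tail l t v d" and l: "0 < l" "l \<le> 1 / 2" and e: "0 < \<epsilon>"
  shows "1 / 2 * ln (1 / \<epsilon>) / l \<le> mixing_time_discrete d \<epsilon>"
proof (rule discrete_time_ge[of d, OF discrete_reaches[OF dt e]])
  fix m assume m: "d m \<le> \<epsilon>"
  have "exp (- (2 * l)) ^ m \<le> (1 - l) ^ m" using exp_le_one_minus[of l] l by (intro power_mono) auto
  also have "\<dots> \<le> d m" using dt by (simp add: discrete_tail_def)
  finally have "exp (real m * - (2 * l)) \<le> \<epsilon>" using m unfolding exp_of_nat_mult by simp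
  then have "real m * - (2 * l) \<le> ln \<epsilon>" using e by (simp add: ln_ge_iff)
  then have "ln (1 / \<epsilon>) \<le> 2 * (real m * l)" using e by (simp add: ln_div)
  then show "1 / 2 * ln (1 / \<epsilon>) / l \<le> real m" using l by (simp add: pos_divide_le_eq)
qed

text \<open>Chebyshev at distance \<open>\<alpha> W\<close> from the mean, where \<open>W\<close> is the window. The constant \<open>E\<close> is chosen so that the
variance \<open>v - t\<close> is at most \<open>E * W^2\<close>; rounding up to an integer costs one step, which is at most \<open>2 * W\<close>
because \<open>l \<le> 2\<close>.\<close>

lemma discrete_time_window:
  assumes dt: "discrete_tail l t v d" and pr: "moment_profile n \<kappa> l s B t v" and k: "\<kappa> > 0"
    and e: "0 < \<epsilon>" "\<epsilon> < 1" and E: "E = 1 + 2 / \<kappa>^2 + 4 / \<kappa>" and \<alpha>: "\<alpha> = 2 * E / \<epsilon> + 2 * E / (1 - \<epsilon>)"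
  shows "\<bar>mixing_time_discrete d \<epsilon> - s\<bar> \<le> (\<alpha> + 2 + 2 / \<kappa>) * max (sqrt (B - s)) (1 / l)"
proof -
  define W where "W = max (sqrt (B - s)) (1 / l)"
  have p: "0 < l" "l \<le> 2" "s \<le> B" "0 \<le> t" "t \<le> s" "s - t \<le> 2 / (\<kappa> * l)" "v \<le> B + 2 / (\<kappa> * l)^2"
    using pr by (auto simp: moment_profile_def)
  have W1: "1 / l \<le> W" "sqrt (B - s) \<le> W" by (auto simp: W_def)
  have "1 / 2 \<le> 1 / l" using p by (simp add: field_simps)
  then have W2: "1 / 2 \<le> W" using W1 by linarith
  have W: "W > 0" using W2 by simp
  have st: "s - t \<le> 2 / \<kappa> * W"
  proof -
    have "2 / (\<kappa> * l) = 2 / \<kappa> * (1 / l)" by simp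
    also have "\<dots> \<le> 2 / \<kappa> * W" using W1 k by (intro mult_left_mono) auto
    finally show ?thesis using p by linarith
  qed
  have var: "v - t \<le> E * W^2"
  proof -
    have "B - s \<le> W^2" using power_mono[OF W1(2), of 2] p by simp
    moreover have "2 / (\<kappa> * l)^2 \<le> 2 / \<kappa>^2 * W^2"
    proof -
      have "(1 / l)^2 \<le> W^2" using W1 p by (intro power_mono) auto
      then have "2 / \<kappa>^2 * (1 / l)^2 \<le> 2 / \<kappa>^2 * W^2" by (intro mult_left_mono) auto
      then show ?thesis by (simp add: power_divide power_mult_distrib)
    qed
    moreover have "s - t \<le> 4 / \<kappa> * W^2"
    proof -
      have "W \<le> 2 * W^2" using W2 by (simp add: power2_eq_square)
      then have "2 / \<kappa> * W \<le> 2 / \<kappa> * (2 * W^2)" using k by (intro mult_left_mono) auto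
      then show ?thesis using st by simp
    qed
    ultimately show ?thesis using p(7) unfolding E distrib_right by linarith
  qed
  have E1: "E \<ge> 1" using k by (simp add: E)
  have a1: "2 * E / \<epsilon> \<le> \<alpha>" "2 * E / (1 - \<epsilon>) \<le> \<alpha>" using e \<alpha> E1 by auto
  have a3: "2 * E \<le> \<alpha> * \<epsilon>" "2 * E \<le> \<alpha> * (1 - \<epsilon>)" using a1 e by (simp_all add: pos_divide_le_eq)
  have a2: "\<alpha> \<ge> 1"
  proof -
    have "1 \<le> 2 * E / \<epsilon>" using e E1 by (simp add: pos_le_divide_eq)
    then show ?thesis using a1 by simp
  qed
  have aW: "\<alpha> * W > 0" using a2 W by simp
  have q: "(v - t) / (\<alpha> * W)^2 \<le> E / \<alpha>"
  proof -
    have "(v - t) / (\<alpha> * W)^2 \<le> E * W^2 / (\<alpha> * W)^2" using var by (intro divide_right_mono) auto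
    also have "\<dots> = E / \<alpha>^2" using W by (simp add: power_mult_distrib)
    also have "\<dots> \<le> E / \<alpha>" using a2 E1 by (intro divide_left_mono) (auto simp: power2_eq_square)
    finally show ?thesis .
  qed
  have qe: "E / \<alpha> \<le> \<epsilon>" "E / \<alpha> < 1 - \<epsilon>"
    using a3 a2 E1 by (simp_all add: pos_divide_le_eq pos_divide_less_eq mult.commute)
  let ?m = "nat \<lceil>t + \<alpha> * W\<rceil>"
  have m: "t + \<alpha> * W \<le> real ?m" "real ?m \<le> t + \<alpha> * W + 1" using p aW by linarith+
  have up: "d ?m \<le> \<epsilon>"
  proof -
    have "d ?m \<le> (v - t) / (\<alpha> * W)^2" using dt aW m by (simp add: discrete_tail_def)
    then show ?thesis using q qe by linarith
  qed
  have "mixing_time_discrete d \<epsilon> \<le> t + \<alpha> * W + 1"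
    using discrete_time_le[of d ?m \<epsilon>, OF up] m by linarith
  moreover have "t - \<alpha> * W \<le> mixing_time_discrete d \<epsilon>"
  proof (rule discrete_time_ge[of d, OF up])
    fix m assume dm: "d m \<le> \<epsilon>"
    show "t - \<alpha> * W \<le> real m"
    proof (rule ccontr)
      assume "\<not> ?thesis"
      then have "1 - d m \<le> (v - t) / (\<alpha> * W)^2" using dt aW by (simp add: discrete_tail_def)
      then show False using q qe dm by linarith
    qed
  qed
  ultimately show ?thesis
    unfolding W_def[symmetric] distrib_right using W2 st p(5) by (simp add: abs_le_iff)
qed

text \<open>\<open>B / s^2 = (B - s) / s^2 + 1 / s\<close>, and \<open>1 / s\<close> tends to zero.\<close>

lemma ratio_equivalence:
  assumes s: "\<And>n. n \<ge> 1 \<Longrightarrow> real n \<le> s n" and B: "\<And>n. n \<ge> 1 \<Longrightarrow> s n < B n"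
  shows "filterlim (\<lambda>n. s n / sqrt (B n - s n)) at_top sequentially \<longleftrightarrow>
    filterlim (\<lambda>n. s n / sqrt (B n)) at_top sequentially"
proof
  assume lim: "filterlim (\<lambda>n. s n / sqrt (B n)) at_top sequentially"
  show "filterlim (\<lambda>n. s n / sqrt (B n - s n)) at_top sequentially"
  proof (rule filterlim_at_top_mono[OF lim])
    show "eventually (\<lambda>n. s n / sqrt (B n) \<le> s n / sqrt (B n - s n)) sequentially"
      using eventually_ge_at_top[of 1]
    proof eventually_elim
      case (elim n)
      then have "s n \<ge> 1" "s n < B n" using s[OF elim] B[OF elim] by auto
      then show ?case by (intro divide_left_mono) auto
    qed
  qed
next
  assume lim: "filterlim (\<lambda>n. s n / sqrt (B n - s n)) at_top sequentially"
  show "filterlim (\<lambda>n. s n / sqrt (B n)) at_top sequentially"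
    unfolding filterlim_at_top
  proof
    fix Z0 :: real
    define Z where "Z = max Z0 1"
    have Z: "Z \<ge> 1" "Z \<ge> Z0" by (auto simp: Z_def)
    have "eventually (\<lambda>n. 2 * Z \<le> s n / sqrt (B n - s n)) sequentially"
      using lim unfolding filterlim_at_top by blast
    moreover have "eventually (\<lambda>n. 2 * Z^2 \<le> real n) sequentially"
      using filterlim_real_sequentially unfolding filterlim_at_top by blast
    ultimately show "eventually (\<lambda>n. Z0 \<le> s n / sqrt (B n)) sequentially"
      using eventually_ge_at_top[of 1]
    proof eventually_elim
      case (elim n)
      have p: "s n \<ge> 1" "B n - s n > 0" "2 * Z^2 \<le> s n"
        using s[OF elim(3)] B[OF elim(3)] elim by auto
      have "2 * Z * sqrt (B n - s n) \<le> s n" using elim(1) p by (simp add: pos_le_divide_eq)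
      then have "(2 * Z * sqrt (B n - s n))^2 \<le> (s n)^2" using Z p by (intro power_mono) auto
      then have 1: "4 * (Z^2 * (B n - s n)) \<le> (s n)^2" using p by (simp add: power_mult_distrib)
      have 2: "2 * Z^2 * s n \<le> (s n)^2"
        unfolding power2_eq_square[of "s n"] using p by (intro mult_right_mono) auto
      have "Z^2 * B n \<le> (s n)^2"
        using 1 2 by (simp add: right_diff_distrib) (use zero_le_power2[of "s n"] in linarith)
      then have "sqrt (Z^2 * B n) \<le> s n" using p by (intro real_le_lsqrt) auto
      then have "Z * sqrt (B n) \<le> s n" using Z by (simp add: real_sqrt_mult)
      then show ?case using p Z by (simp add: pos_le_divide_eq order_trans[OF mult_right_mono[of Z0 Z]])
    qed
  qed
qed

section \<open>The cutoff criterion\<close>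

theorem theorem1p3:
  fixes K :: "nat \<Rightarrow> real mat" and \<pi> :: "nat \<Rightarrow> nat \<Rightarrow> real" and M :: "nat \<Rightarrow> nat"
    and P :: "nat \<Rightarrow> nat \<Rightarrow> 'a measure"
    and X :: "nat \<Rightarrow> nat \<Rightarrow> 'a \<Rightarrow> nat" and N :: "nat \<Rightarrow> real \<Rightarrow> 'a \<Rightarrow> nat"
    and lam s b c :: "nat \<Rightarrow> real"
  assumes "\<And>n. n \<ge> 1 \<Longrightarrow> birth_death n (K n)"
    and "\<And>n. n \<ge> 1 \<Longrightarrow> irreducible_matrix (K n)"
    and "\<And>n. n \<ge> 1 \<Longrightarrow> stationary n (K n) (\<pi> n)"
    and "\<And>n. n \<ge> 1 \<Longrightarrow> lam n = spectral_gap n (K n)"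
    and "\<And>n j. n \<ge> 1 \<Longrightarrow> j \<le> n \<Longrightarrow> realizes_chain (P n j) n (K n) j (X n) (N n)"
    and "\<And>n. n \<ge> 1 \<Longrightarrow> M n \<le> n"
    and "\<And>n. n \<ge> 1 \<Longrightarrow>
      s n = prob_space.expectation (P n 0) (hitting_time_continuous (X n) (N n) (M n))
          + prob_space.expectation (P n n) (hitting_time_continuous (X n) (N n) (M n))"
    and "\<And>n. n \<ge> 1 \<Longrightarrow>
      b n = sqrt (prob_space.variance (P n 0) (hitting_time_continuous (X n) (N n) (M n))
                + prob_space.variance (P n n) (hitting_time_continuous (X n) (N n) (M n)))"
    and "\<And>n. n \<ge> 1 \<Longrightarrow>
      c n = sqrt (prob_space.variance (P n 0) (hitting_time (X n) (M n))
                + prob_space.variance (P n n) (hitting_time (X n) (M n)))"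
    and "(INF n\<in>{1..}. \<Sum>x\<in>{0..M n}. \<pi> n x) > 0"
    and "(INF n\<in>{1..}. \<Sum>x\<in>{M n..n}. \<pi> n x) > 0"
  defines "Tc \<equiv> \<lambda>n. mixing_time_continuous (sep_continuous n (K n) (\<pi> n) 0)"
    and "Td \<equiv> \<lambda>n. mixing_time_discrete (sep_discrete n (K n) (\<pi> n) 0)"
  shows
    "(\<forall>n\<ge>1. s n = prob_space.expectation (P n 0) (hitting_time (X n) (M n))
                 + prob_space.expectation (P n n) (hitting_time (X n) (M n))) \<and>
     (has_cutoff Tc \<longleftrightarrow> filterlim (\<lambda>n. s n * lam n) at_top sequentially) \<and>
     (has_cutoff Tc \<longleftrightarrow> filterlim (\<lambda>n. s n / b n) at_top sequentially) \<and>
     (filterlim (\<lambda>n. s n / b n) at_top sequentially \<longrightarrow> has_window_cutoff Tc s b) \<and>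
     ((\<forall>n\<ge>1. \<forall>i<n. K n $$ (i, Suc i) + K n $$ (Suc i, i) \<le> 1) \<longrightarrow>
        (has_cutoff Td \<longleftrightarrow> filterlim (\<lambda>n. s n * lam n) at_top sequentially) \<and>
        (has_cutoff Td \<longleftrightarrow> filterlim (\<lambda>n. s n / c n) at_top sequentially) \<and>
        (filterlim (\<lambda>n. s n / c n) at_top sequentially \<longrightarrow>
           has_window_cutoff Td s (\<lambda>n. max (c n) (1 / lam n))))"
proof -
  define \<kappa> where "\<kappa> = min (INF n\<in>{1..}. \<Sum>x\<in>{0..M n}. \<pi> n x) (INF n\<in>{1..}. \<Sum>x\<in>{M n..n}. \<pi> n x)"
  have k: "\<kappa> > 0" using assms(10,11) by (simp add: \<kappa>_def)
  have pi0: "\<pi> n x \<ge> 0" if "n \<ge> 1" "x \<le> n" for n x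
    using assms(3)[OF that(1)] that(2) by (simp add: stationary_def)
  have INF_le: "(INF n\<in>{1..}. \<Sum>x\<in>S n. \<pi> n x) \<le> (\<Sum>x\<in>S n. \<pi> n x)"
    if S: "\<And>n. n \<ge> 1 \<Longrightarrow> S n \<subseteq> {..n}" and n: "n \<ge> 1" for S n
  proof (rule cINF_lower)
    show "bdd_below ((\<lambda>n. \<Sum>x\<in>S n. \<pi> n x) ` {1..})"
    proof (rule bdd_belowI2[of _ 0])
      fix m :: nat assume "m \<in> {1..}"
      then have m: "m \<ge> 1" by simp
      show "0 \<le> (\<Sum>x\<in>S m. \<pi> m x)"
      proof (rule sum_nonneg)
        fix x assume "x \<in> S m"
        then have "x \<le> m" using S[OF m] by auto
        then show "0 \<le> \<pi> m x" by (rule pi0[OF m])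
      qed
    qed
  qed (use n in simp)
  have k1: "\<kappa> \<le> (\<Sum>x\<in>{0..M n}. \<pi> n x)" if n: "n \<ge> 1" for n
  proof -
    have "{0..M n} \<subseteq> {..n}" if "n \<ge> 1" for n using assms(6)[OF that] by auto
    from INF_le[of "\<lambda>n. {0..M n}", OF this n] show ?thesis by (simp add: \<kappa>_def min.coboundedI1)
  qed
  have k2: "\<kappa> \<le> (\<Sum>x\<in>{M n..n}. \<pi> n x)" if n: "n \<ge> 1" for n
  proof -
    have "{M n..n} \<subseteq> {..n}" for n by auto
    from INF_le[of "\<lambda>n. {M n..n}", OF this n] show ?thesis by (simp add: \<kappa>_def min.coboundedI2)
  qed
  define B where "B n = prob_space.variance (P n 0) (hitting_time_continuous (X n) (N n) (M n))
                + prob_space.variance (P n n) (hitting_time_continuous (X n) (N n) (M n))" for n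
  let ?mono = "\<lambda>n. \<forall>i<n. K n $$ (i, Suc i) + K n $$ (Suc i, i) \<le> 1"
  let ?dc = "\<lambda>n. sep_continuous n (K n) (\<pi> n) 0" and ?dd = "\<lambda>n. sep_discrete n (K n) (\<pi> n) 0"
  have "\<exists>tv. n \<ge> 1 \<longrightarrow> moment_profile n \<kappa> (lam n) (s n) (B n) (fst tv) (snd tv) \<and>
      continuous_tail (lam n) (fst tv) (snd tv) (?dc n) \<and>
      s n = prob_space.expectation (P n 0) (hitting_time (X n) (M n))
          + prob_space.expectation (P n n) (hitting_time (X n) (M n)) \<and>
      c n = sqrt (B n - s n) \<and>
      (?mono n \<longrightarrow> s n < B n \<and> discrete_tail (lam n) (fst tv) (snd tv) (?dd n))" for n
  proof (cases "n \<ge> 1")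
    case n: True
    obtain t v where tv: "moment_profile n \<kappa> (lam n) (s n) (B n) t v" "continuous_tail (lam n) t v (?dc n)"
      "s n = prob_space.expectation (P n 0) (hitting_time (X n) (M n)) + prob_space.expectation (P n n) (hitting_time (X n) (M n))"
      "B n - s n = prob_space.variance (P n 0) (hitting_time (X n) (M n)) + prob_space.variance (P n n) (hitting_time (X n) (M n))"
      "?mono n \<Longrightarrow> s n < B n" "?mono n \<Longrightarrow> discrete_tail (lam n) t v (?dd n)"
      using chain_profile[OF n assms(1-3)[OF n] assms(6)[OF n], of "P n" "X n" "N n" \<kappa>]
        assms(5)[OF n] k k1[OF n] k2[OF n]
      unfolding assms(4)[OF n] assms(7)[OF n] B_def by blast
    have "c n = sqrt (B n - s n)" unfolding assms(9)[OF n] tv(4) ..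
    then show ?thesis using tv by (intro exI[of _ "(t, v)"]) auto
  qed auto
  then obtain tv where tv: "\<And>n. n \<ge> 1 \<Longrightarrow> moment_profile n \<kappa> (lam n) (s n) (B n) (fst (tv n)) (snd (tv n)) \<and>
      continuous_tail (lam n) (fst (tv n)) (snd (tv n)) (?dc n) \<and>
      s n = prob_space.expectation (P n 0) (hitting_time (X n) (M n))
          + prob_space.expectation (P n n) (hitting_time (X n) (M n)) \<and>
      c n = sqrt (B n - s n) \<and>
      (?mono n \<longrightarrow> s n < B n \<and> discrete_tail (lam n) (fst (tv n)) (snd (tv n)) (?dd n))"
    by metis
  define t v where "t n = fst (tv n)" and "v n = snd (tv n)" for n
  have pr: "moment_profile n \<kappa> (lam n) (s n) (B n) (t n) (v n)"
    and ct: "continuous_tail (lam n) (t n) (v n) (?dc n)"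
    and cB: "c n = sqrt (B n - s n)"
    if "n \<ge> 1" for n
    using tv[OF that] unfolding t_def v_def by blast+
  have bB: "b n = sqrt (B n)" if "n \<ge> 1" for n
    using assms(8)[OF that] by (simp only: B_def)
  have p: "lam n > 0" "s n \<ge> real n" "s n \<le> B n" "0 \<le> t n" "t n \<le> s n" "s n \<ge> 1" if "n \<ge> 1" for n
    using pr[OF that] that by (auto simp: moment_profile_def)
  have bcong: "filterlim (\<lambda>n. s n / b n) at_top sequentially \<longleftrightarrow> filterlim (\<lambda>n. s n / sqrt (B n)) at_top sequentially"
    by (intro filterlim_cong refl eventually_mono[OF eventually_ge_at_top[of 1]]) (simp add: bB)
  have ccong: "filterlim (\<lambda>n. s n / c n) at_top sequentially \<longleftrightarrow> filterlim (\<lambda>n. s n / sqrt (B n - s n)) at_top sequentially"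
    by (intro filterlim_cong refl eventually_mono[OF eventually_ge_at_top[of 1]]) (simp add: cB)
  have cont_product: "filterlim (\<lambda>n. s n * lam n) at_top sequentially" if "has_cutoff Tc"
  proof (rule cutoff_imp_product_diverges[OF that, of _ 1 2])
    show "Tc n (1 / 2) \<le> 2 * s n" if n: "n \<ge> 1" for n
      unfolding Tc_def
    proof (rule continuous_time_le)
      have "?dc n (2 * s n) \<le> t n / (2 * s n)"
        using ct[OF n] p[OF n] by (simp add: continuous_tail_def)
      also have "\<dots> \<le> 1 / 2" using p[OF n] by (simp add: divide_le_eq)
      finally show "?dc n (2 * s n) \<le> 1 / 2" .
    qed (use p[OF n] in simp)
    show "eventually (\<lambda>n. s n * lam n \<le> B \<longrightarrow> 1 * ln (1 / \<epsilon>) / lam n \<le> Tc n \<epsilon>) sequentially"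
      if "0 < \<epsilon>" "\<epsilon> < 1" for \<epsilon> B
      using eventually_ge_at_top[of 1]
      by eventually_elim (use continuous_time_ge_log[OF ct p(4) p(1)] that in \<open>simp add: Tc_def\<close>)
  qed (use p in auto)
  have product_ratio: "filterlim (\<lambda>n. s n / b n) at_top sequentially"
    if "filterlim (\<lambda>n. s n * lam n) at_top sequentially"
    unfolding bcong by (rule product_imp_ratio_diverges[OF k pr that])
  have cont_window: "has_window_cutoff Tc s b" if "filterlim (\<lambda>n. s n / b n) at_top sequentially"
  proof (rule window_cutoffI[OF _ _ ratio_inverse_null[OF that]])
    show "\<exists>C. \<forall>n\<ge>1. \<bar>Tc n \<epsilon> - s n\<bar> \<le> C * b n" if "0 < \<epsilon>" "\<epsilon> < 1" for \<epsilon>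
      using continuous_time_window[OF ct pr _ that refl] bB unfolding Tc_def by metis
    show "s n > 0" "b n > 0" if "n \<ge> 1" for n using p[OF that] bB[OF that] by auto
  qed
  have window_cutoff: "has_cutoff T" if "has_window_cutoff T s W" for T W
    using that by (simp add: has_window_cutoff_def)
  have disc: "(has_cutoff Td \<longleftrightarrow> filterlim (\<lambda>n. s n * lam n) at_top sequentially) \<and>
        (has_cutoff Td \<longleftrightarrow> filterlim (\<lambda>n. s n / c n) at_top sequentially) \<and>
        (filterlim (\<lambda>n. s n / c n) at_top sequentially \<longrightarrow>
           has_window_cutoff Td s (\<lambda>n. max (c n) (1 / lam n)))"
    if mono: "\<forall>n\<ge>1. ?mono n"
  proof -
    have dt: "discrete_tail (lam n) (t n) (v n) (?dd n)" and sB: "s n < B n" if "n \<ge> 1" for n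
      using tv[OF that] mono that unfolding t_def v_def by blast+
    have ratio: "filterlim (\<lambda>n. s n / c n) at_top sequentially \<longleftrightarrow> filterlim (\<lambda>n. s n / b n) at_top sequentially"
      unfolding ccong bcong by (rule ratio_equivalence[OF p(2) sB])
    have disc_product: "filterlim (\<lambda>n. s n * lam n) at_top sequentially" if "has_cutoff Td"
    proof (rule cutoff_imp_product_diverges[OF that, of _ "1 / 2" 3])
      show "Td n (1 / 2) \<le> 3 * s n" if n: "n \<ge> 1" for n
      proof -
        have "?dd n (nat \<lceil>t n / (1 / 2)\<rceil>) \<le> 1 / 2"
          by (rule discrete_reaches[OF dt[OF n]]) simp
        then have "Td n (1 / 2) \<le> real (nat \<lceil>t n / (1 / 2)\<rceil>)"
          unfolding Td_def by (rule discrete_time_le[of "?dd n"])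
        moreover have "real (nat \<lceil>t n / (1 / 2)\<rceil>) \<le> 2 * t n + 1"
        proof -
          have eq: "t n / (1 / 2) = 2 * t n" by simp
          show ?thesis unfolding eq using p(4)[OF n] by linarith
        qed
        ultimately show ?thesis using p[OF n] by linarith
      qed
      show "eventually (\<lambda>n. s n * lam n \<le> B \<longrightarrow> 1 / 2 * ln (1 / \<epsilon>) / lam n \<le> Td n \<epsilon>) sequentially"
        if e: "0 < \<epsilon>" "\<epsilon> < 1" for \<epsilon> B
      proof -
        have "eventually (\<lambda>n. 2 * B \<le> real n) sequentially"
          using filterlim_real_sequentially unfolding filterlim_at_top by blast
        then show ?thesis using eventually_ge_at_top[of 1]
        proof eventually_elim
          case (elim n)
          show ?case
          proof
            assume le: "s n * lam n \<le> B"
            have "0 < s n * lam n" using p(1,6)[OF elim(2)] by (intro mult_pos_pos) auto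
            then have B: "B > 0" using le by linarith
            have "lam n * (2 * B) \<le> lam n * s n"
              using elim p(1,2)[OF elim(2)] by (intro mult_left_mono) auto
            also have "\<dots> \<le> B" using le by (simp add: mult.commute)
            finally have "(2 * lam n) * B \<le> 1 * B" by (simp only: mult_ac mult_1_left mult_1_right)
            then have "2 * lam n \<le> 1" using B by (simp only: mult_le_cancel_right_pos)
            then have "lam n \<le> 1 / 2" by simp
            from discrete_time_ge_log[OF dt[OF elim(2)] p(1)[OF elim(2)] this e(1)]
            show "1 / 2 * ln (1 / \<epsilon>) / lam n \<le> Td n \<epsilon>" by (simp only: Td_def)
          qed
        qed
      qed
    qed (use p in auto)
    have disc_window: "has_window_cutoff Td s (\<lambda>n. max (c n) (1 / lam n))"
      if lim: "filterlim (\<lambda>n. s n * lam n) at_top sequentially"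
    proof (rule window_cutoffI)
      show "s n > 0" "max (c n) (1 / lam n) > 0" if "n \<ge> 1" for n
        using p[OF that] by (auto simp: less_max_iff_disj)
      show "\<exists>C. \<forall>n\<ge>1. \<bar>Td n \<epsilon> - s n\<bar> \<le> C * max (c n) (1 / lam n)" if "0 < \<epsilon>" "\<epsilon> < 1" for \<epsilon>
        using discrete_time_window[OF dt pr k that refl refl] cB unfolding Td_def by metis
      have c0: "(\<lambda>n. c n / s n) \<longlonglongrightarrow> 0"
        by (rule ratio_inverse_null) (use product_ratio[OF lim] ratio in blast)
      have "(\<lambda>n. 1 / lam n / s n) \<longlonglongrightarrow> 0"
        using tendsto_inverse_0_at_top[OF lim] by (simp add: divide_inverse mult.commute)
      with c0 have "(\<lambda>n. max (c n / s n) (1 / lam n / s n)) \<longlonglongrightarrow> max 0 0"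
        by (rule tendsto_max)
      moreover have "eventually (\<lambda>n. max (c n / s n) (1 / lam n / s n) = max (c n) (1 / lam n) / s n) sequentially"
        using eventually_ge_at_top[of 1]
      proof eventually_elim
        case (elim n)
        then have sn: "s n > 0" using p(6)[OF elim] by simp
        show ?case
        proof (cases "c n \<le> 1 / lam n")
          case True
          then have "c n / s n \<le> 1 / lam n / s n" using sn by (intro divide_right_mono) auto
          then show ?thesis using True by (simp only: max_absorb2)
        next
          case False
          then have le: "1 / lam n \<le> c n" by simp
          then have "1 / lam n / s n \<le> c n / s n" using sn by (intro divide_right_mono) auto
          then show ?thesis using le by (simp only: max_absorb1)
        qed
      qed
      ultimately have "(\<lambda>n. max (c n) (1 / lam n) / s n) \<longlonglongrightarrow> max 0 0"
        by (rule Lim_transform_eventually)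
      then show "(\<lambda>n. max (c n) (1 / lam n) / s n) \<longlonglongrightarrow> 0" by simp
    qed
    show ?thesis
      using disc_product disc_window window_cutoff ratio product_ratio cont_window cont_product by blast
  qed
  \<comment> \<open>Cutoff implies the product criterion, which implies the ratio criterion, which implies the window
    and hence cutoff.\<close>
  show ?thesis
    using tv cont_product product_ratio cont_window window_cutoff disc by blast
qed

end
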